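(* Let $d\ge3$, $n\ge2$ be integers and let $(\mathbb B,b)$ be the complex and $\mathfrak B$ the basis of $\mathbb B$ defined in the context. (a) The matrix of $b_1$ with respect to $\mathfrak B$ is described as follows. (i) If $X^{(1)}_{a_1,m}\in\mathfrak B$, then $b_1(X^{(1)}_{a_1,m})=x_1\sum_{m_1\in\binom{x_1,\dots,x_d}{n-1}}m_1Q_{m_1,\frac m{x_{a_1}}}$. (ii) If $Y^{(1)}_{a_1,m}\in\mathfrak B$, then $b_1(Y^{(1)}_{a_1,m})=\pmb\delta x_{a_1}m-x_1\sum_{m_1\in\binom{x_1,\dots,x_d}{n-2}}\sum_{m_2\in\binom{x_1,\dots,x_d}{n-1}}m_2Q_{m_2,x_1m_1}t_{x_{a_1}m_1m}$. (b) Let $2\le r\le d-1$. (i) If $X^{(r)}_{a_1,\dots,a_r,m}\in\mathfrak B$ and $\gamma$ is the largest integer with $[2,\gamma]\subseteq\{a_1,\dots,a_r\}$, then $b_r(X^{(r)}_{a_1,\dots,a_r,m})$ is the sum of the following seven terms: $$x_1\sum_{\ell=2}^{\gamma}\sum_{k=\ell}^{r}\sum_{m_2\in\binom{x_\ell,\dots,x_d}{n-1}}\sum_{m_1\in\binom{x_1,\dots,x_d}{n-2}}(-1)^k\Big[\chi(x_{a_k}|m)t_{m_1m_2x_\ell}Q_{x_1m_1,\frac m{x_{a_k}}}-\chi(x_\ell|m)t_{m_1m_2x_{a_k}}Q_{x_1m_1,\frac m{x_\ell}}\Big]X^{(r-1)}_{a_1,\dots,\widehat{a_k},\dots,a_r,x_\ell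 m_2},$$ $$x_1\sum_{\gamma\le j<k\le r}\ \sum_{m_2\in\binom{x_{\gamma+1},\dots,x_d}{n-1}}\sum_{m_1\in\binom{x_1,\dots,x_d}{n-2}}(-1)^{\gamma+j+k}\Big[\chi(x_{a_k}|m)t_{m_1m_2x_{a_j}}Q_{x_1m_1,\frac m{x_{a_k}}}-\chi(x_{a_j}|m)t_{m_1m_2x_{a_k}}Q_{x_1m_1,\frac m{x_{a_j}}}\Big]X^{(r-1)}_{a_1,\dots,a_{\gamma-1},\gamma+1,a_\gamma,\dots,\widehat{a_j},\dots,\widehat{a_k},\dots,a_r,x_{\gamma+1}m_2},$$ $$\pmb\delta\sum_{j=1}^{\operatorname{least}(m)-1}\sum_{k=j+1}^{r}x_{a_j}(-1)^{k+1}\chi(x_{a_k}|m)X^{(r-1)}_{a_1,\dots,\widehat{a_k},\dots,a_r,\frac{x_{j+1}m}{x_{a_k}}},$$ $$\pmb\delta\sum_{j=\operatorname{least}(m)}^{r}x_{a_j}(-1)^jX^{(r-1)}_{a_1,\dots,\widehat{a_j},\dots,a_r,m},$$ $$x_1\sum_{k=2}^{r}\sum_{m_1\in\binom{x_{a_1},\dots,x_d}{n-1}}(-1)^k\Big[\chi(x_{a_k}|m)Q_{m_1,\frac m{x_{a_k}}}-\chi(x_{a_k}|m_1)\chi(x_{a_1}|m)Q_{\frac{x_{a_1}m_1}{x_{a_k}},\frac m{x_{a_1}}}\Big]Y^{(r-1)}_{a_1,\dots,\widehat{a_k},\dots,a_r,m_1},$$ $$x_1\sum_{\ell=a_1+1}^{a_2-1}\sum_{k=2}^{r}\sum_{m_1\in\binom{x_\ell,\dots,x_d}{n-1}}(-1)^{k+1}\chi(x_{a_k}|m_1)\chi(x_{a_1}|m)Q_{\frac{x_\ell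 m_1}{x_{a_k}},\frac m{x_{a_1}}}Y^{(r-1)}_{\ell,a_2,\dots,\widehat{a_k},\dots,a_r,m_1},$$ $$-x_1\sum_{m_1\in\binom{x_{a_2},\dots,x_d}{n-1}}\chi(x_{a_1}|m)Q_{m_1,\frac m{x_{a_1}}}Y^{(r-1)}_{a_2,\dots,a_r,m_1}.$$ (ii) If $Y^{(r)}_{a_1,\dots,a_r,m}\in\mathfrak B$ and $\gamma$ is the largest integer with $[2,\gamma]\subseteq\{a_1,\dots,a_r\}$, then $b_r(Y^{(r)}_{a_1,\dots,a_r,m})$ is the sum of the following nine terms: $$x_1\sum_{\ell=2}^{\gamma}\sum_{k=\ell}^{r}\sum_{m_3\in\binom{x_\ell,\dots,x_d}{n-1}}\sum_{m_1,m_2\in\binom{x_1,\dots,x_d}{n-2}}(-1)^kQ_{x_1m_1,x_1m_2}\big[t_{x_\ell mm_2}t_{x_{a_k}m_1m_3}-t_{x_{a_k}mm_2}t_{x_\ell m_1m_3}\big]X^{(r-1)}_{a_1,\dots,\widehat{a_k},\dots,a_r,x_\ell m_3},$$ $$x_1\sum_{\gamma\le j<k\le r}\ \sum_{m_3\in\binom{x_{\gamma+1},\dots,x_d}{n-1}}\sum_{m_1,m_2\in\binom{x_1,\dots,x_d}{n-2}}(-1)^{j+\gamma+k}Q_{x_1m_1,x_1m_2}\big[t_{x_{a_j}mm_2}t_{x_{a_k}m_1m_3}-t_{x_{a_k}mm_2}t_{x_{a_j}m_1m_3}\big]X^{(r-1)}_{a_1,\dots,a_{\gamma-1},\gamma+1,a_\gamma,\dots,\widehat{a_j},\dots,\widehat{a_k},\dots,a_r,x_{\gamma+1}m_3},$$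 $$x_1\sum_{\ell=2}^{a_1-1}\sum_{1\le j<k\le r}\ \sum_{m_1\in\binom{x_\ell,\dots,x_d}{n-1}}\sum_{m_2\in\binom{x_1,\dots,x_d}{n-2}}(-1)^{k+j}\Big[\chi(x_{a_j}|m_1)t_{x_{a_k}mm_2}Q_{\frac{x_\ell m_1}{x_{a_j}},x_1m_2}-\chi(x_{a_k}|m_1)t_{x_{a_j}mm_2}Q_{\frac{x_\ell m_1}{x_{a_k}},x_1m_2}\Big]Y^{(r-1)}_{\ell,a_1,\dots,\widehat{a_j},\dots,\widehat{a_k},\dots,a_r,m_1},$$ $$x_1\sum_{k=2}^{r}\sum_{m_1\in\binom{x_{a_1},\dots,x_d}{n-1}}\sum_{m_2\in\binom{x_1,\dots,x_d}{n-2}}(-1)^k\Big[\chi(x_{a_k}|m_1)t_{x_{a_1}mm_2}Q_{\frac{x_{a_1}m_1}{x_{a_k}},x_1m_2}-t_{x_{a_k}mm_2}Q_{m_1,x_1m_2}\Big]Y^{(r-1)}_{a_1,\dots,\widehat{a_k},\dots,a_r,m_1},$$ $$x_1\sum_{\ell=a_1+1}^{a_2-1}\sum_{k=2}^{r}\sum_{m_1\in\binom{x_\ell,\dots,x_d}{n-1}}\sum_{m_2\in\binom{x_1,\dots,x_d}{n-2}}(-1)^k\chi(x_{a_k}|m_1)t_{x_{a_1}mm_2}Q_{\frac{x_\ell m_1}{x_{a_k}},x_1m_2}Y^{(r-1)}_{\ell,a_2,\dots,\widehat{a_k},\dots,a_r,m_1},$$ $$x_1\sum_{m_1\in\binom{x_{a_2},\dots,x_d}{n-1}}\sum_{m_2\in\binom{x_1,\dots,x_d}{n-2}}t_{x_{a_1}mm_2}Q_{m_1,x_1m_2}Y^{(r-1)}_{a_2,\dots,a_r,m_1},$$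 $$\pmb\delta\sum_{j=2}^{r}(-1)^jx_{a_j}Y^{(r-1)}_{a_1,\dots,\widehat{a_j},\dots,a_r,m},$$ $$-\pmb\delta x_{a_1}\chi(a_2\le\operatorname{least}(m))Y^{(r-1)}_{a_2,\dots,a_r,m},$$ $$-\pmb\delta x_{a_1}\chi(\operatorname{least}(m)<a_2)\sum_{k=2}^{r}(-1)^kY^{(r-1)}_{\operatorname{least}(m),a_2,\dots,\widehat{a_k},\dots,a_r,\frac{x_{a_k}m}{\operatorname{init}(m)}}.$$ (c) The matrix of $b_d$ with respect to $\mathfrak B$ is described by $$b_d(X^{(d)})=\sum_{m\in\binom{x_2,\dots,x_d}{n}}\Big[\pmb\delta m-\sum_{m_1\in\binom{x_1,\dots,x_d}{n-2}}\sum_{m_2\in\binom{x_1,\dots,x_d}{n-1}}x_1m_2Q_{m_2,x_1m_1}t_{m_1m}\Big]X^{(d-1)}_{2,\dots,d,m}-\sum_{m\in\binom{x_2,\dots,x_d}{n-1}}\sum_{m_1\in\binom{x_1,\dots,x_d}{n-1}}x_1m_1Q_{m_1,m}Y^{(d-1)}_{2,\dots,d,m}.$$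
   Context: Notation. Unadorned $\otimes,\bigwedge,\operatorname{Sym},D$ (divided powers), $(\ )^*$ are over $\mathbb Z$. $U$ is a free $\mathbb Z$-module with basis $x_1,\dots,x_d$, dual basis $x_1^*,\dots,x_d^*$ of $U^*$; $U_0=\bigoplus_{i\ge2}\mathbb Zx_i$, $U_0^*=\bigoplus_{i\ge2}\mathbb Zx_i^*$. $\operatorname{Sym}_\bullet U$ acts on $D_\bullet(U^* )$ (the graded dual of $\operatorname{Sym}_\bullet U$) by contraction. $U^*$ acts on $\bigwedge^\bullet U$ by $u^*(u_1\wedge\dots\wedge u_r)=\sum_i(-1)^{i+1}u^*(u_i)\,u_1\wedge\dots\widehat{u_i}\dots\wedge u_r$. $\binom{x_i,\dots,x_d}{s}$ is the set of monomials of degree $s$ in $x_i,\dots,x_d$; for $m=x_1^{a_1}\cdots x_d^{a_d}$, $m^*={x_1^*}^{(a_1)}\cdots{x_d^*}^{(a_d)}$. $\mathfrak R=\operatorname{Sym}_\bullet(U\oplus\operatorname{Sym}_{2n-2}U)$ is the polynomial ring $\mathbb Z[x_1,\dots,x_d,\{t_m\mid m\in\binom{x_1,\dots,x_d}{2n-2}\}]$, where $t_m$ is the element $m$ of the summand $\operatorname{Sym}_{2n-2}U$. $\Phi=\sum_mt_m\otimes m^*\in\mathfrak R\otimes D_{2n-2}(U^* )$ and $\widetilde\Phi=\sum_mt_m\otimes(x_1m)^*\in\mathfrak R\otimes D_{2n-1}(U^* )$ (sums over $m\in\binom{x_1,\dots,x_d}{2n-2}$). $T=(t_{m_1m_2})$,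 with $m_1,m_2$ running over $\binom{x_1,\dots,x_d}{n-1}$ in the same order; $\pmb\delta=\det T$; $Q=(Q_{m_1,m_2})$ is the classical adjoint of $T$; $q:D_{n-1}(U^* )\to\mathfrak R\otimes\operatorname{Sym}_{n-1}U$ is $q(m_2^* )=\sum_{m_1}Q_{m_1,m_2}\otimes m_1$. $\kappa(\theta\otimes\mu)=\sum_{i=1}^d x_i^*(\theta)\otimes x_i\mu$ and $\eta(\theta\otimes\nu)=\sum_{i=1}^d x_i^*(\theta)\otimes x_i(\nu)$ for $\theta\in\bigwedge^aU$, $\mu\in\operatorname{Sym}_bU$, $\nu\in D_b(U^* )$; $L_{a,b}U_0=\ker(\kappa:\bigwedge^aU_0\otimes\operatorname{Sym}_bU_0\to\bigwedge^{a-1}U_0\otimes\operatorname{Sym}_{b+1}U_0)$, $K_{a,b}U_0=\ker(\eta:\bigwedge^aU_0\otimes D_b(U_0^* )\to\bigwedge^{a-1}U_0\otimes D_{b-1}(U_0^* ))$. Maps are extended $\mathfrak R$-linearly; an element of $\operatorname{Sym}_\bullet U$ is viewed in $\mathfrak R$ when a value in $\mathfrak R$ is required. $\chi(\text{statement})$ is $1$ if the statement is true and $0$ if false, and a product containing $\chi(x_i|m)=0$ is $0$ even if it also contains the symbol $\frac m{x_i}$. For a monomial $m$ of positive degree, $\operatorname{least}(m)=i$ and $\operatorname{init}(m)=x_i$ where $i$ is the least index with $x_i|m$. $[a,b]=\{i\in\mathbb Z\mid a\le i\le b\}$. A hat means omission. The complex $(\mathbb B,b)$: $B_0=\mathfrak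 R$; $B_r=\mathfrak R\otimes(K_{r-1,n-1}U_0\oplus L_{r-1,n}U_0)$ for $1\le r\le d-1$; $B_d=\mathfrak R\otimes\bigwedge^{d-1}U_0$. Let $\operatorname{proj}:\operatorname{Sym}_{n-1}U\to\operatorname{Sym}_{n-1}U_0$ be induced by the projection $U\to U_0$ killing $x_1$, and $\mathrm{Kos}(\theta)=\sum_{i=1}^dx_i\otimes x_i^*(\theta)$. $b_1(\nu)=x_1q(\nu)$ for $\nu\in K_{0,n-1}U_0=D_{n-1}(U_0^* )$; $b_1(\mu)=\pmb\delta\mu-x_1q(\mu(\widetilde\Phi))$ for $\mu\in L_{0,n}U_0=\operatorname{Sym}_nU_0$. For $2\le r\le d-1$, $\sum_i\theta_i\otimes\nu_i\in K_{r-1,n-1}U_0$: $b_r(\sum_i\theta_i\otimes\nu_i)$ has component $-x_1\otimes\sum_i\eta(\theta_i\otimes[q(\nu_i)](\widetilde\Phi))+\pmb\delta\sum_i\mathrm{Kos}(\theta_i)\otimes\nu_i$ in $\mathfrak R\otimes K_{r-2,n-1}U_0$ and $-x_1\otimes\sum_i\kappa(\theta_i\otimes\operatorname{proj}(q(\nu_i)))$ in $\mathfrak R\otimes L_{r-2,n}U_0$. For $2\le r\le d-1$, $\sum_i\theta_i\otimes\mu_i\in L_{r-1,n}U_0$: $b_r(\sum_i\theta_i\otimes\mu_i)$ has component $x_1\otimes\sum_i\eta(\theta_i\otimes[q(\mu_i(\widetilde\Phi))](\widetilde\Phi))$ in $\mathfrak R\otimes K_{r-2,n-1}U_0$ and $x_1\otimes\sum_i\kappa(\theta_i\otimes\operatorname{proj}(q(\mu_i(\widetilde\Phi))))+\pmb\delta\sum_i\mathrm{Kos}(\theta_i)\otimes\mu_i$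 in $\mathfrak R\otimes L_{r-2,n}U_0$. For $\omega\in\bigwedge^{d-1}U_0$: $b_d(\omega)$ has component $\sum_{m\in\binom{x_2,\dots,x_d}{n}}[\pmb\delta m-x_1q(m(\widetilde\Phi))]\otimes\eta(\omega\otimes m^* )$ in $\mathfrak R\otimes K_{d-2,n-1}U_0$ and $-\sum_{m\in\binom{x_2,\dots,x_d}{n-1}}x_1q(m^* )\otimes\kappa(\omega\otimes m)$ in $\mathfrak R\otimes L_{d-2,n}U_0$. The basis $\mathfrak B$: $Y^{(0)}=1$ for $B_0$; for $1\le r\le d-1$, the basis of $B_r$ consists of the elements $X^{(r)}_{a_1,\dots,a_r,m}=\eta(x_{a_1}\wedge\dots\wedge x_{a_r}\otimes m^* )\in K_{r-1,n-1}U_0$ with $2\le a_1<\dots<a_r\le d$, $m\in\binom{x_2,\dots,x_d}{n}$ and $[2,\operatorname{least}(m)]\subseteq\{a_1,\dots,a_r\}$, together with the elements $Y^{(r)}_{a_1,\dots,a_r,m}=\kappa(x_{a_1}\wedge\dots\wedge x_{a_r}\otimes m)\in L_{r-1,n}U_0$ with $2\le a_1<\dots<a_r\le d$ and $m\in\binom{x_{a_1},\dots,x_d}{n-1}$; and $X^{(d)}=x_2\wedge\dots\wedge x_d$ for $B_d$. *)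

theory Defs
  imports
    "HOL-Library.Poly_Mapping"
    "HOL-Library.Product_Plus"
    "HOL-Library.FuncSet"
    "Jordan_Normal_Form.Determinant"
begin

text \<open>A monomial \<open>x\<^sub>1^a\<^sub>1 \<cdots> x\<^sub>d^a\<^sub>d\<close> is its finitely supported exponent function. Hence products of
  monomials are written \<open>+\<close>, exact quotients \<open>-\<close>, and the monomial \<open>x\<^sub>i\<close> is \<open>mx i\<close>.\<close>

type_synonym mon = "nat \<Rightarrow>\<^sub>0 nat"

definition mx :: "nat \<Rightarrow> mon" where
  "mx i = Poly_Mapping.single i 1"

definition mdeg :: "mon \<Rightarrow> nat" where
  "mdeg m = (\<Sum>i\<in>Poly_Mapping.keys m. Poly_Mapping.lookup m i)"

definition dvdx :: "nat \<Rightarrow> mon \<Rightarrow> bool" where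
  "dvdx i m \<longleftrightarrow> i \<in> Poly_Mapping.keys m"

definition least :: "mon \<Rightarrow> nat" where
  "least m = Min (Poly_Mapping.keys m)"

text \<open>The monomials of degree \<open>s\<close> in \<open>x\<^sub>k, \<dots>, x\<^sub>d\<close>.\<close>

definition mons :: "nat \<Rightarrow> nat \<Rightarrow> nat \<Rightarrow> mon set" where
  "mons d k s = {m. Poly_Mapping.keys m \<subseteq> {k..d} \<and> mdeg m = s}"

section \<open>Free modules\<close>

text \<open>\<open>'k \<Rightarrow>\<^sub>0 'c\<close> is the free \<open>'c\<close>-module on \<open>'k\<close>. With \<open>e\<^sub>S = x\<^sub>s\<^sub>1 \<and> \<dots> \<and> x\<^sub>s\<^sub>r\<close> for
  \<open>S = {s\<^sub>1 < \<dots> < s\<^sub>r}\<close>, the following free modules are used, in each case after extension of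
  scalars to \<open>'c\<close>:
  \<^item> \<open>nat set \<Rightarrow>\<^sub>0 'c\<close> is the exterior algebra, with basis \<open>e\<^sub>S\<close>, \<open>S\<close> finite;
  \<^item> \<open>mon \<Rightarrow>\<^sub>0 'c\<close> is the symmetric algebra, with basis the monomials, whose multiplication is
    the convolution product of \<^theory>\<open>HOL-Library.Poly_Mapping\<close>;
  \<^item> \<open>mon \<Rightarrow>\<^sub>0 'c\<close> is also its graded dual, the divided power algebra: \<open>\<nu>\<close> stands for the
    functional with value \<open>lookup \<nu> m\<close> on \<open>m\<close>, so that \<open>single m 1\<close> is the dual basis element
    \<open>m\<^sup>*\<close>;
  \<^item> \<open>nat set \<times> mon \<Rightarrow>\<^sub>0 'c\<close> is the tensor product of the exterior algebra with either of
    these.\<close>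

definition smul :: "'c::comm_ring_1 \<Rightarrow> ('k \<Rightarrow>\<^sub>0 'c) \<Rightarrow> ('k \<Rightarrow>\<^sub>0 'c)" where
  "smul c p = Poly_Mapping.map ((*) c) p"

definition lin :: "('k \<Rightarrow> ('l \<Rightarrow>\<^sub>0 'c::comm_ring_1)) \<Rightarrow> ('k \<Rightarrow>\<^sub>0 'c) \<Rightarrow> ('l \<Rightarrow>\<^sub>0 'c)" where
  "lin f p = (\<Sum>k\<in>Poly_Mapping.keys p. smul (Poly_Mapping.lookup p k) (f k))"

definition tens :: "('k \<Rightarrow>\<^sub>0 'c::comm_ring_1) \<Rightarrow> ('l \<Rightarrow>\<^sub>0 'c) \<Rightarrow> ('k \<times> 'l \<Rightarrow>\<^sub>0 'c)" where
  "tens p q = (\<Sum>k\<in>Poly_Mapping.keys p. \<Sum>l\<in>Poly_Mapping.keys q. Poly_Mapping.single (k, l) (Poly_Mapping.lookup p k * Poly_Mapping.lookup q l))"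

abbreviation bas :: "'k \<Rightarrow> ('k \<Rightarrow>\<^sub>0 'c::comm_ring_1)" where
  "bas k \<equiv> Poly_Mapping.single k 1"

lemma lookup_smul [simp]: "Poly_Mapping.lookup (smul c p) k = c * Poly_Mapping.lookup p k"
  by (simp add: smul_def map.rep_eq when_def)

lemma smul_simps [simp]:
  "smul c 0 = 0" "smul 0 p = 0" "smul 1 p = p"
  "smul (- a) p = - smul a p" "smul a (- p) = - smul a p"
  "smul c (Poly_Mapping.single k b) = Poly_Mapping.single k (c * b)"
  by (auto intro!: poly_mapping_eqI simp: lookup_single when_def algebra_simps)

lemma smul_mult: "smul (a * b) p = smul a (smul b p)"
  by (auto intro!: poly_mapping_eqI simp: algebra_simps)

lemma smul_add: "smul c (p + p') = smul c p + smul c p'"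
  and smul_add_left: "smul (a + b) p = smul a p + smul b p"
  by (auto intro!: poly_mapping_eqI simp: lookup_add algebra_simps)

lemma smul_sum: "smul c (\<Sum>i\<in>A. f i) = (\<Sum>i\<in>A. smul c (f i))"
  by (induction A rule: infinite_finite_induct) (auto simp: smul_add)

lemma lin_superset:
  assumes "finite A" "Poly_Mapping.keys p \<subseteq> A"
  shows "lin f p = (\<Sum>k\<in>A. smul (Poly_Mapping.lookup p k) (f k))"
  unfolding lin_def using assms
  by (intro sum.mono_neutral_left) (auto simp: in_keys_iff)

lemma lin_single [simp]: "lin f (Poly_Mapping.single k c) = smul c (f k)"
  by (subst lin_superset[of "{k}"]) (auto simp: when_def)

lemma lin_0 [simp]: "lin f 0 = 0"
  by (simp add: lin_def)

lemma lin_add: "lin f (p + p') = lin f p + lin f p'"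
proof -
  let ?A = "Poly_Mapping.keys p \<union> Poly_Mapping.keys p'"
  have "Poly_Mapping.keys (p + p') \<subseteq> ?A" by (rule keys_add)
  then show ?thesis
    by (simp add: lin_superset[of ?A] lookup_add smul_add_left sum.distrib)
qed

lemma lin_smul: "lin f (smul c p) = smul c (lin f p)"
proof -
  have "Poly_Mapping.keys (smul c p) \<subseteq> Poly_Mapping.keys p"
    by (auto simp: in_keys_iff)
  then show ?thesis
    by (simp add: lin_superset[of "Poly_Mapping.keys p"] smul_sum smul_mult)
qed

lemma lin_uminus: "lin f (- p) = - lin f p"
  using lin_smul[of f "-1" p] by simp

lemma lin_diff: "lin f (p - p') = lin f p - lin f p'"
  using lin_add[of f p "- p'"] lin_uminus[of f p'] by simp

lemma lin_sum: "lin f (\<Sum>i\<in>A. g i) = (\<Sum>i\<in>A. lin f (g i))"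
  by (induction A rule: infinite_finite_induct) (auto simp: lin_add)

lemma poly_mapping_decomp:
  "p = (\<Sum>k\<in>Poly_Mapping.keys p. smul (Poly_Mapping.lookup p k) (bas k))"
proof (rule poly_mapping_eqI)
  fix k
  have "(\<Sum>l\<in>Poly_Mapping.keys p. (Poly_Mapping.lookup p l when l = k))
        = (\<Sum>l\<in>Poly_Mapping.keys p. if l = k then Poly_Mapping.lookup p k else 0)"
    by (rule sum.cong) (auto simp: when_def)
  then show "Poly_Mapping.lookup p k = Poly_Mapping.lookup
      (\<Sum>k\<in>Poly_Mapping.keys p. smul (Poly_Mapping.lookup p k) (bas k)) k"
    by (simp add: lookup_sum lookup_single in_keys_iff)
qed

section \<open>Exterior algebra, contraction, and the maps eta and kappa\<close>

definition wedge1 :: "nat \<Rightarrow> (nat set \<Rightarrow>\<^sub>0 'c::comm_ring_1) \<Rightarrow> (nat set \<Rightarrow>\<^sub>0 'c)" where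
  "wedge1 i = lin (\<lambda>S. if i \<in> S then 0
                      else Poly_Mapping.single (insert i S) ((-1) ^ card {s\<in>S. s < i}))"

definition wedge :: "nat list \<Rightarrow> (nat set \<Rightarrow>\<^sub>0 'c::comm_ring_1)" where
  "wedge as = foldr wedge1 as (bas {})"

text \<open>The action of \<open>x\<^sub>i\<^sup>*\<close> on the exterior algebra, see \<open>dcon_wedge\<close> below.\<close>

definition dcon :: "nat \<Rightarrow> (nat set \<Rightarrow>\<^sub>0 'c::comm_ring_1) \<Rightarrow> (nat set \<Rightarrow>\<^sub>0 'c)" where
  "dcon i = lin (\<lambda>S. if i \<in> S then Poly_Mapping.single (S - {i}) ((-1) ^ card {s\<in>S. s < i})
                    else 0)"

text \<open>The contraction action of \<open>s\<close> in the symmetric algebra on the functional \<open>\<nu>\<close> is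
  \<open>(s \<nu>)(u) = \<nu>(s u)\<close>.\<close>

definition contract :: "(mon \<Rightarrow>\<^sub>0 'c::comm_ring_1) \<Rightarrow> (mon \<Rightarrow>\<^sub>0 'c) \<Rightarrow> (mon \<Rightarrow>\<^sub>0 'c)" where
  "contract s \<nu> = (\<Sum>m\<in>Poly_Mapping.keys s. smul (Poly_Mapping.lookup s m) (Poly_Mapping.map_key ((+) m) \<nu>))"

definition kappa :: "nat \<Rightarrow> (nat set \<times> mon \<Rightarrow>\<^sub>0 'c::comm_ring_1) \<Rightarrow> (nat set \<times> mon \<Rightarrow>\<^sub>0 'c)" where
  "kappa d = lin (\<lambda>(S, m). \<Sum>i=1..d. tens (dcon i (bas S)) (bas (mx i) * bas m))"

definition eta :: "nat \<Rightarrow> (nat set \<times> mon \<Rightarrow>\<^sub>0 'c::comm_ring_1) \<Rightarrow> (nat set \<times> mon \<Rightarrow>\<^sub>0 'c)" where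
  "eta d = lin (\<lambda>(S, m). \<Sum>i=1..d. tens (dcon i (bas S)) (contract (bas (mx i)) (bas m)))"

lemma lookup_contract:
  "Poly_Mapping.lookup (contract s \<nu>) u
     = (\<Sum>m\<in>Poly_Mapping.keys s. Poly_Mapping.lookup s m * Poly_Mapping.lookup \<nu> (m + u))"
  by (simp add: contract_def lookup_sum map_key.rep_eq)

lemma contract_bas:
  "contract (bas (mx i)) (bas m)
     = (if dvdx i m then bas (m - mx i) else (0 :: mon \<Rightarrow>\<^sub>0 'c::comm_ring_1))"
proof -
  have *: "m = mx i + u \<longleftrightarrow> dvdx i m \<and> m - mx i = u" for u
  proof
    assume "m = mx i + u"
    then show "dvdx i m \<and> m - mx i = u"
      by (simp add: dvdx_def in_keys_iff lookup_add mx_def)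
  next
    assume a: "dvdx i m \<and> m - mx i = u"
    show "m = mx i + u"
    proof (rule poly_mapping_eqI)
      fix k
      have "u = m - mx i" using a by simp
      then show "Poly_Mapping.lookup m k = Poly_Mapping.lookup (mx i + u) k"
        using a by (auto simp: dvdx_def in_keys_iff lookup_add lookup_minus mx_def
            lookup_single when_def)
    qed
  qed
  show ?thesis
    by (rule poly_mapping_eqI) (auto simp: lookup_contract lookup_single when_def *)
qed

lemma wedge_Cons: "wedge (a # as) = wedge1 a (wedge as)"
  by (simp add: wedge_def)

lemma wedge_sorted:
  "sorted_wrt (<) as \<Longrightarrow> wedge as = (bas (set as) :: nat set \<Rightarrow>\<^sub>0 'c::comm_ring_1)"
proof (induction as)
  case Nil
  then show ?case by (simp add: wedge_def)
next
  case (Cons a as)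
  have "{s \<in> set as. s < a} = {}" "a \<notin> set as" using Cons.prems by auto
  then show ?case using Cons unfolding wedge_Cons wedge1_def
    by (simp del: Collect_empty_eq)
qed

lemma dcon_wedge1_bas:
  assumes "finite S"
  shows "dcon i (wedge1 j (bas S)) = smul (of_bool (i = j)) (bas S)
           - wedge1 j (dcon i (bas S) :: nat set \<Rightarrow>\<^sub>0 'c::comm_ring_1)"
proof (cases "i = j")
  case True
  have "{s \<in> S - {j}. s < j} = {s \<in> S. s < j}" "{s. (s = j \<or> s \<in> S) \<and> s < j} = {s \<in> S. s < j}"
    by auto
  moreover have "(-1) ^ c * (-1) ^ c = (1 :: 'c)" for c :: nat
    by (simp flip: power_mult_distrib)
  ultimately show ?thesis
    using True by (auto simp: dcon_def wedge1_def insert_absorb)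
next
  case False
  show ?thesis
  proof (cases "i \<in> S \<and> j \<notin> S")
    case True
    have set_eq: "insert j S - {i} = insert j (S - {i})" using False by auto
    have "(-1) ^ card {s \<in> S. s < j} * (-1) ^ card {s \<in> insert j S. s < i}
        = - ((-1) ^ card {s \<in> S. s < i} * (-1) ^ card {s \<in> S - {i}. s < j} :: 'c)"
    proof (cases "j < i")
      case True
      have "{s \<in> insert j S. s < i} = insert j {s \<in> S. s < i}"
        "{s \<in> S - {i}. s < j} = {s \<in> S. s < j}" using True by auto
      then show ?thesis using assms \<open>i \<in> S \<and> j \<notin> S\<close> by (simp add: mult.commute)
    next
      case False
      have "{s \<in> insert j S. s < i} = {s \<in> S. s < i}"
        "{s \<in> S. s < j} = insert i {s \<in> S - {i}. s < j}"
        using False \<open>i \<noteq> j\<close> \<open>i \<in> S \<and> j \<notin> S\<close> by auto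
      moreover have "i \<notin> {s \<in> S - {i}. s < j}" by simp
      ultimately show ?thesis using assms by (simp only: card_insert_disjoint) (simp add: mult.commute)
    qed
    then show ?thesis
      using True False by (simp add: dcon_def wedge1_def set_eq single_uminus)
  next
    case not: False
    then show ?thesis using False by (auto simp: dcon_def wedge1_def)
  qed
qed

lemma finite_keys_wedge:
  "S \<in> Poly_Mapping.keys (wedge as :: nat set \<Rightarrow>\<^sub>0 'c::comm_ring_1) \<Longrightarrow> finite S"
proof (induction as arbitrary: S)
  case Nil
  then show ?case by (simp add: wedge_def split: if_splits)
next
  case (Cons a as)
  let ?f = "\<lambda>T. smul (Poly_Mapping.lookup (wedge as :: nat set \<Rightarrow>\<^sub>0 'c) T)
     (if a \<in> T then 0 else Poly_Mapping.single (insert a T) ((-1) ^ card {s\<in>T. s < a}))"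
  have "S \<in> Poly_Mapping.keys (\<Sum>T\<in>Poly_Mapping.keys (wedge as :: nat set \<Rightarrow>\<^sub>0 'c). ?f T)"
    using Cons.prems by (simp only: wedge_Cons wedge1_def lin_def)
  then obtain T where "T \<in> Poly_Mapping.keys (wedge as :: nat set \<Rightarrow>\<^sub>0 'c)"
      "S \<in> Poly_Mapping.keys (?f T)"
    using subsetD[OF keys_sum] by (metis (no_types, lifting) UN_E)
  with Cons.IH[of T] show ?case by (auto split: if_splits)
qed

lemma dcon_wedge1:
  assumes "\<forall>S\<in>Poly_Mapping.keys w. finite S"
  shows "dcon i (wedge1 j w) = smul (of_bool (i = j)) w
           - wedge1 j (dcon i w :: nat set \<Rightarrow>\<^sub>0 'c::comm_ring_1)"
proof -
  let ?K = "Poly_Mapping.keys w" and ?c = "Poly_Mapping.lookup w"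
  have w: "w = (\<Sum>S\<in>?K. smul (?c S) (bas S))" by (rule poly_mapping_decomp)
  have dc: "dcon i' (\<Sum>S\<in>A. smul (c S) (g S)) = (\<Sum>S\<in>A. smul (c S) (dcon i' (g S)))"
    and we: "wedge1 i' (\<Sum>S\<in>A. smul (c S) (g S)) = (\<Sum>S\<in>A. smul (c S) (wedge1 i' (g S)))"
    for i' A c and g :: "nat set \<Rightarrow> nat set \<Rightarrow>\<^sub>0 'c"
    by (simp_all only: dcon_def wedge1_def lin_sum lin_smul)
  have 1: "wedge1 j w = (\<Sum>S\<in>?K. smul (?c S) (wedge1 j (bas S)))"
    by (subst w) (rule we)
  have 2: "dcon i w = (\<Sum>S\<in>?K. smul (?c S) (dcon i (bas S)))"
    by (subst w) (rule dc)
  have "dcon i (wedge1 j w) = (\<Sum>S\<in>?K. smul (?c S)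
           (smul (of_bool (i = j)) (bas S) - wedge1 j (dcon i (bas S))))"
    unfolding 1 dc using assms by (intro sum.cong refl) (simp only: dcon_wedge1_bas)
  also have "\<dots> = (\<Sum>S\<in>?K. smul (of_bool (i = j)) (smul (?c S) (bas S))
                        - smul (?c S) (wedge1 j (dcon i (bas S))))"
    by (intro sum.cong refl) (simp only: diff_conv_add_uminus smul_add smul_simps mult_1 mult_1_right
        mult.commute)
  also have "\<dots> = smul (of_bool (i = j)) w - wedge1 j (dcon i w)"
    by (simp only: sum_subtractf 2 we flip: smul_sum poly_mapping_decomp)
  finally show ?thesis .
qed

lemma dcon_wedge:
  "dcon i (wedge as) = (\<Sum>k<length as. smul ((-1) ^ k * of_bool (as ! k = i))
     (wedge (take k as @ drop (Suc k) as) :: nat set \<Rightarrow>\<^sub>0 'c::comm_ring_1))"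
proof (induction as)
  case Nil
  then show ?case by (simp add: wedge_def dcon_def)
next
  case (Cons a as)
  have fin: "\<forall>S\<in>Poly_Mapping.keys (wedge as :: nat set \<Rightarrow>\<^sub>0 'c). finite S"
    using finite_keys_wedge by blast
  have "wedge1 a (dcon i (wedge as)) = (\<Sum>k<length as. smul ((-1) ^ k * of_bool (as ! k = i))
          (wedge (a # take k as @ drop (Suc k) as) :: nat set \<Rightarrow>\<^sub>0 'c))"
    unfolding Cons wedge_Cons by (simp only: wedge1_def lin_sum lin_smul)
  then have "dcon i (wedge (a # as)) = smul (of_bool (i = a)) (wedge as)
      - (\<Sum>k<length as. smul ((-1) ^ k * of_bool (as ! k = i))
          (wedge (a # take k as @ drop (Suc k) as) :: nat set \<Rightarrow>\<^sub>0 'c))"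
    by (simp only: wedge_Cons dcon_wedge1[OF fin])
  then show ?case
    by (simp only: length_Cons sum.lessThan_Suc_shift)
       (simp add: sum_negf eq_commute)
qed

definition ext0 :: "nat \<Rightarrow> nat \<Rightarrow> nat set set" where
  "ext0 d a = {S. S \<subseteq> {2..d} \<and> card S = a}"

definition Kmod :: "nat \<Rightarrow> nat \<Rightarrow> nat \<Rightarrow> (nat set \<times> mon \<Rightarrow>\<^sub>0 int) set" where
  "Kmod d a b = {z. Poly_Mapping.keys z \<subseteq> ext0 d a \<times> mons d 2 b \<and> eta d z = 0}"

definition Lmod :: "nat \<Rightarrow> nat \<Rightarrow> nat \<Rightarrow> (nat set \<times> mon \<Rightarrow>\<^sub>0 int) set" where
  "Lmod d a b = {z. Poly_Mapping.keys z \<subseteq> ext0 d a \<times> mons d 2 b \<and> kappa d z = 0}"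

section \<open>The polynomial ring and the matrix T\<close>

text \<open>\<open>R\<close> is a polynomial ring over the integers in countably many variables; the ring of the
  complex is its subring \<open>RR d n\<close> of polynomials in \<open>x\<^sub>1, \<dots>, x\<^sub>d\<close> and the \<open>t\<^sub>m\<close> with \<open>m\<close> of degree
  \<open>2n - 2\<close>.\<close>

datatype var = XV nat | TV mon

type_synonym R = "(var \<Rightarrow>\<^sub>0 nat) \<Rightarrow>\<^sub>0 int"

definition xR :: "nat \<Rightarrow> R" where
  "xR i = bas (Poly_Mapping.single (XV i) 1)"

definition tR :: "mon \<Rightarrow> R" where
  "tR m = bas (Poly_Mapping.single (TV m) 1)"

definition RR :: "nat \<Rightarrow> nat \<Rightarrow> R set" where
  "RR d n = {p. \<forall>u\<in>Poly_Mapping.keys p. Poly_Mapping.keys u \<subseteq> XV ` {1..d} \<union> TV ` mons d 1 (2*n-2)}"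

text \<open>Elements of the symmetric algebra viewed in \<open>R\<close>.\<close>

definition monR :: "mon \<Rightarrow> R" where
  "monR m = (\<Prod>i\<in>Poly_Mapping.keys m. xR i ^ Poly_Mapping.lookup m i)"

definition symR :: "(mon \<Rightarrow>\<^sub>0 R) \<Rightarrow> R" where
  "symR s = (\<Sum>m\<in>Poly_Mapping.keys s. Poly_Mapping.lookup s m * monR m)"

text \<open>Rows and columns of \<open>T\<close> are listed in the linear order of
  \<^theory>\<open>HOL-Library.Poly_Mapping\<close>; \<open>delta\<close> and the entries \<open>Q\<^sub>m\<^sub>1\<^sub>,\<^sub>m\<^sub>2\<close> do not depend on it.\<close>

definition mlist :: "nat \<Rightarrow> nat \<Rightarrow> mon list" where
  "mlist d n = sorted_list_of_set (mons d 1 (n-1))"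

definition mpos :: "nat \<Rightarrow> nat \<Rightarrow> mon \<Rightarrow> nat" where
  "mpos d n = the_inv_into {..<length (mlist d n)} (\<lambda>i. mlist d n ! i)"

definition Tmat :: "nat \<Rightarrow> nat \<Rightarrow> R mat" where
  "Tmat d n = mat (length (mlist d n)) (length (mlist d n))
                (\<lambda>(i, j). tR (mlist d n ! i + mlist d n ! j))"

definition delta :: "nat \<Rightarrow> nat \<Rightarrow> R" where
  "delta d n = det (Tmat d n)"

definition Q :: "nat \<Rightarrow> nat \<Rightarrow> mon \<Rightarrow> mon \<Rightarrow> R" where
  "Q d n m1 m2 = adj_mat (Tmat d n) $$ (mpos d n m1, mpos d n m2)"

definition q :: "nat \<Rightarrow> nat \<Rightarrow> (mon \<Rightarrow>\<^sub>0 R) \<Rightarrow> (mon \<Rightarrow>\<^sub>0 R)" where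
  "q d n = lin (\<lambda>m2. \<Sum>m1\<in>mons d 1 (n-1). Poly_Mapping.single m1 (Q d n m1 m2))"

definition Phit :: "nat \<Rightarrow> nat \<Rightarrow> (mon \<Rightarrow>\<^sub>0 R)" where
  "Phit d n = (\<Sum>m\<in>mons d 1 (2*n-2). Poly_Mapping.single (mx 1 + m) (tR m))"

definition proj :: "(mon \<Rightarrow>\<^sub>0 R) \<Rightarrow> (mon \<Rightarrow>\<^sub>0 R)" where
  "proj = lin (\<lambda>m. if dvdx 1 m then 0 else bas m)"

section \<open>The complex\<close>

text \<open>Base change to the ring of the complex: since that ring is free over the integers, its
  tensor product with a submodule \<open>Z\<close> of a free module is the span of \<open>Z\<close> in the base change of
  the free module.\<close>

definition spanR :: "nat \<Rightarrow> nat \<Rightarrow> ('k \<Rightarrow>\<^sub>0 int) set \<Rightarrow> ('k \<Rightarrow>\<^sub>0 R) set" where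
  "spanR d n Z = {w. \<exists>F c. finite F \<and> F \<subseteq> Z \<and> c ` F \<subseteq> RR d n \<and>
                       w = (\<Sum>z\<in>F. smul (c z) (Poly_Mapping.map of_int z))}"

type_synonym BM = "(nat set \<times> mon \<Rightarrow>\<^sub>0 R) \<times> (nat set \<times> mon \<Rightarrow>\<^sub>0 R)"

text \<open>\<open>Bmod d n r\<close> is \<open>B\<^sub>r\<close> for \<open>1 \<le> r \<le> d - 1\<close>, the first component belonging to \<open>K\<close> and the second
  to \<open>L\<close>. \<open>B\<^sub>0\<close> is the ring itself, and \<open>Btop d n\<close> is \<open>B\<^sub>d\<close>.\<close>

definition Bmod :: "nat \<Rightarrow> nat \<Rightarrow> nat \<Rightarrow> BM set" where
  "Bmod d n r = spanR d n (Kmod d (r-1) (n-1)) \<times> spanR d n (Lmod d (r-1) n)"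

definition Btop :: "nat \<Rightarrow> nat \<Rightarrow> (nat set \<Rightarrow>\<^sub>0 R) set" where
  "Btop d n = spanR d n {z. Poly_Mapping.keys z \<subseteq> ext0 d (d-1)}"

definition smulB :: "R \<Rightarrow> BM \<Rightarrow> BM" (infixr \<open>*\<^sub>B\<close> 75) where
  "c *\<^sub>B z = (smul c (fst z), smul c (snd z))"

definition linB :: "('k \<Rightarrow> BM) \<Rightarrow> ('k \<Rightarrow>\<^sub>0 R) \<Rightarrow> BM" where
  "linB f p = (\<Sum>k\<in>Poly_Mapping.keys p. Poly_Mapping.lookup p k *\<^sub>B f k)"

text \<open>The term \<open>Kos(\<theta>) \<otimes> \<nu>\<close>.\<close>

definition kosT :: "nat \<Rightarrow> (nat set \<Rightarrow>\<^sub>0 R) \<Rightarrow> (mon \<Rightarrow>\<^sub>0 R) \<Rightarrow> (nat set \<times> mon \<Rightarrow>\<^sub>0 R)" where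
  "kosT d \<theta> \<nu> = (\<Sum>i=1..d. smul (xR i) (tens (dcon i \<theta>) \<nu>))"

text \<open>The differentials are given by formulas that make sense, and are linear, on all of
  exterior algebra tensor divided powers (or symmetric algebra); \<open>b1\<close>, \<open>br\<close> and \<open>bd\<close> are their
  restrictions to the modules of the complex. In \<open>b1\<close>, the exterior factor of degree zero has
  basis \<open>e\<^sub>\<emptyset>\<close> and is dropped.\<close>

definition b1 :: "nat \<Rightarrow> nat \<Rightarrow> BM \<Rightarrow> R" where
  "b1 d n = restrict (\<lambda>(z, w).
       (\<Sum>(S, m)\<in>Poly_Mapping.keys z. Poly_Mapping.lookup z (S, m) * (xR 1 * symR (q d n (bas m))))
     + (\<Sum>(S, m)\<in>Poly_Mapping.keys w. Poly_Mapping.lookup w (S, m) *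
          (delta d n * monR m - xR 1 * symR (q d n (contract (bas m) (Phit d n))))))
     (Bmod d n 1)"

definition brK :: "nat \<Rightarrow> nat \<Rightarrow> nat set \<times> mon \<Rightarrow> BM" where
  "brK d n = (\<lambda>(S, m).
     (smul (- xR 1) (eta d (tens (bas S) (contract (q d n (bas m)) (Phit d n))))
        + smul (delta d n) (kosT d (bas S) (bas m)),
      smul (- xR 1) (kappa d (tens (bas S) (proj (q d n (bas m)))))))"

definition brL :: "nat \<Rightarrow> nat \<Rightarrow> nat set \<times> mon \<Rightarrow> BM" where
  "brL d n = (\<lambda>(S, m).
     (smul (xR 1) (eta d (tens (bas S)
        (contract (q d n (contract (bas m) (Phit d n))) (Phit d n)))),
      smul (xR 1) (kappa d (tens (bas S) (proj (q d n (contract (bas m) (Phit d n))))))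
        + smul (delta d n) (kosT d (bas S) (bas m))))"

definition br :: "nat \<Rightarrow> nat \<Rightarrow> nat \<Rightarrow> BM \<Rightarrow> BM" where
  "br d n r = restrict (\<lambda>(z, w). linB (brK d n) z + linB (brL d n) w) (Bmod d n r)"

definition bd :: "nat \<Rightarrow> nat \<Rightarrow> (nat set \<Rightarrow>\<^sub>0 R) \<Rightarrow> BM" where
  "bd d n = restrict (linB (\<lambda>S.
     (\<Sum>m\<in>mons d 2 n.
        smul (delta d n * monR m - xR 1 * symR (q d n (contract (bas m) (Phit d n))))
          (eta d (tens (bas S) (bas m))),
      - (\<Sum>m\<in>mons d 2 (n-1).
        smul (xR 1 * symR (q d n (bas m))) (kappa d (tens (bas S) (bas m)))))))
     (Btop d n)"

section \<open>The basis\<close>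

definition inX :: "nat \<Rightarrow> nat \<Rightarrow> nat \<Rightarrow> nat list \<Rightarrow> mon \<Rightarrow> bool" where
  "inX d n r as m \<longleftrightarrow> 1 \<le> r \<and> r \<le> d - 1 \<and> length as = r \<and> sorted_wrt (<) as \<and> set as \<subseteq> {2..d} \<and>
     m \<in> mons d 2 n \<and> {2..least m} \<subseteq> set as"

definition inY :: "nat \<Rightarrow> nat \<Rightarrow> nat \<Rightarrow> nat list \<Rightarrow> mon \<Rightarrow> bool" where
  "inY d n r as m \<longleftrightarrow> 1 \<le> r \<and> r \<le> d - 1 \<and> length as = r \<and> sorted_wrt (<) as \<and> set as \<subseteq> {2..d} \<and>
     m \<in> mons d (hd as) (n-1)"

text \<open>The symbols \<open>X\<close> and \<open>Y\<close> only have a meaning for the indices of basis elements. So an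
  identity with a nonzero multiple of one of them on its right-hand side is provable only if
  that symbol denotes a basis element.\<close>

definition X :: "nat \<Rightarrow> nat \<Rightarrow> nat \<Rightarrow> nat list \<Rightarrow> mon \<Rightarrow> BM" where
  "X d n r as m = (if inX d n r as m then (eta d (tens (wedge as) (bas m)), 0) else undefined)"

definition Y :: "nat \<Rightarrow> nat \<Rightarrow> nat \<Rightarrow> nat list \<Rightarrow> mon \<Rightarrow> BM" where
  "Y d n r as m = (if inY d n r as m then (0, kappa d (tens (wedge as) (bas m))) else undefined)"

definition Xtop :: "nat \<Rightarrow> (nat set \<Rightarrow>\<^sub>0 R)" where
  "Xtop d = wedge [2..<Suc d]"

text \<open>\<open>a\<^sub>i, \<dots>, a\<^sub>j\<close> with the entries whose position lies in \<open>H\<close> omitted.\<close>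

definition hat :: "(nat \<Rightarrow> nat) \<Rightarrow> nat \<Rightarrow> nat \<Rightarrow> nat set \<Rightarrow> nat list" where
  "hat a i j H = map a (filter (\<lambda>k. k \<notin> H) [i..<Suc j])"

end

theory Submission
  imports Defs
begin

text \<open>The matrices are computed by expanding the differentials and rewriting the result in the
  basis. Four facts are behind the formulas.

  \<^item> \<open>\<eta>\<^sup>2 = 0\<close> and \<open>\<kappa>\<^sup>2 = 0\<close>. Applied to \<open>x\<^sub>g \<and> e\<^sub>W \<otimes> (x\<^sub>g u)\<^sup>*\<close> and to \<open>x\<^sub>l \<and> e\<^sub>W \<otimes> v\<close>, this gives
    straightening relations (\<open>hX_straighten\<close>, \<open>hY_straighten\<close>), which express a generator
    \<open>\<eta>(e\<^sub>W \<otimes> u\<^sup>*)\<close> or \<open>\<kappa>(e\<^sub>W \<otimes> u)\<close> that does not belong to the basis in terms of basis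
    elements, for a suitable choice of \<open>g\<close> and \<open>l\<close>.
  \<^item> \<open>T Q = \<delta>\<close>. Hence \<open>[q(\<nu>\<^sup>*)](\<Phi>\<^sup>~)\<close> is the sum of \<open>\<delta> (x\<^sub>1 \<nu>)\<^sup>*\<close> and of terms \<open>u\<^sup>*\<close> with \<open>u\<close> not
    divisible by \<open>x\<^sub>1\<close>, whose coefficients are sums of products of a \<open>t\<close> and an entry of \<open>Q\<close>
    (\<open>contract_q_Phit\<close>).
  \<^item> The terms divisible by \<open>x\<^sub>1\<close> cancel in the differentials: on \<open>K\<close> because \<open>\<eta>\<^sup>2 = 0\<close>, and on \<open>L\<close>
    because the index \<open>x\<^sub>i x\<^sub>j m v\<close> of the variable \<open>t\<close> occurring in them is symmetric in \<open>i\<close> and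
    \<open>j\<close> while the sign is alternating (\<open>sum_t_hX_cancel\<close>).
  \<^item> The Koszul differential anticommutes with contractions (\<open>sum_sg_swap\<close>).

  Let \<open>S = {a\<^sub>1 < \<dots> < a\<^sub>r}\<close>. It follows (\<open>linB_brK_hX\<close>, \<open>linB_brL_hY\<close>) that the values of \<open>b\<^sub>r\<close>
  on the basis elements with index \<open>S\<close> are composed of alternating sums over \<open>k\<close> and \<open>u\<close> of
  \<open>(-1)\<^sup>k A\<^sub>k(u) \<eta>(e\<^bsub>S - a\<^sub>k\<^esub> \<otimes> u\<^sup>*)\<close> and of \<open>(-1)\<^sup>k A\<^sub>k(u) \<kappa>(e\<^bsub>S - a\<^sub>k\<^esub> \<otimes> u)\<close>, for suitable
  coefficients \<open>A\<^sub>k(u)\<close>, and of \<open>\<delta>\<close> times Koszul terms. Sums of the first two kinds are expanded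
  in the basis, for arbitrary coefficients, in \<open>expand_hX\<close> and \<open>expand_hY\<close>: split the monomials
  \<open>u\<close> according to their least variable, straighten the generators that are not in the basis, and
  collect. The Koszul terms are treated in \<open>expand_Kos_hX\<close> and \<open>expand_Kos_hY\<close>. The first
  and the last differential need no straightening.\<close>

section \<open>Signs, eta and kappa on basis elements\<close>

text \<open>The sign in the contraction of \<open>e\<^sub>S\<close> by \<open>x\<^sub>i\<^sup>*\<close>.\<close>

definition sg :: "nat set \<Rightarrow> nat \<Rightarrow> 'c::comm_ring_1" where
  "sg S i = (-1) ^ card {s\<in>S. s < i}"

lemma sg_square [simp]: "sg S i * sg S i = (1 :: 'c::comm_ring_1)"
  by (simp add: sg_def flip: power_mult_distrib)

lemma sg_insert:
  assumes "finite S" "g \<notin> S"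
  shows "sg (insert g S) i = (if g < i then - sg S i else (sg S i :: 'c::comm_ring_1))"
proof (cases "g < i")
  case True
  then have "{s\<in>insert g S. s < i} = insert g {s\<in>S. s < i}" by auto
  with True assms show ?thesis by (simp add: sg_def)
next
  case False
  then have "{s\<in>insert g S. s < i} = {s\<in>S. s < i}" by auto
  with False show ?thesis by (simp add: sg_def)
qed

lemma sg_remove:
  assumes "finite S" "g \<in> S"
  shows "sg (S - {g}) i = (if g < i then - sg S i else (sg S i :: 'c::comm_ring_1))"
  using sg_insert[of "S - {g}" g i, where 'c = 'c] assms by (auto simp: insert_absorb)

lemma sg_below: "(\<And>s. s \<in> S \<Longrightarrow> i \<le> s) \<Longrightarrow> sg S i = 1"
proof -
  assume "\<And>s. s \<in> S \<Longrightarrow> i \<le> s"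
  then have "{s\<in>S. s < i} = {}" by force
  then show ?thesis by (simp only: sg_def card.empty power_0)
qed

lemma sg_anticommute:
  assumes "finite S" "i \<in> S" "j \<in> S" "i \<noteq> j"
  shows "sg S i * sg (S - {i}) j = - (sg S j * sg (S - {j}) i :: 'c::comm_ring_1)"
  using assms by (auto simp: sg_remove algebra_simps)

lemma smul_diff: "smul c (p - p') = smul c p - smul c p'"
  and smul_diff_left: "smul (c - c') p = smul c p - smul c' p"
proof -
  show "smul c (p - p') = smul c p - smul c p'"
    by (rule poly_mapping_eqI) (simp add: lookup_minus right_diff_distrib)
  show "smul (c - c') p = smul c p - smul c' p"
    by (rule poly_mapping_eqI) (simp add: lookup_minus left_diff_distrib)
qed

lemma sum_smul_left: "(\<Sum>i\<in>A. smul (c i) x) = smul (\<Sum>i\<in>A. c i) x"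
  by (induction A rule: infinite_finite_induct) (simp_all add: smul_add_left)

lemma smul_uminus_sum: "(\<Sum>i\<in>A. smul (- c i) (f i)) = - (\<Sum>i\<in>A. smul (c i) (f i))"
  by (simp add: sum_negf)

text \<open>Double contractions are alternating: the reason why \<open>\<eta>\<^sup>2 = 0\<close> and \<open>\<kappa>\<^sup>2 = 0\<close>.\<close>

lemma sum_sg_symmetric_eq_0:
  fixes F :: "nat \<Rightarrow> nat \<Rightarrow> ('k \<Rightarrow>\<^sub>0 'c::comm_ring_1)"
  assumes fin: "finite S" and sym: "\<And>i j. i \<in> S \<Longrightarrow> j \<in> S \<Longrightarrow> i \<noteq> j \<Longrightarrow> F i j = F j i"
  shows "(\<Sum>i\<in>S. \<Sum>j\<in>S - {i}. smul (sg S i * sg (S - {i}) j) (F i j)) = 0"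
proof -
  let ?G = "\<lambda>i j. smul (sg S i * sg (S - {i}) j) (F i j)"
  have split: "(\<Sum>j\<in>S - {i}. ?G i j) = (\<Sum>j\<in>{j\<in>S. j < i}. ?G i j) + (\<Sum>j\<in>{j\<in>S. i < j}. ?G i j)" for i
    using fin by (subst sum.union_disjoint[symmetric]) (auto intro!: sum.cong)
  have "(\<Sum>i\<in>S. \<Sum>j\<in>{j\<in>S. i < j}. ?G i j) = (\<Sum>j\<in>S. \<Sum>i\<in>{i\<in>S. i < j}. ?G i j)"
    using fin by (rule sum.swap_restrict[OF _ fin])
  also have "\<dots> = (\<Sum>j\<in>S. \<Sum>i\<in>{i\<in>S. i < j}. - ?G j i)"
  proof (intro sum.cong refl)
    fix j i assume "j \<in> S" "i \<in> {i\<in>S. i < j}"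
    then show "?G i j = - ?G j i"
      using sym[of i j] sg_anticommute[OF fin, of i j, where 'c = 'c] by simp
  qed
  finally show ?thesis by (simp add: split sum.distrib sum_negf)
qed

lemma dcon_bas: "dcon i (bas S) = (if i \<in> S then Poly_Mapping.single (S - {i}) (sg S i) else 0)"
  by (simp add: dcon_def sg_def)

lemma tens_0 [simp]: "tens 0 p = 0" "tens p 0 = 0"
  by (simp_all add: tens_def)

lemma tens_single [simp]:
  "tens (Poly_Mapping.single k c) (Poly_Mapping.single l c') = Poly_Mapping.single (k, l) (c * c')"
  by (simp add: tens_def)

lemma tens_bas: "tens (bas S) p = lin (\<lambda>l. bas (S, l)) p"
  by (simp add: tens_def lin_def)

lemma mx_nz: "Poly_Mapping.lookup (mx i) j = (if i = j then 1 else 0)"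
  by (simp add: mx_def lookup_single when_def)

lemma dvdx_mx_add [simp]: "dvdx i (mx j + m) \<longleftrightarrow> i = j \<or> dvdx i m"
  by (simp add: dvdx_def in_keys_iff lookup_add mx_nz)

lemma dvdx_add: "dvdx i (m + m') \<longleftrightarrow> dvdx i m \<or> dvdx i m'"
  by (simp add: dvdx_def in_keys_iff lookup_add)

lemma dvdx_mx [simp]: "dvdx i (mx j) \<longleftrightarrow> i = j"
  by (simp add: dvdx_def in_keys_iff mx_nz)

lemma dvdx_minus_mx: "i \<noteq> j \<Longrightarrow> dvdx i (m - mx j) \<longleftrightarrow> dvdx i m"
  by (simp add: dvdx_def in_keys_iff lookup_minus mx_nz)

lemma mx_add_minus: "dvdx i m \<Longrightarrow> mx i + (m - mx i) = m"
  by (rule poly_mapping_eqI) (auto simp: lookup_add lookup_minus mx_nz dvdx_def in_keys_iff)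

lemma mx_add_minus_other: "dvdx i m \<Longrightarrow> mx j + m - mx i = mx j + (m - mx i)"
  by (rule poly_mapping_eqI) (auto simp: lookup_add lookup_minus mx_nz dvdx_def in_keys_iff)

lemma minus_mx_commute: "(m :: mon) - mx i - mx j = m - mx j - mx i"
  by (rule poly_mapping_eqI) (auto simp: lookup_minus)

lemma sum_if_mem_interval:
  assumes "S \<subseteq> {1..d::nat}"
  shows "(\<Sum>i=1..d. if i \<in> S then f i else 0) = (\<Sum>i\<in>S. f i :: 'a::comm_monoid_add)"
  using assms by (simp add: sum.If_cases Int_absorb1)

lemma eta_bas:
  assumes "S \<subseteq> {1..d}"
  shows "eta d (bas (S, m)) =
    (\<Sum>i\<in>S. smul (sg S i * of_bool (dvdx i m)) (bas (S - {i}, m - mx i) :: _ \<Rightarrow>\<^sub>0 'c::comm_ring_1))"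
proof -
  have "eta d (bas (S, m)) = (\<Sum>i=1..d. if i \<in> S then
      smul (sg S i * of_bool (dvdx i m)) (bas (S - {i}, m - mx i) :: _ \<Rightarrow>\<^sub>0 'c) else 0)"
    by (simp add: eta_def) (auto intro!: sum.cong simp: dcon_bas contract_bas)
  then show ?thesis unfolding sum_if_mem_interval[OF assms] .
qed

lemma kappa_bas:
  assumes "S \<subseteq> {1..d}"
  shows "kappa d (bas (S, m)) =
    (\<Sum>i\<in>S. smul (sg S i) (bas (S - {i}, mx i + m) :: _ \<Rightarrow>\<^sub>0 'c::comm_ring_1))"
proof -
  have "kappa d (bas (S, m)) = (\<Sum>i=1..d. if i \<in> S then
      smul (sg S i) (bas (S - {i}, mx i + m) :: _ \<Rightarrow>\<^sub>0 'c) else 0)"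
    by (simp add: kappa_def) (auto intro!: sum.cong simp: dcon_bas mult_single)
  then show ?thesis unfolding sum_if_mem_interval[OF assms] .
qed

lemma kosT_bas:
  assumes "S \<subseteq> {1..d}"
  shows "kosT d (bas S) (bas m) = (\<Sum>i\<in>S. smul (xR i * sg S i) (bas (S - {i}, m)))"
proof -
  have "kosT d (bas S) (bas m) = (\<Sum>i=1..d. if i \<in> S then
      smul (xR i * sg S i) (bas (S - {i}, m)) else 0)"
    unfolding kosT_def by (auto intro!: sum.cong simp: dcon_bas)
  then show ?thesis unfolding sum_if_mem_interval[OF assms] .
qed

text \<open>The generators \<open>\<eta>(e\<^sub>S \<otimes> m\<^sup>*)\<close> of \<open>K\<close> and \<open>\<kappa>(e\<^sub>S \<otimes> m)\<close> of \<open>L\<close>, for arbitrary indices.\<close>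

definition hX :: "nat \<Rightarrow> nat set \<Rightarrow> mon \<Rightarrow> (nat set \<times> mon \<Rightarrow>\<^sub>0 'c::comm_ring_1)" where
  "hX d S m = eta d (bas (S, m))"

definition hY :: "nat \<Rightarrow> nat set \<Rightarrow> mon \<Rightarrow> (nat set \<times> mon \<Rightarrow>\<^sub>0 'c::comm_ring_1)" where
  "hY d S m = kappa d (bas (S, m))"

lemma eta_linear:
  "eta d (smul c p) = smul c (eta d p)" "eta d (\<Sum>i\<in>A. g i) = (\<Sum>i\<in>A. eta d (g i))"
  by (simp_all add: eta_def lin_smul lin_sum)

lemma kappa_linear:
  "kappa d (smul c p) = smul c (kappa d p)" "kappa d (\<Sum>i\<in>A. g i) = (\<Sum>i\<in>A. kappa d (g i))"
  by (simp_all add: kappa_def lin_smul lin_sum)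

lemma eta_hX_expand:
  assumes "S \<subseteq> {1..d}"
  shows "eta d (hX d S m) = (\<Sum>i\<in>S. smul (sg S i * of_bool (dvdx i m)) (hX d (S - {i}) (m - mx i) :: _ \<Rightarrow>\<^sub>0 'c::comm_ring_1))"
  by (simp only: hX_def eta_bas[OF assms] eta_linear)

lemma kappa_hY_expand:
  assumes "S \<subseteq> {1..d}"
  shows "kappa d (hY d S m) = (\<Sum>i\<in>S. smul (sg S i) (hY d (S - {i}) (mx i + m) :: _ \<Rightarrow>\<^sub>0 'c::comm_ring_1))"
  by (simp only: hY_def kappa_bas[OF assms] kappa_linear)

lemma eta_hX:
  assumes "S \<subseteq> {1..d}"
  shows "eta d (hX d S m :: _ \<Rightarrow>\<^sub>0 'c::comm_ring_1) = 0"
proof -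
  have fin: "finite S" using assms finite_subset by blast
  let ?F = "\<lambda>i j. smul (of_bool (dvdx i m) * of_bool (dvdx j (m - mx i)))
                    (bas (S - {i} - {j}, m - mx i - mx j) :: _ \<Rightarrow>\<^sub>0 'c)"
  have "eta d (hX d S m) = (\<Sum>i\<in>S. smul (sg S i * of_bool (dvdx i m)) (hX d (S - {i}) (m - mx i)))"
    by (rule eta_hX_expand[OF assms])
  also have "\<dots> = (\<Sum>i\<in>S. \<Sum>j\<in>S - {i}. smul (sg S i * sg (S - {i}) j) (?F i j))"
  proof (intro sum.cong refl)
    fix i assume "i \<in> S"
    have "S - {i} \<subseteq> {1..d}" using assms by auto
    then show "smul (sg S i * of_bool (dvdx i m)) (hX d (S - {i}) (m - mx i))
        = (\<Sum>j\<in>S - {i}. smul (sg S i * sg (S - {i}) j) (?F i j))"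
      unfolding hX_def by (subst eta_bas) (auto simp: smul_sum ac_simps intro!: sum.cong)
  qed
  also have "\<dots> = 0"
  proof (rule sum_sg_symmetric_eq_0[OF fin])
    fix i j :: nat assume "i \<noteq> j"
    then have "dvdx i m \<and> dvdx j (m - mx i) \<longleftrightarrow> dvdx j m \<and> dvdx i (m - mx j)"
      by (auto simp: dvdx_minus_mx)
    moreover have "S - {i} - {j} = S - {j} - {i}" by blast
    ultimately show "?F i j = ?F j i"
      by (simp only: minus_mx_commute[of m i j] of_bool_conj[symmetric])
  qed
  finally show ?thesis .
qed

lemma kappa_hY:
  assumes "S \<subseteq> {1..d}"
  shows "kappa d (hY d S m :: _ \<Rightarrow>\<^sub>0 'c::comm_ring_1) = 0"
proof -
  have fin: "finite S" using assms finite_subset by blast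
  let ?F = "\<lambda>i j. (bas (S - {i} - {j}, mx j + (mx i + m)) :: _ \<Rightarrow>\<^sub>0 'c)"
  have "kappa d (hY d S m) = (\<Sum>i\<in>S. smul (sg S i) (hY d (S - {i}) (mx i + m)))"
    by (rule kappa_hY_expand[OF assms])
  also have "\<dots> = (\<Sum>i\<in>S. \<Sum>j\<in>S - {i}. smul (sg S i * sg (S - {i}) j) (?F i j))"
  proof (intro sum.cong refl)
    fix i assume "i \<in> S"
    have "S - {i} \<subseteq> {1..d}" using assms by auto
    then show "smul (sg S i) (hY d (S - {i}) (mx i + m))
        = (\<Sum>j\<in>S - {i}. smul (sg S i * sg (S - {i}) j) (?F i j))"
      unfolding hY_def by (subst kappa_bas) (auto simp: smul_sum ac_simps intro!: sum.cong)
  qed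
  also have "\<dots> = 0"
  proof (rule sum_sg_symmetric_eq_0[OF fin])
    fix i j :: nat
    have "S - {i} - {j} = S - {j} - {i}" by blast
    then show "?F i j = ?F j i" by (simp only: add.left_commute)
  qed
  finally show ?thesis .
qed

text \<open>The straightening relation for \<open>K\<close>, obtained by expanding
  \<open>\<eta>\<^sup>2(x\<^sub>g \<and> e\<^sub>W \<otimes> (x\<^sub>g u)\<^sup>*) = 0\<close>.\<close>

lemma hX_straighten:
  assumes W: "W \<subseteq> {1..d}" and g: "g \<in> {1..d}" "g \<notin> W"
  shows "hX d W u = (\<Sum>i\<in>W. smul (- sg W g * sg (insert g W) i * of_bool (dvdx i u))
           (hX d (insert g W - {i}) (mx g + (u - mx i)) :: _ \<Rightarrow>\<^sub>0 'c::comm_ring_1))"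
proof -
  let ?V = "insert g W"
  have fin: "finite W" using W finite_subset by blast
  have V: "?V \<subseteq> {1..d}" using W g by auto
  have sgg: "sg ?V g = (sg W g :: 'c)" using fin g by (simp add: sg_insert)
  have "(\<Sum>i\<in>?V. smul (sg ?V i * of_bool (dvdx i (mx g + u))) (hX d (?V - {i}) (mx g + u - mx i))) = (0 :: _ \<Rightarrow>\<^sub>0 'c)"
    unfolding eta_hX_expand[OF V, symmetric] by (rule eta_hX[OF V])
  then have "smul (sg W g) (hX d W u) + (\<Sum>i\<in>W. smul (sg ?V i * of_bool (dvdx i (mx g + u)))
       (hX d (?V - {i}) (mx g + u - mx i))) = (0 :: _ \<Rightarrow>\<^sub>0 'c)"
    using fin g by (simp add: sgg)
  then have "smul (sg W g) (hX d W u) = - (\<Sum>i\<in>W. smul (sg ?V i * of_bool (dvdx i (mx g + u)))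
       (hX d (?V - {i}) (mx g + u - mx i)) :: _ \<Rightarrow>\<^sub>0 'c)"
    by (simp add: eq_neg_iff_add_eq_0)
  also have "\<dots> = (\<Sum>i\<in>W. smul (- sg ?V i * of_bool (dvdx i u)) (hX d (?V - {i}) (mx g + (u - mx i))))"
    unfolding sum_negf[symmetric] using g
    by (intro sum.cong refl) (auto simp: mx_add_minus_other)
  finally have "smul (sg W g * sg W g) (hX d W u) = smul (sg W g) (\<Sum>i\<in>W. smul (- sg ?V i * of_bool (dvdx i u))
       (hX d (?V - {i}) (mx g + (u - mx i))) :: _ \<Rightarrow>\<^sub>0 'c)"
    by (simp only: smul_mult)
  also have "\<dots> = (\<Sum>i\<in>W. smul (- sg W g * sg ?V i * of_bool (dvdx i u)) (hX d (?V - {i}) (mx g + (u - mx i))))"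
    unfolding smul_sum smul_mult[symmetric] by (simp add: mult.assoc)
  finally show ?thesis by simp
qed

text \<open>The straightening relation for \<open>L\<close>, obtained by expanding
  \<open>\<kappa>\<^sup>2(x\<^sub>l \<and> e\<^sub>W \<otimes> v) = 0\<close>, in the case where \<open>l\<close> is less than the elements of \<open>W\<close>.\<close>

lemma hY_straighten:
  assumes W: "W \<subseteq> {1..d}" and l: "l \<in> {1..d}" "\<And>i. i \<in> W \<Longrightarrow> l < i"
  shows "hY d W (mx l + v) = (\<Sum>i\<in>W. smul (sg W i) (hY d (insert l (W - {i})) (mx i + v) :: _ \<Rightarrow>\<^sub>0 'c::comm_ring_1))"
proof -
  let ?V = "insert l W"
  have fin: "finite W" and lW: "l \<notin> W" using W l finite_subset by blast+
  have V: "?V \<subseteq> {1..d}" using W l by auto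
  have sgl: "sg ?V l = (1 :: 'c)" using l(2) by (intro sg_below) (auto intro: less_imp_le)
  have "(\<Sum>i\<in>?V. smul (sg ?V i) (hY d (?V - {i}) (mx i + v))) = (0 :: _ \<Rightarrow>\<^sub>0 'c)"
    unfolding kappa_hY_expand[OF V, symmetric] by (rule kappa_hY[OF V])
  then have "hY d W (mx l + v) + (\<Sum>i\<in>W. smul (sg ?V i) (hY d (?V - {i}) (mx i + v))) = (0 :: _ \<Rightarrow>\<^sub>0 'c)"
    using fin lW by (simp add: sgl)
  then have "hY d W (mx l + v) = (\<Sum>i\<in>W. - smul (sg ?V i) (hY d (?V - {i}) (mx i + v)) :: _ \<Rightarrow>\<^sub>0 'c)"
    unfolding sum_negf by (simp add: eq_neg_iff_add_eq_0)
  also have "\<dots> = (\<Sum>i\<in>W. smul (sg W i) (hY d (insert l (W - {i})) (mx i + v)))"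
    using fin lW l by (intro sum.cong refl) (auto simp: sg_insert insert_Diff_if)
  finally show ?thesis .
qed

text \<open>Indices and signs are written with \<open>1\<close>, as in \<open>mx 1\<close> and \<open>a 1\<close>, so it is kept in this form.\<close>

declare One_nat_def [simp del]

section \<open>Sums over monomials\<close>

lemma mdeg_superset: "finite A \<Longrightarrow> Poly_Mapping.keys m \<subseteq> A \<Longrightarrow> mdeg m = (\<Sum>i\<in>A. Poly_Mapping.lookup m i)"
  unfolding mdeg_def by (intro sum.mono_neutral_left) (auto simp: in_keys_iff)

lemma keys_add_mon: "Poly_Mapping.keys (m + m' :: mon) = Poly_Mapping.keys m \<union> Poly_Mapping.keys m'"
  by (auto simp: in_keys_iff lookup_add)

lemma keys_mx [simp]: "Poly_Mapping.keys (mx i) = {i}"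
  by (auto simp: in_keys_iff mx_nz split: if_splits)

lemma mdeg_add: "mdeg (m + m') = mdeg m + mdeg m'"
  by (simp add: mdeg_superset[of "Poly_Mapping.keys m \<union> Poly_Mapping.keys m'"] keys_add_mon
      lookup_add sum.distrib)

lemma mdeg_mx [simp]: "mdeg (mx i) = 1"
  by (simp add: mdeg_def mx_nz)

lemma finite_mons [simp]: "finite (mons d k s)"
proof (rule inj_on_finite)
  show "inj_on (\<lambda>m. \<lambda>i\<in>{k..d}. Poly_Mapping.lookup m i) (mons d k s)"
  proof (rule inj_onI, rule poly_mapping_eqI)
    fix m m' i
    assume m: "m \<in> mons d k s" "m' \<in> mons d k s"
      and eq: "(\<lambda>i\<in>{k..d}. Poly_Mapping.lookup m i) = (\<lambda>i\<in>{k..d}. Poly_Mapping.lookup m' i)"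
    show "Poly_Mapping.lookup m i = Poly_Mapping.lookup m' i"
    proof (cases "i \<in> {k..d}")
      case True then show ?thesis using fun_cong[OF eq, of i] by simp
    next
      case False
      then have "i \<notin> Poly_Mapping.keys m" "i \<notin> Poly_Mapping.keys m'"
        using m by (auto simp: mons_def)
      then show ?thesis by (simp add: in_keys_iff)
    qed
  qed
  have "Poly_Mapping.lookup m i \<le> s" if "m \<in> mons d k s" for m i
  proof (cases "i \<in> Poly_Mapping.keys m")
    case True
    then have "Poly_Mapping.lookup m i \<le> mdeg m"
      unfolding mdeg_def by (intro member_le_sum) auto
    then show ?thesis using that by (simp add: mons_def)
  qed (simp add: in_keys_iff)
  then show "(\<lambda>m. \<lambda>i\<in>{k..d}. Poly_Mapping.lookup m i) ` mons d k s \<subseteq> (\<Pi>\<^sub>E i\<in>{k..d}. {..s})"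
    by auto
  show "finite (\<Pi>\<^sub>E i\<in>{k..d}. {..s})" by (intro finite_PiE) auto
qed

lemma mons_add: "m \<in> mons d k s \<Longrightarrow> m' \<in> mons d k s' \<Longrightarrow> m + m' \<in> mons d k (s + s')"
  by (auto simp: mons_def keys_add_mon mdeg_add)

lemma mons_mono: "k \<le> k' \<Longrightarrow> m \<in> mons d k' s \<Longrightarrow> m \<in> mons d k s"
  by (force simp: mons_def)

lemma mx_add_mons:
  assumes "1 \<le> s" "k \<le> i" "i \<le> d"
  shows "mx i + m \<in> mons d k s \<longleftrightarrow> m \<in> mons d k (s - 1)"
  using assms by (auto simp: mons_def keys_add_mon mdeg_add)

lemma mx_add_mons_I: "1 \<le> s \<Longrightarrow> k \<le> i \<Longrightarrow> i \<le> d \<Longrightarrow> k \<le> l \<Longrightarrow> m \<in> mons d l (s - 1) \<Longrightarrow> mx i + m \<in> mons d k s"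
  using mx_add_mons mons_mono by blast

lemma not_dvdx_mons: "m \<in> mons d k s \<Longrightarrow> i < k \<Longrightarrow> \<not> dvdx i m"
  by (force simp: mons_def dvdx_def)

lemma dvdx_mons_le: "m \<in> mons d k s \<Longrightarrow> dvdx i m \<Longrightarrow> k \<le> i \<and> i \<le> d"
  by (force simp: mons_def dvdx_def)

lemma minus_mx_mons: "m \<in> mons d k s \<Longrightarrow> dvdx i m \<Longrightarrow> m - mx i \<in> mons d k (s - 1)"
proof -
  assume m: "m \<in> mons d k s" and i: "dvdx i m"
  have "mx i + (m - mx i) \<in> mons d k s" using m i by (simp add: mx_add_minus)
  then show ?thesis by (auto simp: mons_def keys_add_mon mdeg_add)
qed

lemma least_mem:
  assumes "m \<in> mons d k s" "1 \<le> s"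
  shows "dvdx (least m) m" "k \<le> least m" "least m \<le> d" "m \<in> mons d (least m) s"
proof -
  have "Poly_Mapping.keys m \<noteq> {}" using assms by (auto simp: mons_def mdeg_def)
  then show *: "dvdx (least m) m" unfolding dvdx_def least_def by (rule Min_in[OF finite_keys])
  show "k \<le> least m" "least m \<le> d" using dvdx_mons_le[OF assms(1) *] by auto
  show "m \<in> mons d (least m) s" using assms(1) by (force simp: mons_def least_def)
qed

lemma least_mx_add: "m \<in> mons d l s \<Longrightarrow> least (mx l + m) = l"
  unfolding least_def by (rule Min_eqI) (auto simp: keys_add_mon mons_def)

lemma sum_mons_filter_dvdx:
  fixes f :: "mon \<Rightarrow> 'a::comm_monoid_add"
  assumes "1 \<le> s" "k \<le> i" "i \<le> d"
  shows "(\<Sum>u\<in>{u\<in>mons d k s. dvdx i u}. f u) = (\<Sum>v\<in>mons d k (s - 1). f (mx i + v))"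
  by (rule sum.reindex_bij_witness[of _ "\<lambda>v. mx i + v" "\<lambda>u. u - mx i"])
     (use assms in \<open>auto simp: mx_add_minus mx_add_mons minus_mx_mons\<close>)

lemma sum_mons_dvdx:
  fixes f :: "mon \<Rightarrow> ('k \<Rightarrow>\<^sub>0 'c::comm_ring_1)"
  assumes "1 \<le> s" "k \<le> i" "i \<le> d"
  shows "(\<Sum>u\<in>mons d k s. smul (of_bool (dvdx i u) * c u) (f u))
       = (\<Sum>v\<in>mons d k (s - 1). smul (c (mx i + v)) (f (mx i + v)))"
proof -
  have "(\<Sum>u\<in>mons d k s. smul (of_bool (dvdx i u) * c u) (f u)) = (\<Sum>u\<in>{u\<in>mons d k s. dvdx i u}. smul (c u) (f u))"
    by (intro sum.mono_neutral_cong_right) auto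
  also have "\<dots> = (\<Sum>v\<in>mons d k (s - 1). smul (c (mx i + v)) (f (mx i + v)))"
    by (rule sum_mons_filter_dvdx[OF assms])
  finally show ?thesis .
qed

lemma sum_mons_least_Suc:
  fixes f :: "mon \<Rightarrow> 'a::comm_monoid_add"
  assumes "1 \<le> s" "k \<le> d"
  shows "(\<Sum>u\<in>mons d k s. f u) = (\<Sum>v\<in>mons d k (s - 1). f (mx k + v)) + (\<Sum>u\<in>mons d (Suc k) s. f u)"
proof -
  have "mons d (Suc k) s = {u\<in>mons d k s. \<not> dvdx k u}"
  proof -
    have "{Suc k..d} = {k..d} - {k}" by auto
    then show ?thesis by (auto simp: mons_def dvdx_def)
  qed
  then have "mons d k s = {u\<in>mons d k s. dvdx k u} \<union> mons d (Suc k) s"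
    "{u\<in>mons d k s. dvdx k u} \<inter> mons d (Suc k) s = {}" by auto
  then have "(\<Sum>u\<in>mons d k s. f u) = (\<Sum>u\<in>{u\<in>mons d k s. dvdx k u}. f u) + (\<Sum>u\<in>mons d (Suc k) s. f u)"
    by (metis (no_types, lifting) finite_Un finite_mons sum.union_disjoint)
  also have "(\<Sum>u\<in>{u\<in>mons d k s. dvdx k u}. f u) = (\<Sum>v\<in>mons d k (s - 1). f (mx k + v))"
    by (rule sum_mons_filter_dvdx) (use assms in auto)
  finally show ?thesis .
qed

text \<open>A sum over monomials, split according to the least variable.\<close>

lemma sum_mons_least:
  fixes f :: "mon \<Rightarrow> 'a::comm_monoid_add"
  assumes "1 \<le> s" "k \<le> p" "p \<le> Suc d"
  shows "(\<Sum>u\<in>mons d k s. f u) = (\<Sum>l\<in>{k..<p}. \<Sum>v\<in>mons d l (s - 1). f (mx l + v)) + (\<Sum>u\<in>mons d p s. f u)"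
  using assms(2,3)
proof (induction p rule: dec_induct)
  case (step p)
  then show ?case
    using sum_mons_least_Suc[OF assms(1), of p d f] by (simp add: add.assoc)
qed simp

text \<open>Sums over pairs of distinct indices.\<close>

lemma sum_pairs_distinct:
  fixes f :: "nat \<Rightarrow> nat \<Rightarrow> 'a::comm_monoid_add"
  shows "(\<Sum>k=p..r. \<Sum>j\<in>{p..r} - {k}. f k j) = (\<Sum>j=p..r. \<Sum>k=j+1..r. f k j + f j k)"
proof -
  have "(\<Sum>j\<in>{p..r} - {k}. f k j) = (\<Sum>j\<in>{j\<in>{p..r}. j < k}. f k j) + (\<Sum>j\<in>{j\<in>{p..r}. k < j}. f k j)" for k
    by (subst sum.union_disjoint[symmetric]) (auto intro!: sum.cong)
  then have "(\<Sum>k=p..r. \<Sum>j\<in>{p..r} - {k}. f k j)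
      = (\<Sum>k=p..r. \<Sum>j\<in>{j\<in>{p..r}. j < k}. f k j) + (\<Sum>k=p..r. \<Sum>j\<in>{j\<in>{p..r}. k < j}. f k j)"
    by (simp add: sum.distrib)
  also have "(\<Sum>k=p..r. \<Sum>j\<in>{j\<in>{p..r}. j < k}. f k j) = (\<Sum>j=p..r. \<Sum>k\<in>{k\<in>{p..r}. j < k}. f k j)"
    by (rule sum.swap_restrict) auto
  also have "\<dots> + (\<Sum>k=p..r. \<Sum>j\<in>{j\<in>{p..r}. k < j}. f k j) = (\<Sum>j=p..r. \<Sum>k\<in>{k\<in>{p..r}. j < k}. f k j + f j k)"
    by (simp add: sum.distrib)
  also have "\<dots> = (\<Sum>j=p..r. \<Sum>k=j+1..r. f k j + f j k)"
    by (intro sum.cong refl) auto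
  finally show ?thesis .
qed

section \<open>Increasing sequences of indices\<close>

text \<open>The index sequence \<open>a\<^sub>1 < \<dots> < a\<^sub>r\<close> of a basis element. The values \<open>a i\<close> with \<open>i\<close> outside
  \<open>[1, r]\<close> are irrelevant.\<close>

locale index_seq =
  fixes a :: "nat \<Rightarrow> nat" and r d :: nat
  assumes mono: "i \<in> {1..r} \<Longrightarrow> j \<in> {1..r} \<Longrightarrow> i < j \<Longrightarrow> a i < a j"
    and range: "i \<in> {1..r} \<Longrightarrow> a i \<in> {2..d}"
begin

text \<open>The underlying set, so that \<open>e\<^sub>S\<close> is \<open>x\<^bsub>a\<^sub>1\<^esub> \<and> \<dots> \<and> x\<^bsub>a\<^sub>r\<^esub>\<close>.\<close>

definition S :: "nat set" where "S = a ` {1..r}"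

lemma less_iff: "i \<in> {1..r} \<Longrightarrow> j \<in> {1..r} \<Longrightarrow> a i < a j \<longleftrightarrow> i < j"
  using mono by (metis linorder_neqE_nat order_less_asym order_less_irrefl)

lemma eq_iff: "i \<in> {1..r} \<Longrightarrow> j \<in> {1..r} \<Longrightarrow> a i = a j \<longleftrightarrow> i = j"
  using mono by (metis linorder_neqE_nat order_less_irrefl)

lemma inj: "inj_on a {1..r}"
  by (rule inj_onI) (simp only: eq_iff)

lemma finite_S [simp]: "finite S" by (simp add: S_def)

lemma mem_S: "i \<in> {1..r} \<Longrightarrow> a i \<in> S" by (simp add: S_def)

lemma S_subset: "S \<subseteq> {2..d}" using range by (auto simp: S_def)

lemma S_subset1: "S \<subseteq> {1..d}" using S_subset by auto

lemma card_S: "card S = r" by (simp add: S_def card_image[OF inj])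

lemma sg_S: "k \<in> {1..r} \<Longrightarrow> sg S (a k) = (- ((-1) ^ k) :: 'c::comm_ring_1)"
proof -
  assume k: "k \<in> {1..r}"
  have "{s\<in>S. s < a k} = a ` {1..<k}"
    using k by (auto simp: S_def less_iff)
  moreover have "inj_on a {1..<k}" using k by (intro inj_on_subset[OF inj]) auto
  then have "card (a ` {1..<k}) = k - 1" by (simp add: card_image)
  ultimately show ?thesis using k by (cases k) (auto simp: sg_def)
qed

lemma sg_S_remove:
  assumes "k \<in> {1..r}" "j \<in> {1..r}"
  shows "sg (S - {a k}) (a j) = ((if k < j then (-1) ^ j else - ((-1) ^ j)) :: 'c::comm_ring_1)"
  using assms by (simp add: sg_remove mem_S less_iff sg_S)

lemma sum_S_remove: "k \<in> {1..r} \<Longrightarrow> (\<Sum>i\<in>S - {a k}. f i) = (\<Sum>j\<in>{1..r} - {k}. f (a j))"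
proof -
  assume k: "k \<in> {1..r}"
  have "S - {a k} = a ` ({1..r} - {k})" using k by (auto simp: S_def eq_iff)
  then show ?thesis by (simp add: sum.reindex[OF inj_on_subset[OF inj]])
qed

lemma sum_S: "(\<Sum>i\<in>S. f i) = (\<Sum>j\<in>{1..r}. f (a j))"
  by (simp add: S_def sum.reindex[OF inj])

lemma Suc_le_a: "i \<in> {1..r} \<Longrightarrow> Suc i \<le> a i"
proof (induction i)
  case (Suc i)
  show ?case
  proof (cases "i = 0")
    case True then show ?thesis using range[of 1] Suc by (auto simp: One_nat_def)
  next
    case False
    then have "Suc i \<le> a i" "a i < a (Suc i)" using Suc mono[of i "Suc i"] by auto
    then show ?thesis by simp
  qed
qed simp

end

section \<open>Straightening in L\<close>

context index_seq
begin

text \<open>The straightening relation for an index \<open>l\<close> below all elements of \<open>S - {a\<^sub>k}\<close>, with the signs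
  read off from positions in the index sequence.\<close>

lemma hY_straighten_S:
  assumes k: "k \<in> {1..r}" and l: "1 \<le> l" "l \<le> d" "\<And>j. j \<in> {1..r} - {k} \<Longrightarrow> l < a j"
  shows "hY d (S - {a k}) (mx l + v) = (\<Sum>j\<in>{1..r} - {k}. smul (if k < j then (-1) ^ j else - ((-1) ^ j))
          (hY d (insert l (S - {a j, a k})) (mx (a j) + v) :: _ \<Rightarrow>\<^sub>0 'c::comm_ring_1))"
proof -
  have "hY d (S - {a k}) (mx l + v) = (\<Sum>i\<in>S - {a k}. smul (sg (S - {a k}) i)
        (hY d (insert l (S - {a k} - {i})) (mx i + v) :: _ \<Rightarrow>\<^sub>0 'c))"
  proof (rule hY_straighten)
    show "S - {a k} \<subseteq> {1..d}" using S_subset1 by auto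
    show "l \<in> {1..d}" using l by simp
    show "l < i" if "i \<in> S - {a k}" for i
      using that l(3) k by (auto simp: S_def eq_iff)
  qed
  also have "\<dots> = (\<Sum>j\<in>{1..r} - {k}. smul (if k < j then (-1) ^ j else - ((-1) ^ j))
        (hY d (insert l (S - {a j, a k})) (mx (a j) + v)))"
    unfolding sum_S_remove[OF k]
  proof (intro sum.cong refl)
    fix j assume "j \<in> {1..r} - {k}"
    then have "sg (S - {a k}) (a j) = ((if k < j then (-1) ^ j else - ((-1) ^ j)) :: 'c)"
      using sg_S_remove[OF k] by blast
    moreover have "S - {a k} - {a j} = S - {a j, a k}" by blast
    ultimately show "smul (sg (S - {a k}) (a j)) (hY d (insert l (S - {a k} - {a j})) (mx (a j) + v) :: _ \<Rightarrow>\<^sub>0 'c)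
      = smul (if k < j then (-1) ^ j else - ((-1) ^ j)) (hY d (insert l (S - {a j, a k})) (mx (a j) + v))"
      by (simp only:)
  qed
  finally show ?thesis .
qed

lemma sum_hY_straighten:
  fixes A :: "mon \<Rightarrow> 'c::comm_ring_1"
  assumes k: "k \<in> {1..r}" and l: "1 \<le> l" "l \<le> d" "\<And>j. j \<in> {1..r} - {k} \<Longrightarrow> l < a j" and s: "1 \<le> s"
  shows "(\<Sum>v\<in>mons d l (s - 1). smul (A (mx l + v)) (hY d (S - {a k}) (mx l + v)))
    = (\<Sum>j\<in>{1..r} - {k}. \<Sum>m\<in>mons d l s.
        smul (of_bool (dvdx (a j) m) * (if k < j then (-1) ^ j else - ((-1) ^ j)) * A (mx l + m - mx (a j)))
          (hY d (insert l (S - {a j, a k})) m))"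
proof -
  have "(\<Sum>v\<in>mons d l (s - 1). smul (A (mx l + v)) (hY d (S - {a k}) (mx l + v)))
    = (\<Sum>v\<in>mons d l (s - 1). \<Sum>j\<in>{1..r} - {k}. smul ((if k < j then (-1) ^ j else - ((-1) ^ j)) * A (mx l + v))
         (hY d (insert l (S - {a j, a k})) (mx (a j) + v)))"
    by (simp only: hY_straighten_S[OF k l] smul_sum smul_mult[symmetric] mult.commute[of "A _"])
  also have "\<dots> = (\<Sum>j\<in>{1..r} - {k}. \<Sum>v\<in>mons d l (s - 1). smul ((if k < j then (-1) ^ j else - ((-1) ^ j)) * A (mx l + v))
         (hY d (insert l (S - {a j, a k})) (mx (a j) + v)))"
    by (rule sum.swap)
  also have "\<dots> = (\<Sum>j\<in>{1..r} - {k}. \<Sum>m\<in>mons d l s.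
        smul (of_bool (dvdx (a j) m) * ((if k < j then (-1) ^ j else - ((-1) ^ j)) * A (mx l + m - mx (a j))))
          (hY d (insert l (S - {a j, a k})) m))"
  proof (rule sum.cong[OF refl])
    fix j assume j: "j \<in> {1..r} - {k}"
    then have j': "l \<le> a j" "a j \<le> d" using l(3)[OF j] range by auto
    have "mx l + (mx (a j) + v) - mx (a j) = mx l + v" for v
      by (simp add: add.left_commute[of "mx l" "mx (a j)"])
    then show "(\<Sum>v\<in>mons d l (s - 1). smul ((if k < j then (-1) ^ j else - ((-1) ^ j)) * A (mx l + v))
         (hY d (insert l (S - {a j, a k})) (mx (a j) + v))) = (\<Sum>m\<in>mons d l s.
        smul (of_bool (dvdx (a j) m) * ((if k < j then (-1) ^ j else - ((-1) ^ j)) * A (mx l + m - mx (a j))))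
          (hY d (insert l (S - {a j, a k})) m))"
      by (simp only: sum_mons_dvdx[OF s j'])
  qed
  finally show ?thesis by (simp only: mult.assoc)
qed

text \<open>The expansion in the basis of \<open>L\<close> of an alternating sum of generators. A generator
  \<open>\<kappa>(e\<^bsub>S - a\<^sub>k\<^esub> \<otimes> u)\<close> is a basis element when the least variable of \<open>u\<close> is not below
  \<open>min(S - a\<^sub>k)\<close>, which is \<open>a\<^sub>1\<close>, or \<open>a\<^sub>2\<close> if \<open>k = 1\<close>; the others are straightened with
  respect to their least variable \<open>x\<^sub>l\<close>.\<close>

lemma expand_hY:
  fixes A :: "nat \<Rightarrow> mon \<Rightarrow> 'c::comm_ring_1"
  assumes r: "2 \<le> r" and s: "1 \<le> s"
  shows "(\<Sum>k=1..r. smul ((-1) ^ k) (\<Sum>u\<in>mons d 2 s. smul (A (a k) u) (hY d (S - {a k}) u)))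
    = (\<Sum>l\<in>{2..<a 1}. \<Sum>j=1..r. \<Sum>k=j+1..r. \<Sum>m\<in>mons d l s.
         smul (- ((-1) ^ (k + j)) * (of_bool (dvdx (a j) m) * A (a k) (mx l + m - mx (a j))
                                 - of_bool (dvdx (a k) m) * A (a j) (mx l + m - mx (a k))))
           (hY d (insert l (S - {a j, a k})) m))
    + (\<Sum>k=2..r. \<Sum>m\<in>mons d (a 1) s.
         smul ((-1) ^ k * (A (a k) m - of_bool (dvdx (a k) m) * A (a 1) (mx (a 1) + m - mx (a k))))
           (hY d (S - {a k}) m))
    + (\<Sum>l\<in>{a 1<..<a 2}. \<Sum>k=2..r. \<Sum>m\<in>mons d l s.
         smul ((-1) ^ (k + 1) * of_bool (dvdx (a k) m) * A (a 1) (mx l + m - mx (a k)))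
           (hY d (insert l (S - {a 1, a k})) m))
    + (\<Sum>m\<in>mons d (a 2) s. smul (- A (a 1) m) (hY d (S - {a 1}) m))"
proof -
  define F where "F k u = smul (A (a k) u) (hY d (S - {a k}) u)" for k u
  define G where "G k l = (\<Sum>v\<in>mons d l (s - 1). F k (mx l + v))" for k l
  define E where "E l k j = (\<Sum>m\<in>mons d l s.
      smul (of_bool (dvdx (a j) m) * (if k < j then (-1) ^ j else - ((-1) ^ j)) * A (a k) (mx l + m - mx (a j)))
          (hY d (insert l (S - {a j, a k})) m))" for l k j
  have a1: "2 \<le> a 1" "a 1 < a 2" "a 2 \<le> d"
    using range[of 1] range[of 2] mono[of 1 2] r by auto
  have GE: "G k l = (\<Sum>j\<in>{1..r} - {k}. E l k j)"
    if "k \<in> {1..r}" "1 \<le> l" "l \<le> d" "\<And>j. j \<in> {1..r} - {k} \<Longrightarrow> l < a j" for k l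
    unfolding G_def E_def F_def using sum_hY_straighten[OF that s, of "A (a k)"] .
  \<comment> \<open>the least variable is below \<open>a\<^sub>1\<close>\<close>
  have low: "(\<Sum>k=1..r. smul ((-1) ^ k) (\<Sum>l\<in>{2..<a 1}. G k l)) =
     (\<Sum>l\<in>{2..<a 1}. \<Sum>j=1..r. \<Sum>k=j+1..r. \<Sum>m\<in>mons d l s.
         smul (- ((-1) ^ (k + j)) * (of_bool (dvdx (a j) m) * A (a k) (mx l + m - mx (a j))
                                 - of_bool (dvdx (a k) m) * A (a j) (mx l + m - mx (a k))))
           (hY d (insert l (S - {a j, a k})) m))"
  proof -
    have "(\<Sum>k=1..r. smul ((-1) ^ k) (\<Sum>l\<in>{2..<a 1}. G k l)) = (\<Sum>l\<in>{2..<a 1}. \<Sum>k=1..r. smul ((-1) ^ k) (G k l))"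
      unfolding smul_sum by (rule sum.swap)
    also have "\<dots> = (\<Sum>l\<in>{2..<a 1}. \<Sum>k=1..r. \<Sum>j\<in>{1..r} - {k}. smul ((-1) ^ k) (E l k j))"
    proof (intro sum.cong refl)
      fix l k assume l: "l \<in> {2..<a 1}" and k: "k \<in> {1..r}"
      have "a 1 \<le> a j" if "j \<in> {1..r}" for j
        using mono[of 1 j] that r by (cases "j = 1") (auto intro: less_imp_le)
      then have "G k l = (\<Sum>j\<in>{1..r} - {k}. E l k j)"
        using l k a1 by (intro GE) (auto intro: less_le_trans)
      then show "smul ((-1) ^ k) (G k l) = (\<Sum>j\<in>{1..r} - {k}. smul ((-1) ^ k) (E l k j))"
        by (simp only: smul_sum)
    qed
    also have "\<dots> = (\<Sum>l\<in>{2..<a 1}. \<Sum>j=1..r. \<Sum>k=j+1..r. smul ((-1) ^ k) (E l k j) + smul ((-1) ^ j) (E l j k))"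
      by (simp only: sum_pairs_distinct)
    also have "\<dots> = (\<Sum>l\<in>{2..<a 1}. \<Sum>j=1..r. \<Sum>k=j+1..r. \<Sum>m\<in>mons d l s.
         smul (- ((-1) ^ (k + j)) * (of_bool (dvdx (a j) m) * A (a k) (mx l + m - mx (a j))
                                 - of_bool (dvdx (a k) m) * A (a j) (mx l + m - mx (a k))))
           (hY d (insert l (S - {a j, a k})) m))"
    proof (intro sum.cong refl)
      fix l j k assume "j \<in> {1..r}" "k \<in> {j+1..r}"
      then have jk: "j < k" and nkj: "(k < j) = False" by simp_all
      have ins: "{a k, a j} = {a j, a k}" by blast
      have "smul ((-1) ^ k) (E l k j) + smul ((-1) ^ j) (E l j k) = (\<Sum>m\<in>mons d l s.
          smul ((-1) ^ k * (of_bool (dvdx (a j) m) * (- ((-1) ^ j)) * A (a k) (mx l + m - mx (a j)))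
              + (-1) ^ j * (of_bool (dvdx (a k) m) * (-1) ^ k * A (a j) (mx l + m - mx (a k))))
           (hY d (insert l (S - {a j, a k})) m))"
        using jk by (simp only: E_def smul_sum smul_mult[symmetric] sum.distrib[symmetric] smul_add_left ins
            if_True if_False nkj simp_thms)
      also have "\<dots> = (\<Sum>m\<in>mons d l s.
         smul (- ((-1) ^ (k + j)) * (of_bool (dvdx (a j) m) * A (a k) (mx l + m - mx (a j))
                                 - of_bool (dvdx (a k) m) * A (a j) (mx l + m - mx (a k))))
           (hY d (insert l (S - {a j, a k})) m))"
        by (intro sum.cong refl arg_cong2[where f = smul]) (simp add: power_add algebra_simps)
      finally show "smul ((-1) ^ k) (E l k j) + smul ((-1) ^ j) (E l j k) = (\<Sum>m\<in>mons d l s.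
         smul (- ((-1) ^ (k + j)) * (of_bool (dvdx (a j) m) * A (a k) (mx l + m - mx (a j))
                                 - of_bool (dvdx (a k) m) * A (a j) (mx l + m - mx (a k))))
           (hY d (insert l (S - {a j, a k})) m))" .
    qed
    finally show ?thesis .
  qed
  \<comment> \<open>the terms with \<open>k = 1\<close> and least variable in \<open>[a\<^sub>1, a\<^sub>2 - 1]\<close>\<close>
  have G1: "G 1 l = (\<Sum>k=2..r. \<Sum>m\<in>mons d l s.
         smul ((-1) ^ k * of_bool (dvdx (a k) m) * A (a 1) (mx l + m - mx (a k)))
           (hY d (insert l (S - {a 1, a k})) m))" if l: "l \<in> {a 1..<a 2}" for l
  proof -
    have "a 2 \<le> a j" if "j \<in> {1..r} - {1}" for j
      using mono[of 2 j] that r by (cases "j = 2") (auto intro: less_imp_le)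
    then have "G 1 l = (\<Sum>j\<in>{1..r} - {1}. E l 1 j)"
      using l a1 r by (intro GE) (auto intro: less_le_trans)
    also have "{1..r} - {1} = {2..r}" by auto
    also have "(\<Sum>j\<in>{2..r}. E l 1 j) = (\<Sum>k=2..r. \<Sum>m\<in>mons d l s.
         smul ((-1) ^ k * of_bool (dvdx (a k) m) * A (a 1) (mx l + m - mx (a k)))
           (hY d (insert l (S - {a 1, a k})) m))"
      unfolding E_def by (intro sum.cong refl arg_cong2[where f = smul]) (auto simp: insert_commute)
    finally show ?thesis .
  qed
  have split1: "(\<Sum>u\<in>mons d (a 1) s. F 1 u) = G 1 (a 1) + (\<Sum>l\<in>{a 1<..<a 2}. G 1 l) + (\<Sum>u\<in>mons d (a 2) s. F 1 u)"
  proof -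
    have "{a 1..<a 2} = insert (a 1) {a 1<..<a 2}" using a1 by auto
    then show ?thesis
      using sum_mons_least[OF s, of "a 1" "a 2" d "F 1"] a1 by (simp add: G_def)
  qed
  have S1: "insert (a 1) (S - {a 1, a k}) = S - {a k}" if "k \<in> {2..r}" for k
    using that mem_S[of 1] eq_iff[of 1 k] by auto
  have "(\<Sum>k=1..r. smul ((-1) ^ k) (\<Sum>u\<in>mons d 2 s. F k u))
      = (\<Sum>k=1..r. smul ((-1) ^ k) (\<Sum>l\<in>{2..<a 1}. G k l)) + (\<Sum>k=1..r. smul ((-1) ^ k) (\<Sum>u\<in>mons d (a 1) s. F k u))"
    using a1 by (simp add: sum_mons_least[OF s, of 2 "a 1" d] G_def smul_add sum.distrib)
  also have "(\<Sum>k=1..r. smul ((-1) ^ k) (\<Sum>u\<in>mons d (a 1) s. F k u))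
      = - (\<Sum>u\<in>mons d (a 1) s. F 1 u) + (\<Sum>k=2..r. smul ((-1) ^ k) (\<Sum>u\<in>mons d (a 1) s. F k u))"
  proof -
    have "{1..r} = insert 1 {2..r}" using r by auto
    then show ?thesis by simp
  qed
  also have "\<dots> = ((\<Sum>k=2..r. smul ((-1) ^ k) (\<Sum>u\<in>mons d (a 1) s. F k u)) - G 1 (a 1))
      + - (\<Sum>l\<in>{a 1<..<a 2}. G 1 l) + - (\<Sum>u\<in>mons d (a 2) s. F 1 u)"
    unfolding split1 by simp
  also have "(\<Sum>k=2..r. smul ((-1) ^ k) (\<Sum>u\<in>mons d (a 1) s. F k u)) - G 1 (a 1) =
      (\<Sum>k=2..r. \<Sum>m\<in>mons d (a 1) s.
         smul ((-1) ^ k * (A (a k) m - of_bool (dvdx (a k) m) * A (a 1) (mx (a 1) + m - mx (a k))))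
           (hY d (S - {a k}) m))"
  proof -
    have "G 1 (a 1) = (\<Sum>k=2..r. \<Sum>m\<in>mons d (a 1) s.
         smul ((-1) ^ k * of_bool (dvdx (a k) m) * A (a 1) (mx (a 1) + m - mx (a k)))
           (hY d (S - {a k}) m))"
      using a1 S1 by (subst G1) auto
    then show ?thesis
      by (simp only: F_def smul_sum smul_mult[symmetric] sum_subtractf[symmetric] smul_diff_left[symmetric]
          mult.assoc right_diff_distrib)
  qed
  also have "- (\<Sum>l\<in>{a 1<..<a 2}. G 1 l) = (\<Sum>l\<in>{a 1<..<a 2}. \<Sum>k=2..r. \<Sum>m\<in>mons d l s.
         smul ((-1) ^ (k + 1) * of_bool (dvdx (a k) m) * A (a 1) (mx l + m - mx (a k)))
           (hY d (insert l (S - {a 1, a k})) m))"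
    unfolding sum_negf[symmetric]
  proof (rule sum.cong[OF refl])
    fix l assume "l \<in> {a 1<..<a 2}"
    then show "- G 1 l = (\<Sum>k=2..r. \<Sum>m\<in>mons d l s.
         smul ((-1) ^ (k + 1) * of_bool (dvdx (a k) m) * A (a 1) (mx l + m - mx (a k)))
           (hY d (insert l (S - {a 1, a k})) m))"
      by (subst G1) (auto simp: power_add simp flip: sum_negf)
  qed
  also have "- (\<Sum>u\<in>mons d (a 2) s. F 1 u) = (\<Sum>m\<in>mons d (a 2) s. smul (- A (a 1) m) (hY d (S - {a 1}) m))"
    by (simp add: F_def sum_negf)
  finally show ?thesis unfolding low F_def by (simp only: add.assoc)
qed

end

section \<open>Straightening in K\<close>

text \<open>An index sequence together with the end point \<open>\<gamma>\<close> of the initial segment \<open>[2, \<gamma>]\<close> contained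
  in it; the segment is empty if \<open>\<gamma> = 1\<close>. Thus \<open>a\<^sub>i = i + 1\<close> for \<open>i < \<gamma>\<close>, and \<open>\<gamma> + 1\<close> is the
  first index missing from the sequence.\<close>

locale index_seq_gap = index_seq +
  fixes \<gamma> :: nat
  assumes initial: "{2..\<gamma>} \<subseteq> a ` {1..r}"
    and maximal: "\<And>g. {2..g} \<subseteq> a ` {1..r} \<Longrightarrow> g \<le> \<gamma>"
begin

lemma gap_ge_1: "1 \<le> \<gamma>"
  by (rule maximal) auto

lemma a_initial:
  assumes "1 \<le> i" "i < \<gamma>"
  shows "i \<le> r \<and> a i = Suc i"
  using assms
proof (induction i rule: less_induct)
  case (less i)
  have "Suc i \<in> a ` {1..r}" using initial less.prems by auto
  then obtain j where j: "j \<in> {1..r}" "a j = Suc i" by force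
  then have "j \<le> i" using Suc_le_a[of j] by simp
  moreover have "\<not> j < i"
    using less.IH[of j] j less.prems by auto
  ultimately show ?case using j by auto
qed

lemma gap_le: "\<gamma> \<le> Suc r"
proof (cases "\<gamma> \<le> 1")
  case False
  then show ?thesis using a_initial[of "\<gamma> - 1"] by linarith
qed simp

lemma gap_not_mem: "Suc \<gamma> \<notin> S"
proof
  assume "Suc \<gamma> \<in> S"
  moreover have "{2..Suc \<gamma>} \<subseteq> insert (Suc \<gamma>) {2..\<gamma>}" by auto
  ultimately have "{2..Suc \<gamma>} \<subseteq> a ` {1..r}"
    using initial unfolding S_def by blast
  from maximal[OF this] show False by simp
qed

lemma gap_less: "i \<in> {\<gamma>..r} \<Longrightarrow> Suc \<gamma> < a i"
proof -
  assume i: "i \<in> {\<gamma>..r}"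
  then have i': "i \<in> {1..r}" using gap_ge_1 by auto
  then have "a i \<noteq> Suc \<gamma>" using gap_not_mem mem_S[of i] by metis
  then show ?thesis using Suc_le_a[OF i'] i by auto
qed

text \<open>Straightening of the generators \<open>\<eta>(e\<^bsub>S - l\<^esub> \<otimes> u\<^sup>*)\<close> with \<open>l = a\<^sub>k = k + 1\<close> in the
  initial segment of \<open>S\<close> and \<open>u\<close> a monomial in \<open>x\<^sub>l, \<dots>, x\<^sub>d\<close>.\<close>

lemma hX_straighten_initial:
  assumes l: "l \<in> {2..\<gamma>}" and u: "u \<in> mons d l s"
  shows "hX d (S - {l}) u = (\<Sum>k=l..r. smul (- ((-1) ^ (l - 1)) * (-1) ^ k * of_bool (dvdx (a k) u))
     (hX d (S - {a k}) (mx l + (u - mx (a k))) :: _ \<Rightarrow>\<^sub>0 'c::comm_ring_1))"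
proof -
  define p where "p = l - 1"
  have p: "1 \<le> p" "p < \<gamma>" "l = Suc p" using l by (auto simp: p_def)
  have p': "p \<in> {1..r}" "a p = l" using a_initial[OF p(1,2)] p by auto
  have lS: "l \<in> S" using mem_S[OF p'(1)] p' by simp
  have ld: "l \<in> {2..d}" using lS S_subset by blast
  have sgl: "sg (S - {l}) l = (- ((-1) ^ p) :: 'c)"
    using sg_S[OF p'(1)] p'(2) lS by (simp add: sg_remove)
  have "hX d (S - {l}) u = (\<Sum>i\<in>S - {l}. smul (- sg (S - {l}) l * sg (insert l (S - {l})) i * of_bool (dvdx i u))
         (hX d (insert l (S - {l}) - {i}) (mx l + (u - mx i)) :: _ \<Rightarrow>\<^sub>0 'c))"
    using S_subset1 ld by (intro hX_straighten) auto
  also have "\<dots> = (\<Sum>i\<in>S - {a p}. smul ((-1) ^ p * sg S i * of_bool (dvdx i u))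
         (hX d (S - {i}) (mx l + (u - mx i))))"
    using lS by (simp add: insert_absorb sgl p'(2))
  also have "\<dots> = (\<Sum>k\<in>{1..r} - {p}. smul ((-1) ^ p * sg S (a k) * of_bool (dvdx (a k) u))
         (hX d (S - {a k}) (mx l + (u - mx (a k)))))"
    by (rule sum_S_remove[OF p'(1)])
  also have "\<dots> = (\<Sum>k=l..r. smul ((-1) ^ p * sg S (a k) * of_bool (dvdx (a k) u))
         (hX d (S - {a k}) (mx l + (u - mx (a k)))))"
  proof (rule sum.mono_neutral_right)
    show "{l..r} \<subseteq> {1..r} - {p}" using p by auto
    show "\<forall>i\<in>{1..r} - {p} - {l..r}. smul ((-1) ^ p * sg S (a i) * of_bool (dvdx (a i) u))
         (hX d (S - {a i}) (mx l + (u - mx (a i)))) = (0 :: _ \<Rightarrow>\<^sub>0 'c)"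
    proof
      fix i assume i: "i \<in> {1..r} - {p} - {l..r}"
      then have "i < p" using p by auto
      then have "a i < l" using less_iff[of i p] i p' by auto
      then show "smul ((-1) ^ p * sg S (a i) * of_bool (dvdx (a i) u))
         (hX d (S - {a i}) (mx l + (u - mx (a i)))) = (0 :: _ \<Rightarrow>\<^sub>0 'c)"
        using not_dvdx_mons[OF u] by simp
    qed
  qed simp
  also have "\<dots> = (\<Sum>k=l..r. smul (- ((-1) ^ p) * (-1) ^ k * of_bool (dvdx (a k) u))
   (hX d (S - {a k}) (mx l + (u - mx (a k)))))"
    using l by (intro sum.cong refl) (simp add: sg_S)
  finally show ?thesis by (simp only: p_def)
qed

lemma sum_hX_straighten_initial:
  fixes A :: "mon \<Rightarrow> 'c::comm_ring_1"
  assumes l: "l \<in> {2..\<gamma>}" and s: "1 \<le> s"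
  shows "smul ((-1) ^ (l - 1)) (\<Sum>u\<in>mons d l s. smul (A u) (hX d (S - {l}) u))
    = (\<Sum>k=l..r. \<Sum>m\<in>mons d l (s - 1). smul (- ((-1) ^ k) * A (mx (a k) + m)) (hX d (S - {a k}) (mx l + m)))"
proof -
  define p where "p = l - 1"
  note st = hX_straighten_initial[OF l, folded p_def]
  have "smul ((-1) ^ p) (\<Sum>u\<in>mons d l s. smul (A u) (hX d (S - {l}) u))
    = (\<Sum>u\<in>mons d l s. \<Sum>k=l..r. smul (of_bool (dvdx (a k) u) * (- ((-1) ^ k) * A u))
         (hX d (S - {a k}) (mx l + (u - mx (a k)))))"
    unfolding smul_sum
  proof (rule sum.cong[OF refl])
    fix u assume u: "u \<in> mons d l s"
    have sq: "(-1) ^ p * ((-1) ^ p * c) = (c :: 'c)" for c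
      by (simp flip: mult.assoc power_mult_distrib)
    show "smul ((-1) ^ p) (smul (A u) (hX d (S - {l}) u)) = (\<Sum>k=l..r. smul (of_bool (dvdx (a k) u) * (- ((-1) ^ k) * A u))
         (hX d (S - {a k}) (mx l + (u - mx (a k)))))"
      unfolding st[OF u] smul_sum smul_mult[symmetric]
      by (intro sum.cong refl arg_cong2[where f = smul]) (simp add: sq mult.left_commute mult.commute)
  qed
  also have "\<dots> = (\<Sum>k=l..r. \<Sum>u\<in>mons d l s. smul (of_bool (dvdx (a k) u) * (- ((-1) ^ k) * A u))
         (hX d (S - {a k}) (mx l + (u - mx (a k)))))"
    by (rule sum.swap)
  also have "\<dots> = (\<Sum>k=l..r. \<Sum>m\<in>mons d l (s - 1). smul (- ((-1) ^ k) * A (mx (a k) + m)) (hX d (S - {a k}) (mx l + m)))"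
  proof (rule sum.cong[OF refl])
    fix k assume "k \<in> {l..r}"
    then have "k \<in> {1..r}" "l \<le> k" using l by auto
    then have "l \<le> a k" "a k \<le> d" using Suc_le_a[of k] range[of k] by auto
    then show "(\<Sum>u\<in>mons d l s. smul (of_bool (dvdx (a k) u) * (- ((-1) ^ k) * A u))
         (hX d (S - {a k}) (mx l + (u - mx (a k))))) = (\<Sum>m\<in>mons d l (s - 1). smul (- ((-1) ^ k) * A (mx (a k) + m)) (hX d (S - {a k}) (mx l + m)))"
      by (subst sum_mons_dvdx[OF s]) auto
  qed
  finally show ?thesis by (simp only: p_def)
qed

text \<open>Straightening with respect to the first index \<open>\<gamma> + 1\<close> missing from \<open>S\<close>. The factor
  \<open>(-1)\<^sup>\<gamma>\<close> comes from the \<open>\<gamma> - 1\<close> elements of \<open>S\<close> below \<open>\<gamma> + 1\<close>.\<close>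

lemma sum_hX_straighten_gap:
  fixes A :: "mon \<Rightarrow> 'c::comm_ring_1"
  assumes k: "k \<in> {\<gamma>..r}" and s: "1 \<le> s" and r: "r < d"
  shows "(\<Sum>u\<in>mons d (\<gamma> + 1) s. smul (A u) (hX d (S - {a k}) u))
    = (\<Sum>j\<in>{\<gamma>..r} - {k}. \<Sum>m\<in>mons d (\<gamma> + 1) (s - 1).
         smul ((if j < k then (-1) ^ (\<gamma> + j) else - ((-1) ^ (\<gamma> + j))) * A (mx (a j) + m))
           (hX d (insert (\<gamma> + 1) S - {a j, a k}) (mx (\<gamma> + 1) + m)))"
proof -
  let ?g = "\<gamma> + 1"
  have k': "k \<in> {1..r}" using k gap_ge_1 by auto
  have g: "?g \<in> {1..d}" "?g \<notin> S" using k r gap_not_mem by (auto simp: One_nat_def)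
  have below: "{s\<in>S - {a k}. s < ?g} = a ` {1..<\<gamma>}"
  proof (intro equalityI subsetI)
    fix x assume "x \<in> {s\<in>S - {a k}. s < ?g}"
    then obtain i where i: "i \<in> {1..r}" "x = a i" "a i < ?g" by (auto simp: S_def)
    moreover have "i < \<gamma>" using gap_less[of i] i by (cases "i < \<gamma>") auto
    ultimately show "x \<in> a ` {1..<\<gamma>}" by auto
  next
    fix x assume "x \<in> a ` {1..<\<gamma>}"
    then obtain i where i: "1 \<le> i" "i < \<gamma>" "x = a i" by auto
    then have "i \<in> {1..r}" "a i = Suc i" "i < k" using a_initial[of i] k by auto
    then show "x \<in> {s\<in>S - {a k}. s < ?g}" using i mem_S[of i] k' eq_iff[of i k] by auto
  qed
  have sgg: "sg (S - {a k}) ?g = (- ((-1) ^ \<gamma>) :: 'c)"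
  proof -
    have "inj_on a {1..<\<gamma>}" using gap_le by (intro inj_on_subset[OF inj]) auto
    then have "card (a ` {1..<\<gamma>}) = \<gamma> - 1" by (simp add: card_image)
    then show ?thesis using gap_ge_1 unfolding sg_def below by (cases \<gamma>) auto
  qed
  have st: "hX d (S - {a k}) u = (\<Sum>j\<in>{\<gamma>..r} - {k}.
     smul ((if j < k then (-1) ^ (\<gamma> + j) else - ((-1) ^ (\<gamma> + j))) * of_bool (dvdx (a j) u))
     (hX d (insert ?g S - {a j, a k}) (mx ?g + (u - mx (a j))) :: _ \<Rightarrow>\<^sub>0 'c))" if u: "u \<in> mons d ?g s" for u
  proof -
    let ?c = "\<lambda>i. - sg (S - {a k}) ?g * sg (insert ?g (S - {a k})) i * of_bool (dvdx i u) :: 'c"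
    have "hX d (S - {a k}) u = (\<Sum>i\<in>S - {a k}. smul (?c i)
           (hX d (insert ?g (S - {a k}) - {i}) (mx ?g + (u - mx i)) :: _ \<Rightarrow>\<^sub>0 'c))"
      using S_subset1 g by (intro hX_straighten) auto
    also have "\<dots> = (\<Sum>j\<in>{1..r} - {k}. smul (?c (a j))
           (hX d (insert ?g (S - {a k}) - {a j}) (mx ?g + (u - mx (a j)))))"
      by (rule sum_S_remove[OF k'])
    also have "\<dots> = (\<Sum>j\<in>{\<gamma>..r} - {k}. smul (?c (a j))
           (hX d (insert ?g (S - {a k}) - {a j}) (mx ?g + (u - mx (a j)))))"
    proof (rule sum.mono_neutral_right)
      show "{\<gamma>..r} - {k} \<subseteq> {1..r} - {k}" using gap_ge_1 by auto
      show "\<forall>i\<in>{1..r} - {k} - ({\<gamma>..r} - {k}). smul (?c (a i))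
           (hX d (insert ?g (S - {a k}) - {a i}) (mx ?g + (u - mx (a i)))) = (0 :: _ \<Rightarrow>\<^sub>0 'c)"
      proof
        fix i assume i: "i \<in> {1..r} - {k} - ({\<gamma>..r} - {k})"
        then have "1 \<le> i" "i < \<gamma>" by auto
        then have "a i < ?g" using a_initial[of i] by auto
        then show "smul (?c (a i))
           (hX d (insert ?g (S - {a k}) - {a i}) (mx ?g + (u - mx (a i)))) = (0 :: _ \<Rightarrow>\<^sub>0 'c)"
          using not_dvdx_mons[OF u] by simp
      qed
    qed simp
    also have "\<dots> = (\<Sum>j\<in>{\<gamma>..r} - {k}.
     smul ((if j < k then (-1) ^ (\<gamma> + j) else - ((-1) ^ (\<gamma> + j))) * of_bool (dvdx (a j) u))
     (hX d (insert ?g S - {a j, a k}) (mx ?g + (u - mx (a j)))))"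
    proof (rule sum.cong[OF refl])
      fix j assume j: "j \<in> {\<gamma>..r} - {k}"
      then have j': "j \<in> {1..r}" "?g < a j" using gap_ge_1 gap_less[of j] by auto
      have "sg (insert ?g (S - {a k})) (a j) = (- sg (S - {a k}) (a j) :: 'c)"
        using g j' by (subst sg_insert) auto
      also have "\<dots> = (if k < j then - ((-1) ^ j) else (-1) ^ j)"
        by (simp only: sg_S_remove[OF k' j'(1)]) simp
      finally have "?c (a j) = (if j < k then (-1) ^ (\<gamma> + j) else - ((-1) ^ (\<gamma> + j))) * of_bool (dvdx (a j) u)"
        using j by (auto simp: sgg power_add)
      moreover have "insert ?g (S - {a k}) - {a j} = insert ?g S - {a j, a k}"
        using gap_less[OF k] by auto
      ultimately show "smul (?c (a j)) (hX d (insert ?g (S - {a k}) - {a j}) (mx ?g + (u - mx (a j)))) =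
        smul ((if j < k then (-1) ^ (\<gamma> + j) else - ((-1) ^ (\<gamma> + j))) * of_bool (dvdx (a j) u))
     (hX d (insert ?g S - {a j, a k}) (mx ?g + (u - mx (a j))) :: _ \<Rightarrow>\<^sub>0 'c)" by (simp only:)
    qed
    finally show ?thesis .
  qed
  have "(\<Sum>u\<in>mons d ?g s. smul (A u) (hX d (S - {a k}) u))
    = (\<Sum>u\<in>mons d ?g s. \<Sum>j\<in>{\<gamma>..r} - {k}.
     smul (of_bool (dvdx (a j) u) * ((if j < k then (-1) ^ (\<gamma> + j) else - ((-1) ^ (\<gamma> + j))) * A u))
     (hX d (insert ?g S - {a j, a k}) (mx ?g + (u - mx (a j)))))"
  proof (rule sum.cong[OF refl])
    fix u assume u: "u \<in> mons d ?g s"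
    show "smul (A u) (hX d (S - {a k}) u) = (\<Sum>j\<in>{\<gamma>..r} - {k}.
     smul (of_bool (dvdx (a j) u) * ((if j < k then (-1) ^ (\<gamma> + j) else - ((-1) ^ (\<gamma> + j))) * A u))
     (hX d (insert ?g S - {a j, a k}) (mx ?g + (u - mx (a j)))))"
      unfolding st[OF u] smul_sum smul_mult[symmetric]
      by (intro sum.cong refl arg_cong2[where f = smul]) (simp add: mult.commute mult.left_commute)
  qed
  also have "\<dots> = (\<Sum>j\<in>{\<gamma>..r} - {k}. \<Sum>u\<in>mons d ?g s.
     smul (of_bool (dvdx (a j) u) * ((if j < k then (-1) ^ (\<gamma> + j) else - ((-1) ^ (\<gamma> + j))) * A u))
     (hX d (insert ?g S - {a j, a k}) (mx ?g + (u - mx (a j)))))"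
    by (rule sum.swap)
  also have "\<dots> = (\<Sum>j\<in>{\<gamma>..r} - {k}. \<Sum>m\<in>mons d ?g (s - 1).
         smul ((if j < k then (-1) ^ (\<gamma> + j) else - ((-1) ^ (\<gamma> + j))) * A (mx (a j) + m))
           (hX d (insert ?g S - {a j, a k}) (mx ?g + m)))"
  proof (rule sum.cong[OF refl])
    fix j assume "j \<in> {\<gamma>..r} - {k}"
    then have j: "?g \<le> a j" "a j \<le> d"
      using gap_less[of j] range[of j] gap_ge_1 by auto
    show "(\<Sum>u\<in>mons d ?g s.
     smul (of_bool (dvdx (a j) u) * ((if j < k then (-1) ^ (\<gamma> + j) else - ((-1) ^ (\<gamma> + j))) * A u))
     (hX d (insert ?g S - {a j, a k}) (mx ?g + (u - mx (a j))))) = (\<Sum>m\<in>mons d ?g (s - 1).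
         smul ((if j < k then (-1) ^ (\<gamma> + j) else - ((-1) ^ (\<gamma> + j))) * A (mx (a j) + m))
           (hX d (insert ?g S - {a j, a k}) (mx ?g + m)))"
      by (subst sum_mons_dvdx[OF s j]) (simp only: add_diff_cancel_left')
  qed
  finally show ?thesis .
qed

text \<open>The expansion in the basis of \<open>K\<close> of an alternating sum of generators. The generator
  \<open>\<eta>(e\<^bsub>S - a\<^sub>k\<^esub> \<otimes> u\<^sup>*)\<close> is a basis element when the least variable \<open>x\<^sub>l\<close> of \<open>u\<close> satisfies
  \<open>l \<le> min(k, \<gamma>)\<close>; the others are straightened with respect to \<open>a\<^sub>k = k + 1\<close> if \<open>k < \<gamma>\<close>, and
  with respect to \<open>\<gamma> + 1\<close> otherwise.\<close>

lemma expand_hX: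
  fixes A :: "nat \<Rightarrow> mon \<Rightarrow> 'c::comm_ring_1"
  assumes r: "r < d" and s: "1 \<le> s"
  shows "(\<Sum>k=1..r. smul ((-1) ^ k) (\<Sum>u\<in>mons d 2 s. smul (A (a k) u) (hX d (S - {a k}) u)))
    = (\<Sum>l=2..\<gamma>. \<Sum>k=l..r. \<Sum>m\<in>mons d l (s - 1).
         smul ((-1) ^ k * (A (a k) (mx l + m) - A l (mx (a k) + m))) (hX d (S - {a k}) (mx l + m)))
    + (\<Sum>j=\<gamma>..r. \<Sum>k=j+1..r. \<Sum>m\<in>mons d (\<gamma> + 1) (s - 1).
         smul ((-1) ^ (\<gamma> + j + k) * (A (a k) (mx (a j) + m) - A (a j) (mx (a k) + m)))
           (hX d (insert (\<gamma> + 1) S - {a j, a k}) (mx (\<gamma> + 1) + m)))"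
proof -
  define F where "F k u = smul (A (a k) u) (hX d (S - {a k}) u)" for k u
  have split: "(\<Sum>u\<in>mons d 2 s. F k u) = (\<Sum>l\<in>{l\<in>{2..\<gamma>}. l \<le> k}. \<Sum>v\<in>mons d l (s - 1). F k (mx l + v))
      + (\<Sum>u\<in>mons d (min k \<gamma> + 1) s. F k u)" if k: "k \<in> {1..r}" for k
  proof -
    have "{l\<in>{2..\<gamma>}. l \<le> k} = {2..<min k \<gamma> + 1}" by auto
    then show ?thesis
      using sum_mons_least[OF s, of 2 "min k \<gamma> + 1" d "F k"] k gap_ge_1 r by auto
  qed
  \<comment> \<open>the basis elements among the generators\<close>
  have good: "(\<Sum>k=1..r. smul ((-1) ^ k) (\<Sum>l\<in>{l\<in>{2..\<gamma>}. l \<le> k}. \<Sum>v\<in>mons d l (s - 1). F k (mx l + v)))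
      = (\<Sum>l=2..\<gamma>. \<Sum>k=l..r. \<Sum>v\<in>mons d l (s - 1). smul ((-1) ^ k) (F k (mx l + v)))"
  proof -
    have "(\<Sum>k=1..r. smul ((-1) ^ k) (\<Sum>l\<in>{l\<in>{2..\<gamma>}. l \<le> k}. \<Sum>v\<in>mons d l (s - 1). F k (mx l + v)))
      = (\<Sum>l=2..\<gamma>. \<Sum>k\<in>{k\<in>{1..r}. l \<le> k}. \<Sum>v\<in>mons d l (s - 1). smul ((-1) ^ k) (F k (mx l + v)))"
      unfolding smul_sum by (rule sum.swap_restrict) auto
    also have "\<dots> = (\<Sum>l=2..\<gamma>. \<Sum>k=l..r. \<Sum>v\<in>mons d l (s - 1). smul ((-1) ^ k) (F k (mx l + v)))"
      by (intro sum.cong refl) auto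
    finally show ?thesis .
  qed
  have "{1..r} = {1..<\<gamma>} \<union> {\<gamma>..r}" using gap_ge_1 gap_le by auto
  then have "(\<Sum>k=1..r. smul ((-1) ^ k) (\<Sum>u\<in>mons d (min k \<gamma> + 1) s. F k u))
      = (\<Sum>k\<in>{1..<\<gamma>}. smul ((-1) ^ k) (\<Sum>u\<in>mons d (min k \<gamma> + 1) s. F k u))
      + (\<Sum>k=\<gamma>..r. smul ((-1) ^ k) (\<Sum>u\<in>mons d (min k \<gamma> + 1) s. F k u))"
    by (simp only:) (rule sum.union_disjoint, auto)
  also have "(\<Sum>k\<in>{1..<\<gamma>}. smul ((-1) ^ k) (\<Sum>u\<in>mons d (min k \<gamma> + 1) s. F k u))
      = (\<Sum>l=2..\<gamma>. smul ((-1) ^ (l - 1)) (\<Sum>u\<in>mons d l s. smul (A l u) (hX d (S - {l}) u)))"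
    by (rule sum.reindex_bij_witness[of _ "\<lambda>l. l - 1" Suc]) (auto simp: F_def a_initial One_nat_def)
  also have "\<dots> = (\<Sum>l=2..\<gamma>. \<Sum>k=l..r. \<Sum>m\<in>mons d l (s - 1).
      smul (- ((-1) ^ k) * A l (mx (a k) + m)) (hX d (S - {a k}) (mx l + m)))"
    by (rule sum.cong[OF refl sum_hX_straighten_initial[OF _ s]])
  also have "(\<Sum>k=\<gamma>..r. smul ((-1) ^ k) (\<Sum>u\<in>mons d (min k \<gamma> + 1) s. F k u))
     = (\<Sum>k=\<gamma>..r. \<Sum>j\<in>{\<gamma>..r} - {k}. \<Sum>m\<in>mons d (\<gamma> + 1) (s - 1).
         smul ((-1) ^ k * (if j < k then (-1) ^ (\<gamma> + j) else - ((-1) ^ (\<gamma> + j))) * A (a k) (mx (a j) + m))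
           (hX d (insert (\<gamma> + 1) S - {a j, a k}) (mx (\<gamma> + 1) + m)))"
    (is "_ = (\<Sum>k=\<gamma>..r. \<Sum>j\<in>{\<gamma>..r} - {k}. ?E k j)")
  proof (rule sum.cong[OF refl])
    fix k assume k: "k \<in> {\<gamma>..r}"
    then have "min k \<gamma> = \<gamma>" by simp
    then show "smul ((-1) ^ k) (\<Sum>u\<in>mons d (min k \<gamma> + 1) s. F k u) = (\<Sum>j\<in>{\<gamma>..r} - {k}. ?E k j)"
      by (simp only: F_def sum_hX_straighten_gap[OF k s r] smul_sum smul_mult[symmetric] mult.assoc)
  qed
  also have "\<dots> = (\<Sum>j=\<gamma>..r. \<Sum>k=j+1..r. ?E k j + ?E j k)"
    by (rule sum_pairs_distinct)
  also have "\<dots> = (\<Sum>j=\<gamma>..r. \<Sum>k=j+1..r. \<Sum>m\<in>mons d (\<gamma> + 1) (s - 1).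
         smul ((-1) ^ (\<gamma> + j + k) * (A (a k) (mx (a j) + m) - A (a j) (mx (a k) + m)))
           (hX d (insert (\<gamma> + 1) S - {a j, a k}) (mx (\<gamma> + 1) + m)))"
  proof (intro sum.cong refl)
    fix j k assume "j \<in> {\<gamma>..r}" "k \<in> {j+1..r}"
    then have jk: "j < k" and nkj: "(k < j) = False" by simp_all
    have ins: "{a k, a j} = {a j, a k}" by blast
    have "?E k j + ?E j k = (\<Sum>m\<in>mons d (\<gamma> + 1) (s - 1).
         smul ((-1) ^ k * (-1) ^ (\<gamma> + j) * A (a k) (mx (a j) + m)
             + (-1) ^ j * (- ((-1) ^ (\<gamma> + k))) * A (a j) (mx (a k) + m))
           (hX d (insert (\<gamma> + 1) S - {a j, a k}) (mx (\<gamma> + 1) + m)))"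
      by (simp only: sum.distrib[symmetric] smul_add_left ins jk nkj if_True if_False simp_thms)
    also have "\<dots> = (\<Sum>m\<in>mons d (\<gamma> + 1) (s - 1).
         smul ((-1) ^ (\<gamma> + j + k) * (A (a k) (mx (a j) + m) - A (a j) (mx (a k) + m)))
           (hX d (insert (\<gamma> + 1) S - {a j, a k}) (mx (\<gamma> + 1) + m)))"
      by (intro sum.cong refl arg_cong2[where f = smul]) (simp add: power_add algebra_simps)
    finally show "?E k j + ?E j k = \<dots>" .
  qed
  finally have rest: "(\<Sum>k=1..r. smul ((-1) ^ k) (\<Sum>u\<in>mons d (min k \<gamma> + 1) s. F k u))
    = (\<Sum>l=2..\<gamma>. \<Sum>k=l..r. \<Sum>m\<in>mons d l (s - 1).
        smul (- ((-1) ^ k) * A l (mx (a k) + m)) (hX d (S - {a k}) (mx l + m)))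
    + (\<Sum>j=\<gamma>..r. \<Sum>k=j+1..r. \<Sum>m\<in>mons d (\<gamma> + 1) (s - 1).
         smul ((-1) ^ (\<gamma> + j + k) * (A (a k) (mx (a j) + m) - A (a j) (mx (a k) + m)))
           (hX d (insert (\<gamma> + 1) S - {a j, a k}) (mx (\<gamma> + 1) + m)))" .
  have "(\<Sum>k=1..r. smul ((-1) ^ k) (\<Sum>u\<in>mons d 2 s. F k u))
    = (\<Sum>k=1..r. smul ((-1) ^ k) (\<Sum>l\<in>{l\<in>{2..\<gamma>}. l \<le> k}. \<Sum>v\<in>mons d l (s - 1). F k (mx l + v)))
    + (\<Sum>k=1..r. smul ((-1) ^ k) (\<Sum>u\<in>mons d (min k \<gamma> + 1) s. F k u))"
    by (simp only: sum.distrib[symmetric] smul_add[symmetric]) (rule sum.cong, simp_all add: split)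
  also have "\<dots> = (\<Sum>l=2..\<gamma>. \<Sum>k=l..r. \<Sum>m\<in>mons d l (s - 1).
         smul ((-1) ^ k * (A (a k) (mx l + m) - A l (mx (a k) + m))) (hX d (S - {a k}) (mx l + m)))
    + (\<Sum>j=\<gamma>..r. \<Sum>k=j+1..r. \<Sum>m\<in>mons d (\<gamma> + 1) (s - 1).
         smul ((-1) ^ (\<gamma> + j + k) * (A (a k) (mx (a j) + m) - A (a j) (mx (a k) + m)))
           (hX d (insert (\<gamma> + 1) S - {a j, a k}) (mx (\<gamma> + 1) + m)))"
    unfolding good rest add.assoc[symmetric] unfolding F_def
    by (simp only: sum.distrib[symmetric] smul_mult[symmetric] smul_add_left[symmetric])
       (intro arg_cong2[where f = "(+)"] sum.cong refl arg_cong2[where f = smul], simp add: right_diff_distrib)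
  finally show ?thesis unfolding F_def .
qed

end

section \<open>The adjoint of T and the contractions of Phi\<close>

text \<open>The matrix identity \<open>T Q = \<delta>\<close>, written with sums over monomials.\<close>

lemma sum_adj_T:
  assumes "v \<in> mons d 1 (n - 1)" "\<nu> \<in> mons d 1 (n - 1)"
  shows "(\<Sum>m\<in>mons d 1 (n - 1). Q d n m \<nu> * tR (m + v)) = (if v = \<nu> then delta d n else 0)"
proof -
  let ?L = "mlist d n" and ?T = "Tmat d n"
  let ?N = "length ?L"
  have L: "set ?L = mons d 1 (n - 1)" "distinct ?L"
    unfolding mlist_def by auto
  have inj: "inj_on (\<lambda>i. ?L ! i) {..<?N}" using L(2) by (simp add: inj_on_nth)
  have pos: "mpos d n (?L ! i) = i" if "i < ?N" for i
    unfolding mpos_def using that by (intro the_inv_into_f_f[OF inj]) simp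
  obtain i where i: "i < ?N" "v = ?L ! i" using assms(1) unfolding L(1)[symmetric] in_set_conv_nth by blast
  obtain j where j: "j < ?N" "\<nu> = ?L ! j" using assms(2) unfolding L(1)[symmetric] in_set_conv_nth by blast
  have T: "?T \<in> carrier_mat ?N ?N" by (simp add: Tmat_def)
  have adj: "adj_mat ?T \<in> carrier_mat ?N ?N" "?T * adj_mat ?T = det ?T \<cdot>\<^sub>m 1\<^sub>m ?N"
    using adj_mat[OF T] by auto
  have "(\<Sum>m\<in>mons d 1 (n - 1). Q d n m \<nu> * tR (m + v)) = (\<Sum>k<?N. Q d n (?L ! k) \<nu> * tR (?L ! k + v))"
    by (rule sum.reindex_bij_betw[symmetric]) (use bij_betw_nth[OF L(2) refl refl] L(1) in auto)
  also have "\<dots> = (\<Sum>k<?N. ?T $$ (i, k) * adj_mat ?T $$ (k, j))"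
    using i j by (intro sum.cong) (auto simp: Q_def pos Tmat_def add.commute mult.commute)
  also have "\<dots> = (?T * adj_mat ?T) $$ (i, j)"
    using T adj(1) i j by (simp add: times_mat_def scalar_prod_def atLeast0LessThan)
  also have "\<dots> = (if i = j then delta d n else 0)"
    using i j by (simp add: adj(2) delta_def)
  also have "i = j \<longleftrightarrow> v = \<nu>" using i j L(2) by (simp add: nth_eq_iff_index_eq)
  finally show ?thesis .
qed

lemma lookup_Phit_mx_add:
  "Poly_Mapping.lookup (Phit d n) (mx 1 + v) = (if v \<in> mons d 1 (2 * n - 2) then tR v else 0)"
  by (simp add: Phit_def lookup_sum lookup_single when_def)

lemma lookup_Phit_not_dvdx: "\<not> dvdx 1 w \<Longrightarrow> Poly_Mapping.lookup (Phit d n) w = 0"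
proof -
  assume w: "\<not> dvdx 1 w"
  have "mx 1 + m \<noteq> w" for m using w by (metis dvdx_mx_add)
  then show ?thesis by (simp add: Phit_def lookup_sum lookup_single when_def)
qed

lemma lookup_contract_superset:
  assumes "finite A" "Poly_Mapping.keys s \<subseteq> A"
  shows "Poly_Mapping.lookup (contract s \<nu>) u
     = (\<Sum>m\<in>A. Poly_Mapping.lookup s m * Poly_Mapping.lookup \<nu> (m + u))"
  unfolding lookup_contract using assms
  by (intro sum.mono_neutral_left) (auto simp: in_keys_iff)

lemma q_bas: "q d n (bas \<nu>) = (\<Sum>m\<in>mons d 1 (n - 1). Poly_Mapping.single m (Q d n m \<nu>))"
  by (simp add: q_def)

lemma lookup_sum_single:
  assumes "finite A"
  shows "Poly_Mapping.lookup (\<Sum>m\<in>A. Poly_Mapping.single m (c m)) u = (if u \<in> A then c u else 0)"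
  using assms by (simp add: lookup_sum lookup_single when_def)

lemma keys_sum_single: "finite A \<Longrightarrow> Poly_Mapping.keys (\<Sum>m\<in>A. Poly_Mapping.single m (c m)) \<subseteq> A"
  by (auto simp: in_keys_iff lookup_sum_single split: if_splits)

lemma mons_add_cancel:
  assumes "m \<in> mons d k s" "m + u \<in> mons d k s'"
  shows "u \<in> mons d k (s' - s)"
  using assms by (auto simp: mons_def keys_add_mon mdeg_add)

lemma mons_Suc_not_dvdx: "u \<in> mons d k s \<Longrightarrow> \<not> dvdx k u \<Longrightarrow> u \<in> mons d (Suc k) s"
proof -
  assume u: "u \<in> mons d k s" "\<not> dvdx k u"
  have "{Suc k..d} = {k..d} - {k}" by auto
  then show ?thesis using u by (auto simp: mons_def dvdx_def)
qed

text \<open>The coefficient of \<open>u\<^sup>*\<close> in \<open>[q(\<nu>\<^sup>*)](\<Phi>\<^sup>~)\<close>, for \<open>u\<close> not divisible by \<open>x\<^sub>1\<close>.\<close>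

definition cPhi :: "nat \<Rightarrow> nat \<Rightarrow> mon \<Rightarrow> mon \<Rightarrow> R" where
  "cPhi d n \<nu> u = (\<Sum>m\<in>mons d 1 (n - 2). tR (m + u) * Q d n (mx 1 + m) \<nu>)"

text \<open>The monomials \<open>u\<close> divisible by \<open>x\<^sub>1\<close> contribute an entry of \<open>T Q\<close>, hence only \<open>\<delta> (x\<^sub>1 \<nu>)\<^sup>*\<close>.\<close>

lemma contract_q_Phit:
  assumes n: "2 \<le> n" and d: "1 \<le> d" and \<nu>: "\<nu> \<in> mons d 1 (n - 1)"
  shows "contract (q d n (bas \<nu>)) (Phit d n)
    = (\<Sum>u\<in>mons d 2 n. Poly_Mapping.single u (cPhi d n \<nu> u)) + Poly_Mapping.single (mx 1 + \<nu>) (delta d n)"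
    (is "?l = ?r")
proof (rule poly_mapping_eqI)
  fix u
  have l: "Poly_Mapping.lookup ?l u
      = (\<Sum>m\<in>mons d 1 (n - 1). Q d n m \<nu> * Poly_Mapping.lookup (Phit d n) (m + u))"
    by (subst lookup_contract_superset[OF finite_mons[of d 1 "n - 1"]])
       (auto simp: q_bas lookup_sum_single keys_sum_single intro!: sum.cong)
  have r: "Poly_Mapping.lookup ?r u
      = (if u \<in> mons d 2 n then cPhi d n \<nu> u else 0) + (if mx 1 + \<nu> = u then delta d n else 0)"
    by (simp add: lookup_add lookup_sum_single lookup_single when_def)
  have nu': "mx 1 + \<nu> \<in> mons d 1 n" using \<nu> n d by (simp add: mx_add_mons)
  consider "u \<notin> mons d 1 n" | v where "u = mx 1 + v" "v \<in> mons d 1 (n - 1)"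
    | "u \<in> mons d 2 n"
  proof (cases "u \<in> mons d 1 n \<and> dvdx 1 u")
    case True
    then have "u = mx 1 + (u - mx 1)" "u - mx 1 \<in> mons d 1 (n - 1)"
      by (auto simp: mx_add_minus minus_mx_mons)
    then show ?thesis using that(2) by blast
  next
    case False
    then show ?thesis using that mons_Suc_not_dvdx[of u d 1 n] by (auto simp: numeral_2_eq_2 One_nat_def)
  qed
  then show "Poly_Mapping.lookup ?l u = Poly_Mapping.lookup ?r u"
  proof cases
    case 1
    have "Poly_Mapping.lookup (Phit d n) (m + u) = 0" if m: "m \<in> mons d 1 (n - 1)" for m
    proof (rule ccontr)
      assume nz: "Poly_Mapping.lookup (Phit d n) (m + u) \<noteq> 0"
      then have dv: "dvdx 1 (m + u)" using lookup_Phit_not_dvdx by blast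
      then have "m + u - mx 1 \<in> mons d 1 (2 * n - 2)"
        using nz lookup_Phit_mx_add[of d n "m + u - mx 1"] by (auto simp: mx_add_minus split: if_splits)
      then have "mx 1 + (m + u - mx 1) \<in> mons d 1 (2 * n - 1)"
        using n d by (simp add: mx_add_mons numeral_2_eq_2 One_nat_def)
      then have "m + u \<in> mons d 1 (2 * n - 1)" using dv by (simp add: mx_add_minus)
      then have "u \<in> mons d 1 (2 * n - 1 - (n - 1))" by (rule mons_add_cancel[OF m])
      moreover have "2 * n - 1 - (n - 1) = n" using n by simp
      ultimately show False using 1 by simp
    qed
    moreover have "u \<notin> mons d 2 n" using 1 mons_mono[of 1 2 u d n] by auto
    ultimately show ?thesis unfolding l r using 1 nu' by auto
  next
    case v: (2 v)
    have "Poly_Mapping.lookup (Phit d n) (m + u) = tR (m + v)" if m: "m \<in> mons d 1 (n - 1)" for m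
    proof -
      have "n - 1 + (n - 1) = 2 * n - 2" using n by simp
      then have "m + v \<in> mons d 1 (2 * n - 2)" using mons_add[OF m v(2)] by simp
      moreover have "m + u = mx 1 + (m + v)" using v by (simp add: ac_simps)
      ultimately show ?thesis by (simp only: lookup_Phit_mx_add if_True)
    qed
    then have "Poly_Mapping.lookup ?l u = (if v = \<nu> then delta d n else 0)"
      unfolding l using sum_adj_T[OF v(2) \<nu>] by simp
    moreover have "u \<notin> mons d 2 n" using not_dvdx_mons[of u d 2 n 1] v by auto
    ultimately show ?thesis unfolding r using v by auto
  next
    case u: 3
    have ndu: "\<not> dvdx 1 u" using not_dvdx_mons[OF u, of 1] by simp
    have "Poly_Mapping.lookup ?l u = (\<Sum>m\<in>{m\<in>mons d 1 (n - 1). dvdx 1 m}. Q d n m \<nu> * Poly_Mapping.lookup (Phit d n) (m + u))"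
      unfolding l by (intro sum.mono_neutral_right) (auto simp: lookup_Phit_not_dvdx dvdx_add ndu)
    also have "\<dots> = (\<Sum>v\<in>mons d 1 (n - 1 - 1). Q d n (mx 1 + v) \<nu> * Poly_Mapping.lookup (Phit d n) (mx 1 + v + u))"
      by (rule sum_mons_filter_dvdx) (use n d in auto)
    also have "\<dots> = (\<Sum>v\<in>mons d 1 (n - 2). Q d n (mx 1 + v) \<nu> * tR (v + u))"
    proof (rule sum.cong)
      show "mons d 1 (n - 1 - 1) = mons d 1 (n - 2)" by (simp add: numeral_2_eq_2 One_nat_def)
      fix v assume v: "v \<in> mons d 1 (n - 2)"
      have u1: "u \<in> mons d 1 n" using mons_mono[OF _ u, of 1] by simp
      have "n - 2 + n = 2 * n - 2" using n by simp
      then have "v + u \<in> mons d 1 (2 * n - 2)" using mons_add[OF v u1] by simp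
      then show "Q d n (mx 1 + v) \<nu> * Poly_Mapping.lookup (Phit d n) (mx 1 + v + u) = Q d n (mx 1 + v) \<nu> * tR (v + u)"
        by (simp only: add.assoc lookup_Phit_mx_add if_True)
    qed
    also have "\<dots> = cPhi d n \<nu> u" by (simp add: cPhi_def mult.commute)
    finally show ?thesis unfolding r using u ndu by auto
  qed
qed

lemma contract_bas_Phit:
  assumes n: "2 \<le> n" and d: "1 \<le> d" and \<mu>: "\<mu> \<in> mons d 2 n"
  shows "contract (bas \<mu>) (Phit d n) = (\<Sum>m\<in>mons d 1 (n - 2). Poly_Mapping.single (mx 1 + m) (tR (\<mu> + m)))"
    (is "?l = ?r")
proof (rule poly_mapping_eqI)
  fix u
  have \<mu>1: "\<mu> \<in> mons d 1 n" using mons_mono[OF _ \<mu>, of 1] by simp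
  have l: "Poly_Mapping.lookup ?l u = Poly_Mapping.lookup (Phit d n) (\<mu> + u)"
    by (simp add: lookup_contract)
  show "Poly_Mapping.lookup ?l u = Poly_Mapping.lookup ?r u"
  proof (cases "dvdx 1 u")
    case True
    define v where "v = u - mx 1"
    have u: "u = mx 1 + v" using True by (simp add: v_def mx_add_minus)
    have "\<mu> + v \<in> mons d 1 (2 * n - 2) \<longleftrightarrow> v \<in> mons d 1 (n - 2)"
    proof
      assume "\<mu> + v \<in> mons d 1 (2 * n - 2)"
      then have "v \<in> mons d 1 (2 * n - 2 - n)" by (rule mons_add_cancel[OF \<mu>1])
      moreover have "2 * n - 2 - n = n - 2" by simp
      ultimately show "v \<in> mons d 1 (n - 2)" by (simp only:)
    next
      assume "v \<in> mons d 1 (n - 2)"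
      then have "\<mu> + v \<in> mons d 1 (n + (n - 2))" by (rule mons_add[OF \<mu>1])
      moreover have "n + (n - 2) = 2 * n - 2" using n by simp
      ultimately show "\<mu> + v \<in> mons d 1 (2 * n - 2)" by (simp only:)
    qed
    moreover have "\<mu> + u = mx 1 + (\<mu> + v)" by (simp add: u ac_simps)
    ultimately have "Poly_Mapping.lookup ?l u = (if v \<in> mons d 1 (n - 2) then tR (\<mu> + v) else 0)"
      by (simp only: l lookup_Phit_mx_add)
    also have "\<dots> = Poly_Mapping.lookup ?r u"
      by (simp add: u lookup_sum lookup_single when_def)
    finally show ?thesis .
  next
    case False
    then have "mx 1 + m \<noteq> u" for m by (metis dvdx_mx_add)
    moreover have "\<not> dvdx 1 (\<mu> + u)" using False not_dvdx_mons[OF \<mu>, of 1] by (simp add: dvdx_add)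
    ultimately show ?thesis by (simp add: l lookup_Phit_not_dvdx lookup_sum lookup_single when_def)
  qed
qed

lemma contract_linear:
  "contract (smul c p) w = smul c (contract p w)" "contract (\<Sum>i\<in>A. g i) w = (\<Sum>i\<in>A. contract (g i) w)"
proof -
  have "contract p w = lin (\<lambda>m. Poly_Mapping.map_key ((+) m) w) p" for p
    by (simp add: contract_def lin_def)
  then show "contract (smul c p) w = smul c (contract p w)"
    "contract (\<Sum>i\<in>A. g i) w = (\<Sum>i\<in>A. contract (g i) w)"
    by (simp_all only: lin_smul lin_sum)
qed

lemma q_contract_Phit:
  assumes "2 \<le> n" "1 \<le> d" "\<mu> \<in> mons d 2 n"
  shows "q d n (contract (bas \<mu>) (Phit d n)) = (\<Sum>m\<in>mons d 1 (n - 2). smul (tR (\<mu> + m)) (q d n (bas (mx 1 + m))))"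
  unfolding contract_bas_Phit[OF assms] by (simp add: q_def lin_sum)

lemma proj_linear:
  "proj (smul c p) = smul c (proj p)" "proj (\<Sum>i\<in>A. g i) = (\<Sum>i\<in>A. proj (g i))"
  by (simp_all add: proj_def lin_smul lin_sum)

lemma proj_q_bas: "proj (q d n (bas \<nu>)) = (\<Sum>u\<in>mons d 2 (n - 1). Poly_Mapping.single u (Q d n u \<nu>))"
proof -
  have "proj (q d n (bas \<nu>)) = (\<Sum>u\<in>mons d 1 (n - 1). if dvdx 1 u then 0 else Poly_Mapping.single u (Q d n u \<nu>))"
    unfolding q_bas proj_def lin_sum by (intro sum.cong) auto
  also have "\<dots> = (\<Sum>u\<in>mons d 2 (n - 1). Poly_Mapping.single u (Q d n u \<nu>))"
  proof (rule sum.mono_neutral_cong_right)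
    show "mons d 2 (n - 1) \<subseteq> mons d 1 (n - 1)" using mons_mono[of 1 2] by auto
    show "\<forall>u\<in>mons d 1 (n - 1) - mons d 2 (n - 1). (if dvdx 1 u then 0 else Poly_Mapping.single u (Q d n u \<nu>)) = 0"
      using mons_Suc_not_dvdx[of _ d 1 "n - 1"] by (auto simp: numeral_2_eq_2 One_nat_def)
    show "(if dvdx 1 u then 0 else Poly_Mapping.single u (Q d n u \<nu>)) = Poly_Mapping.single u (Q d n u \<nu>)"
      if "u \<in> mons d 2 (n - 1)" for u using not_dvdx_mons[OF that, of 1] by simp
  qed simp
  finally show ?thesis .
qed

section \<open>The differentials on the generators\<close>

lemma eta_tens: "eta d (tens (bas W) p) = lin (hX d W) p"
  unfolding tens_bas lin_def by (simp only: eta_linear hX_def)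

lemma kappa_tens: "kappa d (tens (bas W) p) = lin (hY d W) p"
  unfolding tens_bas lin_def by (simp only: kappa_linear hY_def)

lemma linB_eq: "linB f p = (lin (fst \<circ> f) p, lin (snd \<circ> f) p)"
  by (simp add: linB_def lin_def smulB_def prod_eq_iff fst_sum snd_sum)

lemma lin_hX:
  assumes "S \<subseteq> {1..d}"
  shows "lin g (hX d S m) = (\<Sum>i\<in>S. smul (sg S i * of_bool (dvdx i m)) (g (S - {i}, m - mx i)))"
  by (simp add: hX_def eta_bas[OF assms] lin_sum lin_smul)

lemma lin_hY:
  assumes "S \<subseteq> {1..d}"
  shows "lin g (hY d S m) = (\<Sum>i\<in>S. smul (sg S i) (g (S - {i}, mx i + m)))"
  by (simp add: hY_def kappa_bas[OF assms] lin_sum lin_smul)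

lemma lin_sum_single: "lin g (\<Sum>u\<in>A. Poly_Mapping.single u (c u)) = (\<Sum>u\<in>A. smul (c u) (g u))"
  by (simp add: lin_sum)

text \<open>The Koszul differential anticommutes with contractions. Here \<open>x j\<close> is the coefficient that
  \<open>Kos\<close> attaches to the removal of \<open>j\<close>, and \<open>c i\<close> the one that \<open>\<eta>\<close> or \<open>\<kappa>\<close> attaches to the removal
  of \<open>i\<close>.\<close>

lemma sum_sg_swap:
  fixes f :: "nat set \<Rightarrow> nat \<Rightarrow> ('k \<Rightarrow>\<^sub>0 'c::comm_ring_1)"
  assumes fin: "finite S"
  shows "(\<Sum>i\<in>S. smul (sg S i * c i) (\<Sum>j\<in>S - {i}. smul (x j * sg (S - {i}) j) (f (S - {i} - {j}) i)))
   = (\<Sum>j\<in>S. smul (- (x j * sg S j)) (\<Sum>i\<in>S - {j}. smul (sg (S - {j}) i * c i) (f (S - {j} - {i}) i)))"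
proof -
  have "(\<Sum>i\<in>S. smul (sg S i * c i) (\<Sum>j\<in>S - {i}. smul (x j * sg (S - {i}) j) (f (S - {i} - {j}) i)))
    = (\<Sum>i\<in>S. \<Sum>j\<in>{j\<in>S. i \<noteq> j}. smul (- (x j * sg S j) * (sg (S - {j}) i * c i)) (f (S - {j} - {i}) i))"
    unfolding smul_sum
  proof (intro sum.cong refl)
    show "S - {i} = {j\<in>S. i \<noteq> j}" for i by auto
    fix i j assume ij: "i \<in> S" "j \<in> {j\<in>S. i \<noteq> j}"
    have "S - {i} - {j} = S - {j} - {i}" by blast
    moreover have "sg S i * c i * (x j * sg (S - {i}) j) = (sg S i * sg (S - {i}) j) * (x j * c i)"
      by (simp add: ac_simps)
    then have "sg S i * c i * (x j * sg (S - {i}) j) = - (x j * sg S j) * (sg (S - {j}) i * c i)"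
      using ij sg_anticommute[OF fin, of i j, where 'c = 'c] by (simp add: ac_simps)
    ultimately show "smul (sg S i * c i) (smul (x j * sg (S - {i}) j) (f (S - {i} - {j}) i))
      = smul (- (x j * sg S j) * (sg (S - {j}) i * c i)) (f (S - {j} - {i}) i)"
      by (simp only: smul_mult[symmetric])
  qed
  also have "\<dots> = (\<Sum>j\<in>S. \<Sum>i\<in>{i\<in>S. i \<noteq> j}. smul (- (x j * sg S j) * (sg (S - {j}) i * c i)) (f (S - {j} - {i}) i))"
    using fin by (rule sum.swap_restrict[OF _ fin])
  also have "\<dots> = (\<Sum>j\<in>S. smul (- (x j * sg S j)) (\<Sum>i\<in>S - {j}. smul (sg (S - {j}) i * c i) (f (S - {j} - {i}) i)))"
    unfolding smul_sum smul_mult[symmetric] by (intro sum.cong refl) auto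
  finally show ?thesis .
qed

lemma kosT_hX:
  assumes "S \<subseteq> {1..d}"
  shows "(\<Sum>i\<in>S. smul (sg S i * of_bool (dvdx i m)) (kosT d (bas (S - {i})) (bas (m - mx i))))
    = (\<Sum>j\<in>S. smul (- (xR j * sg S j)) (hX d (S - {j}) m))"
proof -
  have S: "finite S" "\<And>i. S - {i} \<subseteq> {1..d}" using assms finite_subset by auto
  show ?thesis
    unfolding kosT_bas[OF S(2)] hX_def eta_bas[OF S(2)] by (rule sum_sg_swap[OF S(1)])
qed

lemma kosT_hY:
  assumes "S \<subseteq> {1..d}"
  shows "(\<Sum>i\<in>S. smul (sg S i) (kosT d (bas (S - {i})) (bas (mx i + m))))
    = (\<Sum>j\<in>S. smul (- (xR j * sg S j)) (hY d (S - {j}) m))"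
proof -
  have S: "finite S" "\<And>i. S - {i} \<subseteq> {1..d}" using assms finite_subset by auto
  show ?thesis
    unfolding kosT_bas[OF S(2)] hY_def kappa_bas[OF S(2)]
    using sum_sg_swap[OF S(1), of "\<lambda>_. 1" xR "\<lambda>T i. bas (T, mx i + m)"] by simp
qed

text \<open>The differential of \<open>\<eta>(e\<^sub>S \<otimes> m\<^sup>*)\<close> in terms of generators, before straightening.\<close>

lemma linB_brK_hX:
  assumes n: "2 \<le> n" and d: "1 \<le> d" and S: "S \<subseteq> {2..d}" and m: "m \<in> mons d 2 n"
  shows "linB (brK d n) (hX d S m) =
    (smul (xR 1) (\<Sum>i\<in>S. smul (- sg S i) (\<Sum>u\<in>mons d 2 n.
        smul (of_bool (dvdx i m) * cPhi d n (m - mx i) u) (hX d (S - {i}) u)))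
      + smul (delta d n) (\<Sum>i\<in>S. smul (- (xR i * sg S i)) (hX d (S - {i}) m)),
     smul (xR 1) (\<Sum>i\<in>S. smul (- sg S i) (\<Sum>u\<in>mons d 2 (n - 1).
        smul (of_bool (dvdx i m) * Q d n u (m - mx i)) (hY d (S - {i}) u))))"
proof -
  have S1: "S \<subseteq> {1..d}" using S by auto
  define P where "P i = (\<Sum>u\<in>mons d 2 n. smul (cPhi d n (m - mx i) u) (hX d (S - {i}) u))" for i
  let ?s = "\<lambda>i. sg S i * of_bool (dvdx i m) :: R"
  have mi: "m - mx i \<in> mons d 1 (n - 1)" if "dvdx i m" for i
    using minus_mx_mons[OF mons_mono[OF _ m, of 1] that] by simp
  have con: "smul (?s i) (lin (hX d (S - {i})) (contract (q d n (bas (m - mx i))) (Phit d n)))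
      = smul (?s i) (P i) + smul (delta d n) (smul (?s i) (hX d (S - {i}) (mx 1 + (m - mx i))))" for i
  proof (cases "dvdx i m")
    case True
    then show ?thesis
      unfolding contract_q_Phit[OF n d mi[OF True]] lin_add lin_sum_single P_def smul_add
      by (simp add: smul_mult[symmetric] mult.commute)
  qed simp
  \<comment> \<open>the terms divisible by \<open>x\<^sub>1\<close> sum up to \<open>\<eta>\<^sup>2\<close> of an element\<close>
  have van: "(\<Sum>i\<in>S. smul (?s i) (hX d (S - {i}) (mx 1 + (m - mx i)))) = (0 :: _ \<Rightarrow>\<^sub>0 R)"
  proof -
    have "(\<Sum>i\<in>S. smul (?s i) (hX d (S - {i}) (mx 1 + (m - mx i)))) = eta d (hX d S (mx 1 + m))"
      unfolding eta_hX_expand[OF S1]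
    proof (rule sum.cong[OF refl])
      fix i assume "i \<in> S"
      then have "i \<noteq> 1" using S by auto
      then show "smul (?s i) (hX d (S - {i}) (mx 1 + (m - mx i)))
          = smul (sg S i * of_bool (dvdx i (mx 1 + m))) (hX d (S - {i}) (mx 1 + m - mx i))"
        by (cases "dvdx i m") (simp_all add: mx_add_minus_other)
    qed
    then show ?thesis by (simp add: eta_hX[OF S1])
  qed
  have "lin (fst \<circ> brK d n) (hX d S m) = (\<Sum>i\<in>S.
       smul (- xR 1) (smul (?s i) (lin (hX d (S - {i})) (contract (q d n (bas (m - mx i))) (Phit d n))))
     + smul (delta d n) (smul (?s i) (kosT d (bas (S - {i})) (bas (m - mx i)))))"
    unfolding lin_hX[OF S1]
    by (intro sum.cong refl) (simp only: o_apply brK_def prod.case fst_conv smul_add eta_tens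
        smul_mult[symmetric] mult.commute mult.left_commute)
  also have "\<dots> = smul (- xR 1) (\<Sum>i\<in>S. smul (?s i) (P i))
      + smul (delta d n) (\<Sum>i\<in>S. smul (- (xR i * sg S i)) (hX d (S - {i}) m))"
    unfolding con sum.distrib smul_sum[symmetric] smul_add van kosT_hX[OF S1] by simp
  also have "smul (- xR 1) (\<Sum>i\<in>S. smul (?s i) (P i)) = smul (xR 1) (\<Sum>i\<in>S. smul (- sg S i) (\<Sum>u\<in>mons d 2 n.
        smul (of_bool (dvdx i m) * cPhi d n (m - mx i) u) (hX d (S - {i}) u)))"
    unfolding smul_sum P_def smul_mult[symmetric]
    by (intro sum.cong refl arg_cong2[where f = smul]) (simp add: ac_simps)
  finally have 1: "lin (fst \<circ> brK d n) (hX d S m) = smul (xR 1) (\<Sum>i\<in>S. smul (- sg S i) (\<Sum>u\<in>mons d 2 n.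
        smul (of_bool (dvdx i m) * cPhi d n (m - mx i) u) (hX d (S - {i}) u)))
      + smul (delta d n) (\<Sum>i\<in>S. smul (- (xR i * sg S i)) (hX d (S - {i}) m))" .
  have 2: "lin (snd \<circ> brK d n) (hX d S m) = smul (xR 1) (\<Sum>i\<in>S. smul (- sg S i) (\<Sum>u\<in>mons d 2 (n - 1).
        smul (of_bool (dvdx i m) * Q d n u (m - mx i)) (hY d (S - {i}) u)))"
    unfolding lin_hX[OF S1] smul_sum
  proof (rule sum.cong[OF refl])
    fix i
    show "smul (?s i) ((snd \<circ> brK d n) (S - {i}, m - mx i)) = (\<Sum>u\<in>mons d 2 (n - 1).
       smul (xR 1) (smul (- sg S i) (smul (of_bool (dvdx i m) * Q d n u (m - mx i)) (hY d (S - {i}) u))))"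
      by (simp add: brK_def kappa_tens proj_q_bas lin_sum_single smul_sum smul_mult[symmetric] ac_simps
          flip: sum_negf)
  qed
  show ?thesis unfolding linB_eq 1 2 ..
qed

text \<open>The terms divisible by \<open>x\<^sub>1\<^sup>2\<close> in the differential of \<open>\<kappa>(e\<^sub>S \<otimes> m)\<close> cancel: contracting twice,
  the coefficient of \<open>e\<^bsub>S - i - j\<^esub> \<otimes> (x\<^sub>1\<^sup>2 v)\<^sup>*\<close> involves \<open>t\<close> at the index \<open>x\<^sub>i x\<^sub>j m v\<close>, which is
  symmetric in \<open>i\<close> and \<open>j\<close>.\<close>

lemma sum_t_hX_cancel:
  assumes S: "S \<subseteq> {2..d}"
  shows "(\<Sum>i\<in>S. smul (sg S i) (\<Sum>v\<in>mons d 1 s. smul (tR (mx i + m + v)) (hX d (S - {i}) (mx 1 + (mx 1 + v))))) = 0"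
proof -
  have fin: "finite S" using S finite_subset by blast
  let ?F = "\<lambda>i j. \<Sum>v\<in>mons d 1 s. smul (of_bool (dvdx j v) * tR (mx i + m + v))
       (bas (S - {i} - {j}, mx 1 + (mx 1 + (v - mx j))))"
  have "(\<Sum>i\<in>S. smul (sg S i) (\<Sum>v\<in>mons d 1 s. smul (tR (mx i + m + v)) (hX d (S - {i}) (mx 1 + (mx 1 + v)))))
    = (\<Sum>i\<in>S. \<Sum>j\<in>S - {i}. smul (sg S i * sg (S - {i}) j) (?F i j))"
  proof (rule sum.cong[OF refl])
    fix i assume "i \<in> S"
    have "S - {i} \<subseteq> {1..d}" using S by auto
    have "hX d (S - {i}) (mx 1 + (mx 1 + v)) = (\<Sum>j\<in>S - {i}. smul (sg (S - {i}) j * of_bool (dvdx j v))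
         (bas (S - {i} - {j}, mx 1 + (mx 1 + (v - mx j))) :: _ \<Rightarrow>\<^sub>0 R))" for v
      unfolding hX_def eta_bas[OF \<open>S - {i} \<subseteq> {1..d}\<close>]
    proof (rule sum.cong[OF refl])
      fix j assume "j \<in> S - {i}"
      then have "j \<noteq> 1" using S by auto
      then show "smul (sg (S - {i}) j * of_bool (dvdx j (mx 1 + (mx 1 + v))))
          (bas (S - {i} - {j}, mx 1 + (mx 1 + v) - mx j) :: _ \<Rightarrow>\<^sub>0 R)
        = smul (sg (S - {i}) j * of_bool (dvdx j v)) (bas (S - {i} - {j}, mx 1 + (mx 1 + (v - mx j))))"
        by (cases "dvdx j v") (simp_all add: mx_add_minus_other)
    qed
    then have "smul (sg S i) (\<Sum>v\<in>mons d 1 s. smul (tR (mx i + m + v)) (hX d (S - {i}) (mx 1 + (mx 1 + v))))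
       = (\<Sum>v\<in>mons d 1 s. \<Sum>j\<in>S - {i}. smul (sg S i * sg (S - {i}) j) (smul (of_bool (dvdx j v) * tR (mx i + m + v))
       (bas (S - {i} - {j}, mx 1 + (mx 1 + (v - mx j))))))"
      by (simp only: smul_sum smul_mult[symmetric] ac_simps)
    also have "\<dots> = (\<Sum>j\<in>S - {i}. smul (sg S i * sg (S - {i}) j) (?F i j))"
      unfolding smul_sum by (rule sum.swap)
    finally show "smul (sg S i) (\<Sum>v\<in>mons d 1 s. smul (tR (mx i + m + v)) (hX d (S - {i}) (mx 1 + (mx 1 + v))))
      = (\<Sum>j\<in>S - {i}. smul (sg S i * sg (S - {i}) j) (?F i j))" .
  qed
  also have "\<dots> = 0"
  proof (rule sum_sg_symmetric_eq_0[OF fin])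
    fix i j assume ij: "i \<in> S" "j \<in> S"
    show "?F i j = ?F j i"
    proof (cases "s = 0")
      case True
      have nd: "\<not> dvdx k v" if "v \<in> mons d 1 0" for v k
        using that by (auto simp: mons_def mdeg_def dvdx_def in_keys_iff)
      show ?thesis unfolding True by (simp add: nd)
    next
      case False
      then have s: "1 \<le> s" by simp
      have ij': "1 \<le> i" "i \<le> d" "1 \<le> j" "j \<le> d" using ij S by auto
      have "S - {i} - {j} = S - {j} - {i}" by blast
      moreover have "mx i + m + (mx j + v) = mx j + m + (mx i + v)" for v by (simp add: ac_simps)
      ultimately show ?thesis
        by (simp only: sum_mons_dvdx[OF s ij'(1,2)] sum_mons_dvdx[OF s ij'(3,4)] add_diff_cancel_left')
    qed
  qed
  finally show ?thesis .
qed

text \<open>The differential of \<open>\<kappa>(e\<^sub>S \<otimes> m)\<close> in terms of generators, before straightening.\<close>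

lemma linB_brL_hY:
  assumes n: "2 \<le> n" and d: "1 \<le> d" and S: "S \<subseteq> {2..d}" and m: "m \<in> mons d 2 (n - 1)"
  shows "linB (brL d n) (hY d S m) =
    (smul (xR 1) (\<Sum>i\<in>S. smul (sg S i) (\<Sum>u\<in>mons d 2 n.
        smul (\<Sum>v\<in>mons d 1 (n - 2). tR (mx i + m + v) * cPhi d n (mx 1 + v) u) (hX d (S - {i}) u))),
     smul (xR 1) (\<Sum>i\<in>S. smul (sg S i) (\<Sum>u\<in>mons d 2 (n - 1).
        smul (\<Sum>v\<in>mons d 1 (n - 2). tR (mx i + m + v) * Q d n u (mx 1 + v)) (hY d (S - {i}) u)))
      + smul (delta d n) (\<Sum>i\<in>S. smul (- (xR i * sg S i)) (hY d (S - {i}) m)))"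
proof -
  have S1: "S \<subseteq> {1..d}" using S by auto
  have mi: "mx i + m \<in> mons d 2 n" if "i \<in> S" for i
    using that S m n by (subst mx_add_mons) auto
  have mv: "mx 1 + v \<in> mons d 1 (n - 1)" if "v \<in> mons d 1 (n - 2)" for v
    using that n d by (subst mx_add_mons) (auto simp: numeral_2_eq_2 One_nat_def)
  have con: "lin (hX d (S - {i})) (contract (q d n (contract (bas (mx i + m)) (Phit d n))) (Phit d n))
      = (\<Sum>u\<in>mons d 2 n. smul (\<Sum>v\<in>mons d 1 (n - 2). tR (mx i + m + v) * cPhi d n (mx 1 + v) u) (hX d (S - {i}) u))
       + smul (delta d n) (\<Sum>v\<in>mons d 1 (n - 2). smul (tR (mx i + m + v)) (hX d (S - {i}) (mx 1 + (mx 1 + v))))"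
    if i: "i \<in> S" for i
  proof -
    have "lin (hX d (S - {i})) (contract (q d n (contract (bas (mx i + m)) (Phit d n))) (Phit d n))
      = (\<Sum>v\<in>mons d 1 (n - 2). smul (tR (mx i + m + v)) (lin (hX d (S - {i})) (contract (q d n (bas (mx 1 + v))) (Phit d n))))"
      unfolding q_contract_Phit[OF n d mi[OF i]] contract_linear lin_sum lin_smul ..
    also have "\<dots> = (\<Sum>v\<in>mons d 1 (n - 2). (\<Sum>u\<in>mons d 2 n. smul (tR (mx i + m + v) * cPhi d n (mx 1 + v) u) (hX d (S - {i}) u))
        + smul (delta d n) (smul (tR (mx i + m + v)) (hX d (S - {i}) (mx 1 + (mx 1 + v)))))"
    proof (rule sum.cong[OF refl])
      fix v assume v: "v \<in> mons d 1 (n - 2)"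
      show "smul (tR (mx i + m + v)) (lin (hX d (S - {i})) (contract (q d n (bas (mx 1 + v))) (Phit d n)))
        = (\<Sum>u\<in>mons d 2 n. smul (tR (mx i + m + v) * cPhi d n (mx 1 + v) u) (hX d (S - {i}) u))
        + smul (delta d n) (smul (tR (mx i + m + v)) (hX d (S - {i}) (mx 1 + (mx 1 + v))))"
        unfolding contract_q_Phit[OF n d mv[OF v]] lin_add lin_sum_single lin_single smul_add smul_sum smul_mult[symmetric]
        by (simp only: mult.commute)
    qed
    also have "\<dots> = (\<Sum>u\<in>mons d 2 n. \<Sum>v\<in>mons d 1 (n - 2). smul (tR (mx i + m + v) * cPhi d n (mx 1 + v) u) (hX d (S - {i}) u))
       + smul (delta d n) (\<Sum>v\<in>mons d 1 (n - 2). smul (tR (mx i + m + v)) (hX d (S - {i}) (mx 1 + (mx 1 + v))))"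
      unfolding sum.distrib smul_sum by (subst sum.swap) (rule refl)
    finally show ?thesis unfolding sum_smul_left .
  qed
  have "lin (fst \<circ> brL d n) (hY d S m) = smul (xR 1) (\<Sum>i\<in>S. smul (sg S i)
      (lin (hX d (S - {i})) (contract (q d n (contract (bas (mx i + m)) (Phit d n))) (Phit d n))))"
    unfolding lin_hY[OF S1] smul_sum
    by (intro sum.cong refl) (simp add: brL_def eta_tens smul_mult[symmetric] mult.commute)
  also have "\<dots> = smul (xR 1) ((\<Sum>i\<in>S. smul (sg S i) (\<Sum>u\<in>mons d 2 n.
        smul (\<Sum>v\<in>mons d 1 (n - 2). tR (mx i + m + v) * cPhi d n (mx 1 + v) u) (hX d (S - {i}) u)))
      + smul (delta d n) (\<Sum>i\<in>S. smul (sg S i) (\<Sum>v\<in>mons d 1 (n - 2). smul (tR (mx i + m + v)) (hX d (S - {i}) (mx 1 + (mx 1 + v))))))"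
    unfolding smul_sum[of "delta d n"] sum.distrib[symmetric]
    by (intro arg_cong2[where f = smul] sum.cong refl)
       (simp only: con smul_add smul_mult[symmetric] mult.commute)
  finally have 1: "lin (fst \<circ> brL d n) (hY d S m) = smul (xR 1) (\<Sum>i\<in>S. smul (sg S i) (\<Sum>u\<in>mons d 2 n.
        smul (\<Sum>v\<in>mons d 1 (n - 2). tR (mx i + m + v) * cPhi d n (mx 1 + v) u) (hX d (S - {i}) u)))"
    unfolding sum_t_hX_cancel[OF S] by simp
  have pr: "lin (hY d (S - {i})) (proj (q d n (contract (bas (mx i + m)) (Phit d n))))
      = (\<Sum>u\<in>mons d 2 (n - 1). smul (\<Sum>v\<in>mons d 1 (n - 2). tR (mx i + m + v) * Q d n u (mx 1 + v)) (hY d (S - {i}) u))"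
    if i: "i \<in> S" for i
  proof -
    have "lin (hY d (S - {i})) (proj (q d n (contract (bas (mx i + m)) (Phit d n))))
      = (\<Sum>v\<in>mons d 1 (n - 2). \<Sum>u\<in>mons d 2 (n - 1). smul (tR (mx i + m + v) * Q d n u (mx 1 + v)) (hY d (S - {i}) u))"
      unfolding q_contract_Phit[OF n d mi[OF i]] proj_linear lin_sum lin_smul proj_q_bas lin_single smul_sum smul_mult[symmetric] ..
    also have "\<dots> = (\<Sum>u\<in>mons d 2 (n - 1). \<Sum>v\<in>mons d 1 (n - 2). smul (tR (mx i + m + v) * Q d n u (mx 1 + v)) (hY d (S - {i}) u))"
      by (rule sum.swap)
    finally show ?thesis unfolding sum_smul_left .
  qed
  have "lin (snd \<circ> brL d n) (hY d S m) = (\<Sum>i\<in>S.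
      smul (xR 1) (smul (sg S i) (lin (hY d (S - {i})) (proj (q d n (contract (bas (mx i + m)) (Phit d n))))))
     + smul (delta d n) (smul (sg S i) (kosT d (bas (S - {i})) (bas (mx i + m)))))"
    unfolding lin_hY[OF S1]
    by (intro sum.cong refl) (simp add: brL_def kappa_tens smul_add smul_mult[symmetric] mult.commute)
  also have "\<dots> = smul (xR 1) (\<Sum>i\<in>S. smul (sg S i) (\<Sum>u\<in>mons d 2 (n - 1).
        smul (\<Sum>v\<in>mons d 1 (n - 2). tR (mx i + m + v) * Q d n u (mx 1 + v)) (hY d (S - {i}) u)))
      + smul (delta d n) (\<Sum>i\<in>S. smul (- (xR i * sg S i)) (hY d (S - {i}) m))"
    unfolding sum.distrib smul_sum[symmetric] kosT_hY[OF S1] by (simp add: pr)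
  finally show ?thesis unfolding linB_eq 1 by simp
qed

section \<open>Membership in the modules of the complex\<close>

lemma lookup_map_of_int:
  "Poly_Mapping.lookup (Poly_Mapping.map of_int p :: _ \<Rightarrow>\<^sub>0 R) k = of_int (Poly_Mapping.lookup p k)"
  by (simp add: map.rep_eq when_def)

lemma of_int_sg: "of_int (sg S i) = (sg S i :: R)"
  by (simp add: sg_def)

lemma map_of_int_hX: "S \<subseteq> {1..d} \<Longrightarrow> Poly_Mapping.map of_int (hX d S m) = (hX d S m :: _ \<Rightarrow>\<^sub>0 R)"
  by (rule poly_mapping_eqI)
     (auto simp: lookup_map_of_int hX_def eta_bas lookup_sum lookup_single when_def of_int_sg intro!: sum.cong)

lemma map_of_int_hY: "S \<subseteq> {1..d} \<Longrightarrow> Poly_Mapping.map of_int (hY d S m) = (hY d S m :: _ \<Rightarrow>\<^sub>0 R)"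
  by (rule poly_mapping_eqI)
     (auto simp: lookup_map_of_int hY_def kappa_bas lookup_sum lookup_single when_def of_int_sg intro!: sum.cong)

lemma one_in_RR: "1 \<in> RR d n"
  by (simp add: RR_def flip: single_one)

lemma spanR_base:
  assumes "z \<in> Z"
  shows "Poly_Mapping.map of_int z \<in> spanR d n Z"
  unfolding spanR_def using assms one_in_RR
  by (intro CollectI exI[of _ "{z}"] exI[of _ "\<lambda>_. 1"]) auto

lemma zero_in_spanR: "0 \<in> spanR d n Z"
  unfolding spanR_def by (intro CollectI exI[of _ "{}"] exI[of _ "\<lambda>_. 1"]) auto

lemma hX_in_Kmod:
  assumes S: "S \<subseteq> {2..d}" "card S = Suc k" and m: "m \<in> mons d 2 s"
  shows "hX d S m \<in> Kmod d k (s - 1)"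
proof -
  have S1: "S \<subseteq> {1..d}" "finite S" using S(1) finite_subset by auto
  have "Poly_Mapping.keys (hX d S m :: _ \<Rightarrow>\<^sub>0 int) \<subseteq> ext0 d k \<times> mons d 2 (s - 1)"
  proof
    fix x assume "x \<in> Poly_Mapping.keys (hX d S m :: _ \<Rightarrow>\<^sub>0 int)"
    then obtain i where i: "i \<in> S" "x \<in> Poly_Mapping.keys (smul (sg S i * of_bool (dvdx i m)) (bas (S - {i}, m - mx i)) :: _ \<Rightarrow>\<^sub>0 int)"
      unfolding hX_def eta_bas[OF S1(1)] using subsetD[OF keys_sum] by (metis (no_types, lifting) UN_E)
    then have "dvdx i m" "x = (S - {i}, m - mx i)" by (auto split: if_splits)
    then show "x \<in> ext0 d k \<times> mons d 2 (s - 1)"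
      using i(1) S S1 m by (auto simp: ext0_def minus_mx_mons)
  qed
  then show ?thesis by (simp add: Kmod_def eta_hX[OF S1(1)])
qed

lemma hY_in_Lmod:
  assumes S: "S \<subseteq> {2..d}" "card S = Suc k" and m: "m \<in> mons d 2 (s - 1)" and s: "1 \<le> s"
  shows "hY d S m \<in> Lmod d k s"
proof -
  have S1: "S \<subseteq> {1..d}" "finite S" using S(1) finite_subset by auto
  have "Poly_Mapping.keys (hY d S m :: _ \<Rightarrow>\<^sub>0 int) \<subseteq> ext0 d k \<times> mons d 2 s"
  proof
    fix x assume "x \<in> Poly_Mapping.keys (hY d S m :: _ \<Rightarrow>\<^sub>0 int)"
    then obtain i where i: "i \<in> S" "x \<in> Poly_Mapping.keys (smul (sg S i) (bas (S - {i}, mx i + m)) :: _ \<Rightarrow>\<^sub>0 int)"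
      unfolding hY_def kappa_bas[OF S1(1)] using subsetD[OF keys_sum] by (metis (no_types, lifting) UN_E)
    then have "x = (S - {i}, mx i + m)" by (auto split: if_splits)
    moreover have "i \<in> {2..d}" using i S by auto
    ultimately show "x \<in> ext0 d k \<times> mons d 2 s"
      using i(1) S S1 m s by (auto simp: ext0_def mx_add_mons)
  qed
  then show ?thesis by (simp add: Lmod_def kappa_hY[OF S1(1)])
qed

lemma hX_in_Bmod:
  assumes "S \<subseteq> {2..d}" "card S = r" "1 \<le> r" "m \<in> mons d 2 n"
  shows "(hX d S m, 0) \<in> Bmod d n r"
proof -
  have "hX d S m \<in> Kmod d (r - 1) (n - 1)" using assms by (intro hX_in_Kmod) auto
  then have "Poly_Mapping.map of_int (hX d S m) \<in> spanR d n (Kmod d (r - 1) (n - 1))" by (rule spanR_base)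
  moreover have "S \<subseteq> {1..d}" using assms(1) by auto
  ultimately show ?thesis by (simp add: Bmod_def map_of_int_hX zero_in_spanR)
qed

lemma hY_in_Bmod:
  assumes "S \<subseteq> {2..d}" "card S = r" "1 \<le> r" "m \<in> mons d 2 (n - 1)" "1 \<le> n"
  shows "(0, hY d S m) \<in> Bmod d n r"
proof -
  have "hY d S m \<in> Lmod d (r - 1) n" using assms by (intro hY_in_Lmod) auto
  then have "Poly_Mapping.map of_int (hY d S m) \<in> spanR d n (Lmod d (r - 1) n)" by (rule spanR_base)
  moreover have "S \<subseteq> {1..d}" using assms(1) by auto
  ultimately show ?thesis by (simp add: Bmod_def map_of_int_hY zero_in_spanR)
qed

section \<open>Basis elements\<close>

text \<open>The index sequences occurring in the expansions are indices of basis elements. Hence the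
  corresponding \<open>X\<close> and \<open>Y\<close> are the generators that the straightening produces.\<close>

lemma X_eq_hX:
  assumes "sorted_wrt (<) as" "set as = W" "W \<subseteq> {2..d}" "card W = r" "1 \<le> r" "r \<le> d - 1"
    and "m \<in> mons d 2 n" "{2..least m} \<subseteq> W"
  shows "X d n r as m = (hX d W m, 0)"
proof -
  have "length as = r"
    using assms distinct_card[of as] strict_sorted_iff[of as] by simp
  then have "inX d n r as m" using assms by (simp add: inX_def)
  then show ?thesis
    using wedge_sorted[OF assms(1), where 'c = R] assms(2) by (simp add: X_def hX_def)
qed

lemma Y_eq_hY:
  assumes "sorted_wrt (<) as" "set as = W" "W \<subseteq> {2..d}" "card W = r" "1 \<le> r" "r \<le> d - 1"
    and l: "l \<in> W" "\<And>i. i \<in> W \<Longrightarrow> l \<le> i" and m: "m \<in> mons d l (n - 1)"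
  shows "Y d n r as m = (0, hY d W m)"
proof -
  have len: "length as = r"
    using assms distinct_card[of as] strict_sorted_iff[of as] by simp
  have "hd as = l"
  proof (cases as)
    case (Cons b bs)
    then have "b \<le> l" using assms(1) l(1) assms(2) by (auto simp: less_imp_le)
    moreover have "l \<le> b" using l(2) assms(2) Cons by auto
    ultimately show ?thesis using Cons by simp
  qed (use l(1) assms(2) in simp)
  then have "inY d n r as m" using assms len by (simp add: inY_def)
  then show ?thesis
    using wedge_sorted[OF assms(1), where 'c = R] assms(2) by (simp add: Y_def hY_def)
qed

lemma set_hat: "set (hat a i j H) = a ` ({i..j} - H)"
  by (auto simp: hat_def less_Suc_eq_le)

lemma index_seqI:
  assumes "sorted_wrt (<) (hat a 1 r {})" "set (hat a 1 r {}) \<subseteq> {2..d}"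
  shows "index_seq a r d"
proof
  have *: "hat a 1 r {} = map a [1..<Suc r]" by (simp add: hat_def)
  show "a i < a j" if "i \<in> {1..r}" "j \<in> {1..r}" "i < j" for i j
    using sorted_wrt_nth_less[OF assms(1), of "i - 1" "j - 1"] that unfolding *
    by (auto simp del: upt_Suc)
  show "a i \<in> {2..d}" if "i \<in> {1..r}" for i
    using assms(2) that unfolding set_hat by (simp add: image_subset_iff)
qed

context index_seq
begin

lemma le_iff: "i \<in> {1..r} \<Longrightarrow> j \<in> {1..r} \<Longrightarrow> a i \<le> a j \<longleftrightarrow> i \<le> j"
  using less_iff[of j i] by (metis not_less)

lemma sorted_hat: "1 \<le> i \<Longrightarrow> j \<le> r \<Longrightarrow> sorted_wrt (<) (hat a i j H)"
  unfolding hat_def sorted_wrt_map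
  by (rule sorted_wrt_mono_rel[of _ "(<)"]) (auto intro!: mono sorted_wrt_filter sorted_wrt_upt simp del: upt_Suc)

lemma card_S_remove: "k \<in> {1..r} \<Longrightarrow> card (S - {a k}) = r - 1"
  by (simp add: card_S mem_S)

lemma card_S_remove2:
  assumes "j \<in> {1..r}" "k \<in> {1..r}" "j \<noteq> k" "l \<notin> S - {a j, a k}"
  shows "card (insert l (S - {a j, a k})) = r - 1"
proof -
  have "{a j, a k} \<subseteq> S" "card {a j, a k} = 2" using assms mem_S eq_iff by auto
  then have "card (S - {a j, a k}) = r - 2" by (simp add: card_Diff_subset card_S)
  moreover have "2 \<le> r" using assms by auto
  ultimately show ?thesis using assms(4) by simp
qed

lemma set_hat_S: "set (hat a 1 r H) = S - a ` (H \<inter> {1..r})"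
proof -
  have "{1..r} - H = {1..r} - (H \<inter> {1..r})" by blast
  then show ?thesis
    unfolding set_hat S_def using inj_on_image_set_diff[OF inj, of "{1..r}" "H \<inter> {1..r}"] by auto
qed

lemma Y_remove:
  assumes "r \<le> d - 1" "k \<in> {2..r}" "m \<in> mons d (a 1) (n - 1)"
  shows "Y d n (r - 1) (hat a 1 r {k}) m = (0, hY d (S - {a k}) m)"
proof (rule Y_eq_hY)
  show "set (hat a 1 r {k}) = S - {a k}" using assms by (auto simp: set_hat_S)
  show "a 1 \<in> S - {a k}" using assms mem_S[of 1] eq_iff[of 1 k] by auto
  show "a 1 \<le> i" if "i \<in> S - {a k}" for i
    using that le_iff[of 1] assms(2) by (auto simp: S_def)
qed (use assms S_subset card_S_remove[of k] in \<open>auto intro: sorted_hat\<close>)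

lemma set_hat_2:
  assumes "2 \<le> r" "k \<in> {1..r}"
  shows "set (hat a 2 r {k}) = S - {a 1, a k}"
proof -
  have "{2..r} - {k} = {1..r} - {1, k}" by auto
  moreover have "a ` ({1..r} - {1, k}) = a ` {1..r} - a ` {1, k}"
    using assms by (intro inj_on_image_set_diff[OF inj]) auto
  ultimately show ?thesis unfolding set_hat S_def by simp
qed

lemma Y_remove_first:
  assumes "2 \<le> r" "r \<le> d - 1" "m \<in> mons d (a 2) (n - 1)"
  shows "Y d n (r - 1) (hat a 2 r {}) m = (0, hY d (S - {a 1}) m)"
proof (rule Y_eq_hY)
  have "hat a 2 r {} = hat a 2 r {1}" by (auto simp: hat_def intro!: map_cong filter_cong)
  then show "set (hat a 2 r {}) = S - {a 1}" using set_hat_2[of 1] assms by simp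
  show "a 2 \<in> S - {a 1}" using assms mem_S[of 2] eq_iff[of 1 2] by auto
  show "a 2 \<le> i" if "i \<in> S - {a 1}" for i
  proof -
    from that obtain j where j: "j \<in> {1..r}" "i = a j" by (auto simp: S_def)
    moreover have "j \<noteq> 1" using that j by auto
    ultimately show ?thesis using le_iff[of 2 j] by auto
  qed
qed (use assms S_subset card_S_remove[of 1] in \<open>auto intro: sorted_hat\<close>)

lemma Y_replace_first:
  assumes r: "2 \<le> r" "r \<le> d - 1" and l: "a 1 \<le> l" "l < a 2" and k: "k \<in> {2..r}"
    and m: "m \<in> mons d l (n - 1)"
  shows "Y d n (r - 1) (l # hat a 2 r {k}) m = (0, hY d (insert l (S - {a 1, a k})) m)"
proof (rule Y_eq_hY)
  have k': "k \<in> {1..r}" using k by auto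
  have below: "l < i" if "i \<in> S - {a 1, a k}" for i
  proof -
    from that obtain j where j0: "j \<in> {1..r}" "i = a j" by (auto simp: S_def)
    moreover have "j \<noteq> 1" using that j0 by auto
    ultimately have j: "j \<in> {2..r}" "i = a j" by auto
    then have "a 2 \<le> i" using le_iff[of 2 j] r by auto
    then show ?thesis using l by simp
  qed
  show st: "set (l # hat a 2 r {k}) = insert l (S - {a 1, a k})" using set_hat_2[OF r(1) k'] by simp
  show "sorted_wrt (<) (l # hat a 2 r {k})" using below sorted_hat[of 2 r "{k}"] set_hat_2[OF r(1) k'] by auto
  show "l \<le> i" if "i \<in> insert l (S - {a 1, a k})" for i using that below by (auto intro: less_imp_le)
  show "card (insert l (S - {a 1, a k})) = r - 1"
    using k r below by (intro card_S_remove2) auto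
  show "insert l (S - {a 1, a k}) \<subseteq> {2..d}"
    using l S_subset range[of 1] range[of 2] r by auto
qed (use r m in auto)

lemma Y_prepend:
  assumes r: "2 \<le> r" "r \<le> d - 1" and l: "2 \<le> l" "l < a 1" and jk: "j \<in> {1..r}" "k \<in> {1..r}" "j \<noteq> k"
    and m: "m \<in> mons d l (n - 1)"
  shows "Y d n (r - 1) (l # hat a 1 r {j, k}) m = (0, hY d (insert l (S - {a j, a k})) m)"
proof (rule Y_eq_hY)
  have below: "l < i" if "i \<in> S" for i
  proof -
    from that obtain j where j: "j \<in> {1..r}" "i = a j" by (auto simp: S_def)
    then have "a 1 \<le> i" using le_iff[of 1 j] r by auto
    then show ?thesis using l by simp
  qed
  show st: "set (l # hat a 1 r {j, k}) = insert l (S - {a j, a k})" using jk by (auto simp: set_hat_S)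
  show "sorted_wrt (<) (l # hat a 1 r {j, k})"
    using below sorted_hat[of 1 r "{j, k}"] by (auto simp: set_hat_S)
  show "l \<le> i" if "i \<in> insert l (S - {a j, a k})" for i using that below by (auto intro: less_imp_le)
  show "card (insert l (S - {a j, a k})) = r - 1"
    using jk below by (intro card_S_remove2) auto
  show "insert l (S - {a j, a k}) \<subseteq> {2..d}"
    using l S_subset range[of 1] r by auto
qed (use r m in auto)

end

context index_seq_gap
begin

text \<open>Removal of an entry above the least variable \<open>x\<^sub>l\<close> of the monomial, \<open>l \<le> \<gamma>\<close>, leaves the
  initial segment \<open>[2, l]\<close> intact, because \<open>k < a\<^sub>k\<close>.\<close>

lemma X_remove:
  assumes "2 \<le> r" "r \<le> d - 1" "1 \<le> n" "l \<in> {2..\<gamma>}" "k \<in> {l..r}" "v \<in> mons d l (n - 1)"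
  shows "X d n (r - 1) (hat a 1 r {k}) (mx l + v) = (hX d (S - {a k}) (mx l + v), 0)"
proof (rule X_eq_hX)
  have k: "k \<in> {1..r}" using assms by auto
  show "set (hat a 1 r {k}) = S - {a k}" using k by (auto simp: set_hat_S)
  show "card (S - {a k}) = r - 1" using card_S_remove[OF k] .
  have "l \<in> S" using assms(4) initial by (auto simp: S_def)
  then have "l \<in> {2..d}" using S_subset by auto
  then show "mx l + v \<in> mons d 2 n" using assms by (intro mx_add_mons_I) auto
  have "l < a k" using Suc_le_a[OF k] assms by auto
  then show "{2..least (mx l + v)} \<subseteq> S - {a k}"
    using assms initial by (auto simp: least_mx_add S_def)
qed (use assms S_subset in \<open>auto intro: sorted_hat\<close>)

lemma X_fill_gap:
  assumes "2 \<le> r" "r \<le> d - 1" "1 \<le> n" "\<gamma> \<le> j" "j < k" "k \<le> r" "v \<in> mons d (\<gamma> + 1) (n - 1)"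
  shows "X d n (r - 1) (hat a 1 (\<gamma> - 1) {} @ [\<gamma> + 1] @ hat a \<gamma> r {j, k}) (mx (\<gamma> + 1) + v)
    = (hX d (insert (\<gamma> + 1) S - {a j, a k}) (mx (\<gamma> + 1) + v), 0)"
proof (rule X_eq_hX)
  let ?as = "hat a 1 (\<gamma> - 1) {} @ [\<gamma> + 1] @ hat a \<gamma> r {j, k}"
  have jk: "j \<in> {1..r}" "k \<in> {1..r}" "j \<noteq> k" using assms gap_ge_1 by auto
  have big: "\<gamma> + 1 < a i" if "i \<in> {\<gamma>..r}" for i using gap_less[OF that] by simp
  have ajk: "\<gamma> + 1 < a j" "\<gamma> + 1 < a k" using big[of j] big[of k] assms by auto
  have small: "a i < \<gamma> + 1" if "i \<in> {1..\<gamma> - 1}" for i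
    using that a_initial[of i] by auto
  have "{1..r} = {1..\<gamma> - 1} \<union> {\<gamma>..r}" using assms gap_ge_1 by auto
  then have S': "S = a ` {1..\<gamma> - 1} \<union> a ` {\<gamma>..r}" unfolding S_def by blast
  have gen: "insert g (P \<union> (N - D)) = insert g (P \<union> N) - D" if "P \<inter> D = {}" "g \<notin> D"
    for g :: nat and P N D using that by blast
  have "x \<notin> {a j, a k}" if "x \<in> a ` {1..\<gamma> - 1}" for x
  proof -
    from that obtain i where "i \<in> {1..\<gamma> - 1}" "x = a i" by auto
    then show ?thesis using small[of i] ajk by auto
  qed
  then have "a ` {1..\<gamma> - 1} \<inter> {a j, a k} = {}" by auto
  moreover have "\<gamma> + 1 \<notin> {a j, a k}" using ajk by auto
  ultimately have "insert (\<gamma> + 1) (a ` {1..\<gamma> - 1} \<union> (a ` {\<gamma>..r} - {a j, a k})) = insert (\<gamma> + 1) S - {a j, a k}"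
    unfolding S' by (rule gen)
  moreover have "a ` ({\<gamma>..r} - {j, k}) = a ` {\<gamma>..r} - a ` {j, k}"
    using gap_ge_1 jk by (intro inj_on_image_set_diff[OF inj]) auto
  moreover have "set ?as = insert (\<gamma> + 1) (a ` {1..\<gamma> - 1} \<union> a ` ({\<gamma>..r} - {j, k}))"
    unfolding set_append set_hat by simp
  ultimately show "set ?as = insert (\<gamma> + 1) S - {a j, a k}"
    by simp
  show "sorted_wrt (<) ?as"
    unfolding sorted_wrt_append set_hat
  proof (intro conjI ballI)
    show "sorted_wrt (<) (hat a 1 (\<gamma> - 1) {})" using assms by (intro sorted_hat) auto
    show "sorted_wrt (<) (hat a \<gamma> r {j, k})" using gap_ge_1 by (intro sorted_hat) auto
    show "x < y" if "x \<in> set [\<gamma> + 1]" "y \<in> a ` ({\<gamma>..r} - {j, k})" for x y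
      using that big by auto
    show "x < y" if "x \<in> a ` ({1..\<gamma> - 1} - {})" "y \<in> set ([\<gamma> + 1] @ hat a \<gamma> r {j, k})" for x y
    proof -
      from that(1) obtain i where "i \<in> {1..\<gamma> - 1}" "x = a i" by auto
      then have "x < \<gamma> + 1" using small by auto
      moreover have "\<gamma> + 1 \<le> y" using that(2) big unfolding set_append set_hat by (auto intro: less_imp_le)
      ultimately show ?thesis by simp
    qed
  qed simp
  have ins: "insert (\<gamma> + 1) S - {a j, a k} = insert (\<gamma> + 1) (S - {a j, a k})"
    using ajk by auto
  have "\<gamma> + 1 \<notin> S" using gap_not_mem unfolding Suc_eq_plus1 .
  then show "card (insert (\<gamma> + 1) S - {a j, a k}) = r - 1"
    unfolding ins using jk by (intro card_S_remove2) auto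
  have g: "\<gamma> + 1 \<in> {2..d}" using assms gap_ge_1 by auto
  then show "insert (\<gamma> + 1) S - {a j, a k} \<subseteq> {2..d}" using S_subset by auto
  show "mx (\<gamma> + 1) + v \<in> mons d 2 n" using assms g by (intro mx_add_mons_I) auto
  have "{2..\<gamma> + 1} \<subseteq> insert (\<gamma> + 1) {2..\<gamma>}" by auto
  then show "{2..least (mx (\<gamma> + 1) + v)} \<subseteq> insert (\<gamma> + 1) S - {a j, a k}"
    using assms(7) initial ajk by (auto simp: least_mx_add S_def)
qed (use assms in auto)

end

section \<open>The first and the last differential\<close>

lemma symR_superset:
  assumes "finite A" "Poly_Mapping.keys s \<subseteq> A"
  shows "symR s = (\<Sum>m\<in>A. Poly_Mapping.lookup s m * monR m)"
  unfolding symR_def using assms by (intro sum.mono_neutral_left) (auto simp: in_keys_iff)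

lemma symR_q_bas: "symR (q d n (bas \<nu>)) = (\<Sum>m\<in>mons d 1 (n - 1). monR m * Q d n m \<nu>)"
  by (subst symR_superset[OF finite_mons[of d 1 "n - 1"]])
     (auto simp: q_bas lookup_sum_single keys_sum_single mult.commute intro!: sum.cong)

lemma symR_q_contract:
  assumes "2 \<le> n" "1 \<le> d" "\<mu> \<in> mons d 2 n"
  shows "symR (q d n (contract (bas \<mu>) (Phit d n)))
    = (\<Sum>v\<in>mons d 1 (n - 2). \<Sum>m\<in>mons d 1 (n - 1). monR m * Q d n m (mx 1 + v) * tR (\<mu> + v))"
proof -
  have lk: "Poly_Mapping.lookup (q d n (contract (bas \<mu>) (Phit d n))) m
      = (if m \<in> mons d 1 (n - 1) then \<Sum>v\<in>mons d 1 (n - 2). tR (\<mu> + v) * Q d n m (mx 1 + v) else 0)" for m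
    by (simp add: q_contract_Phit[OF assms] q_bas lookup_sum lookup_single when_def)
  then have "Poly_Mapping.keys (q d n (contract (bas \<mu>) (Phit d n))) \<subseteq> mons d 1 (n - 1)"
    by (auto simp: in_keys_iff split: if_splits)
  then have "symR (q d n (contract (bas \<mu>) (Phit d n)))
    = (\<Sum>m\<in>mons d 1 (n - 1). \<Sum>v\<in>mons d 1 (n - 2). monR m * Q d n m (mx 1 + v) * tR (\<mu> + v))"
    by (simp add: symR_superset[OF finite_mons] lk sum_distrib_left mult.commute mult.left_commute)
  then show ?thesis by (simp only: sum.swap[of _ "mons d 1 (n - 1)"])
qed

lemma monR_mx_add: "monR (mx i + m) = xR i * monR m"
proof -
  have sup: "monR p = (\<Prod>j\<in>A. xR j ^ Poly_Mapping.lookup p j)" if "finite A" "Poly_Mapping.keys p \<subseteq> A" for p A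
    unfolding monR_def using that by (intro prod.mono_neutral_left) (auto simp: in_keys_iff)
  let ?A = "insert i (Poly_Mapping.keys m)"
  have "monR (mx i + m) = (\<Prod>j\<in>?A. xR j ^ Poly_Mapping.lookup (mx i) j) * (\<Prod>j\<in>?A. xR j ^ Poly_Mapping.lookup m j)"
    by (subst sup[of ?A]) (auto simp: keys_add_mon lookup_add power_add prod.distrib)
  also have "(\<Prod>j\<in>?A. xR j ^ Poly_Mapping.lookup (mx i) j) = monR (mx i)" by (rule sup[symmetric]) auto
  also have "(\<Prod>j\<in>?A. xR j ^ Poly_Mapping.lookup m j) = monR m" by (rule sup[symmetric]) auto
  also have "monR (mx i) = xR i" by (simp add: monR_def mx_nz)
  finally show ?thesis .
qed

lemma hX_singleton: "a \<in> {1..d} \<Longrightarrow> dvdx a m \<Longrightarrow> hX d {a} m = (bas ({}, m - mx a) :: _ \<Rightarrow>\<^sub>0 'c::comm_ring_1)"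
  using sg_below[of "{a}" a, where 'a = 'c] by (simp add: hX_def eta_bas)

lemma hY_singleton: "a \<in> {1..d} \<Longrightarrow> hY d {a} m = (bas ({}, mx a + m) :: _ \<Rightarrow>\<^sub>0 'c::comm_ring_1)"
  using sg_below[of "{a}" a, where 'a = 'c] by (simp add: hY_def kappa_bas)

lemma b1_X:
  assumes n: "1 \<le> n" and X: "inX d n 1 [a] m"
  shows "b1 d n (X d n 1 [a] m) = xR 1 * (\<Sum>m1\<in>mons d 1 (n-1). monR m1 * Q d n m1 (m - mx a))"
proof -
  have a: "a \<in> {2..d}" "m \<in> mons d 2 n" "{2..least m} \<subseteq> {a}" "1 \<le> d - 1" using X by (auto simp: inX_def)
  have lm: "2 \<le> least m" "dvdx (least m) m" using least_mem[OF a(2) n] by auto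
  then have "least m \<in> {2..least m}" by simp
  then have "least m = a" using a(3) by blast
  then have dv: "dvdx a m" using lm by simp
  have "X d n 1 [a] m = (hX d {a} m, 0)" using a by (intro X_eq_hX) auto
  moreover have "(hX d {a} m, 0) \<in> Bmod d n 1" using a by (intro hX_in_Bmod) auto
  moreover have "hX d {a} m = (bas ({}, m - mx a) :: _ \<Rightarrow>\<^sub>0 R)" using a dv by (intro hX_singleton) auto
  ultimately show ?thesis by (simp add: b1_def symR_q_bas)
qed

lemma b1_Y:
  assumes n: "2 \<le> n" and Y: "inY d n 1 [a] m"
  shows "b1 d n (Y d n 1 [a] m) = delta d n * xR a * monR m
    - xR 1 * (\<Sum>m1\<in>mons d 1 (n-2). \<Sum>m2\<in>mons d 1 (n-1). monR m2 * Q d n m2 (mx 1 + m1) * tR (mx a + m1 + m))"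
proof -
  have a: "a \<in> {2..d}" "m \<in> mons d a (n - 1)" "1 \<le> d - 1" using Y by (auto simp: inY_def)
  have m2: "m \<in> mons d 2 (n - 1)" using a mons_mono[of 2 a] by auto
  have am: "mx a + m \<in> mons d 2 n" using a m2 n by (subst mx_add_mons) auto
  have "Y d n 1 [a] m = (0, hY d {a} m)" using a by (intro Y_eq_hY[where l = a]) auto
  moreover have "(0, hY d {a} m) \<in> Bmod d n 1" using a m2 n by (intro hY_in_Bmod) auto
  moreover have "hY d {a} m = (bas ({}, mx a + m) :: _ \<Rightarrow>\<^sub>0 R)" using a by (intro hY_singleton) auto
  moreover have "mx a + m + v = mx a + v + m" for v by (simp add: ac_simps)
  moreover have "1 \<le> d" using a by simp
  ultimately show ?thesis
    by (simp add: b1_def monR_mx_add symR_q_contract[OF n _ am] mult.assoc)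
qed

lemma smulB_Pair: "c *\<^sub>B (u, 0) = (smul c u, 0)" "c *\<^sub>B (0, v) = (0, smul c v)"
  by (simp_all add: smulB_def)

lemma smulB_zero [simp]: "0 *\<^sub>B z = 0"
  by (simp add: smulB_def zero_prod_def)

lemma sum_smulB_left: "(\<Sum>i\<in>A. c i *\<^sub>B z) = (\<Sum>i\<in>A. c i) *\<^sub>B z"
  by (induction A rule: infinite_finite_induct)
     (auto simp: smulB_def zero_prod_def smul_add_left)

lemma sum_Pair_fst: "(\<Sum>i\<in>A. (f i, 0)) = (\<Sum>i\<in>A. f i, 0)"
  by (induction A rule: infinite_finite_induct) (auto simp: zero_prod_def)

lemma sum_Pair_snd: "(\<Sum>i\<in>A. (0, f i)) = (0, \<Sum>i\<in>A. f i)"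
  by (induction A rule: infinite_finite_induct) (auto simp: zero_prod_def)

lemma bd_Xtop:
  assumes d: "3 \<le> d" and n: "2 \<le> n"
  shows "bd d n (Xtop d) =
        (\<Sum>m\<in>mons d 2 n.
          (delta d n * monR m
            - (\<Sum>m1\<in>mons d 1 (n-2). \<Sum>m2\<in>mons d 1 (n-1).
                xR 1 * monR m2 * Q d n m2 (mx 1 + m1) * tR (m1 + m)))
          *\<^sub>B X d n (d-1) [2..<Suc d] m)
      - (\<Sum>m\<in>mons d 2 (n-1). \<Sum>m1\<in>mons d 1 (n-1).
          (xR 1 * monR m1 * Q d n m1 m) *\<^sub>B Y d n (d-1) [2..<Suc d] m)"
proof -
  let ?S = "{2..d}"
  have st: "set [2..<Suc d] = ?S" "sorted_wrt (<) [2..<Suc d]"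
    by (auto simp del: upt_Suc)
  have top: "Xtop d = bas ?S" unfolding Xtop_def using wedge_sorted[OF st(2)] st(1) by simp
  have "bas ?S \<in> {z :: nat set \<Rightarrow>\<^sub>0 int. Poly_Mapping.keys z \<subseteq> ext0 d (d - 1)}"
    using d by (auto simp: ext0_def)
  from spanR_base[OF this, of d n] have "Poly_Mapping.map of_int (bas ?S) \<in> Btop d n"
    unfolding Btop_def .
  moreover have "Poly_Mapping.map of_int (bas ?S :: _ \<Rightarrow>\<^sub>0 int) = (bas ?S :: _ \<Rightarrow>\<^sub>0 R)"
    by (rule poly_mapping_eqI) (simp add: lookup_map_of_int lookup_single when_def)
  ultimately have mem: "(bas ?S :: _ \<Rightarrow>\<^sub>0 R) \<in> Btop d n" by simp
  have Xe: "X d n (d - 1) [2..<Suc d] m = (hX d ?S m, 0)" if m: "m \<in> mons d 2 n" for m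
    using st d m least_mem[OF m] n by (intro X_eq_hX) auto
  have Ye: "Y d n (d - 1) [2..<Suc d] m = (0, hY d ?S m)" if m: "m \<in> mons d 2 (n - 1)" for m
    using st d m by (intro Y_eq_hY[where l = 2]) auto
  have c1: "xR 1 * symR (q d n (contract (bas m) (Phit d n)))
      = (\<Sum>m1\<in>mons d 1 (n-2). \<Sum>m2\<in>mons d 1 (n-1). xR 1 * monR m2 * Q d n m2 (mx 1 + m1) * tR (m1 + m))"
    if "m \<in> mons d 2 n" for m
    using that d by (simp add: symR_q_contract[OF n] sum_distrib_left ac_simps)
  have c2: "(\<Sum>m1\<in>mons d 1 (n-1). (xR 1 * monR m1 * Q d n m1 m) *\<^sub>B Y d n (d-1) [2..<Suc d] m)
      = (0, smul (xR 1 * symR (q d n (bas m))) (hY d ?S m))" if "m \<in> mons d 2 (n - 1)" for m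
    unfolding sum_smulB_left unfolding Ye[OF that] smulB_Pair symR_q_bas by (simp add: sum_distrib_left mult.assoc)
  have "bd d n (Xtop d) = (\<Sum>m\<in>mons d 2 n. smul (delta d n * monR m - xR 1 * symR (q d n (contract (bas m) (Phit d n)))) (hX d ?S m),
     - (\<Sum>m\<in>mons d 2 (n - 1). smul (xR 1 * symR (q d n (bas m))) (hY d ?S m)))"
    unfolding top bd_def using mem by (simp add: linB_eq hX_def hY_def)
  also have "\<dots> = (\<Sum>m\<in>mons d 2 n. smul (delta d n * monR m - xR 1 * symR (q d n (contract (bas m) (Phit d n)))) (hX d ?S m), 0)
     - (0, \<Sum>m\<in>mons d 2 (n - 1). smul (xR 1 * symR (q d n (bas m))) (hY d ?S m))"
    by simp
  also have "\<dots> = (\<Sum>m\<in>mons d 2 n. (delta d n * monR m - xR 1 * symR (q d n (contract (bas m) (Phit d n)))) *\<^sub>B X d n (d-1) [2..<Suc d] m)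
     - (\<Sum>m\<in>mons d 2 (n - 1). \<Sum>m1\<in>mons d 1 (n-1). (xR 1 * monR m1 * Q d n m1 m) *\<^sub>B Y d n (d-1) [2..<Suc d] m)"
    unfolding sum_Pair_fst[symmetric] sum_Pair_snd[symmetric]
    by (intro arg_cong2[where f = "(-)"] sum.cong refl) (simp_all only: Xe smulB_Pair c2)
  finally show ?thesis by (simp only: c1 cong: sum.cong)
qed

section \<open>The intermediate differentials\<close>

lemma br_hX:
  assumes "S \<subseteq> {2..d}" "card S = r" "1 \<le> r" "m \<in> mons d 2 n"
  shows "br d n r (hX d S m, 0) = linB (brK d n) (hX d S m)"
  using hX_in_Bmod[OF assms] by (simp add: br_def linB_def)

lemma br_hY:
  assumes "S \<subseteq> {2..d}" "card S = r" "1 \<le> r" "m \<in> mons d 2 (n - 1)" "1 \<le> n"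
  shows "br d n r (0, hY d S m) = linB (brL d n) (hY d S m)"
  using hY_in_Bmod[OF assms] by (simp add: br_def linB_def)

lemma cPhi_combine:
  "(\<Sum>v\<in>mons d 1 (n - 2). f v * cPhi d n (mx 1 + v) u)
   = (\<Sum>m1\<in>mons d 1 (n - 2). \<Sum>v\<in>mons d 1 (n - 2). Q d n (mx 1 + m1) (mx 1 + v) * f v * tR (m1 + u))"
proof -
  have "(\<Sum>v\<in>mons d 1 (n - 2). f v * cPhi d n (mx 1 + v) u)
   = (\<Sum>v\<in>mons d 1 (n - 2). \<Sum>m1\<in>mons d 1 (n - 2). Q d n (mx 1 + m1) (mx 1 + v) * f v * tR (m1 + u))"
    by (simp add: cPhi_def sum_distrib_left ac_simps)
  also have "\<dots> = (\<Sum>m1\<in>mons d 1 (n - 2). \<Sum>v\<in>mons d 1 (n - 2). Q d n (mx 1 + m1) (mx 1 + v) * f v * tR (m1 + u))"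
    by (rule sum.swap)
  finally show ?thesis .
qed

text \<open>The sums of the terms in the matrix of an intermediate differential, as pairs with components
  in \<open>K\<close> and \<open>L\<close>.\<close>

lemma assemble_br_X:
  assumes "T1 = (E1, 0)" "T2 = (E2, 0)" "T3 + T4 = (G, 0)" "T5 = (0, F1)" "T6 = (0, F2)" "T7 = (0, F3)"
  shows "x *\<^sub>B T1 + x *\<^sub>B T2 + e *\<^sub>B T3 + e *\<^sub>B T4 + x *\<^sub>B T5 + x *\<^sub>B T6 + (- x) *\<^sub>B T7
    = (smul x (E1 + E2) + smul e G, smul x (F1 + F2 - F3))"
proof -
  have "e *\<^sub>B T3 + e *\<^sub>B T4 = e *\<^sub>B (T3 + T4)" by (simp add: smulB_def smul_add)
  then have "e *\<^sub>B T3 + e *\<^sub>B T4 = (smul e G, 0)" unfolding assms(3) smulB_Pair .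
  moreover have "x *\<^sub>B T1 + x *\<^sub>B T2 + e *\<^sub>B T3 + e *\<^sub>B T4 + x *\<^sub>B T5 + x *\<^sub>B T6 + (- x) *\<^sub>B T7
    = x *\<^sub>B T1 + x *\<^sub>B T2 + (e *\<^sub>B T3 + e *\<^sub>B T4) + x *\<^sub>B T5 + x *\<^sub>B T6 + (- x) *\<^sub>B T7"
    by (simp only: add.assoc)
  ultimately show ?thesis
    by (simp add: assms smulB_Pair smul_add smul_diff)
qed

lemma assemble_br_Y:
  assumes "T1 = (E1, 0)" "T2 = (E2, 0)" "T3 = (0, F0)" "T4 = (0, F1)" "T5 = (0, F2)" "T6 = (0, F3)"
    "T7 = (0, G)" "T8 + T9 = (0, smul (- (e * y)) H)"
  shows "x *\<^sub>B T1 + x *\<^sub>B T2 + x *\<^sub>B T3 + x *\<^sub>B T4 + x *\<^sub>B T5 + x *\<^sub>B T6 + e *\<^sub>B T7 + T8 + T9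
    = (smul x (E1 + E2), smul x (F0 + F1 + F2 + F3) + smul e (G + smul (- y) H))"
proof -
  have "x *\<^sub>B T1 + x *\<^sub>B T2 + x *\<^sub>B T3 + x *\<^sub>B T4 + x *\<^sub>B T5 + x *\<^sub>B T6 + e *\<^sub>B T7 + T8 + T9
    = x *\<^sub>B T1 + x *\<^sub>B T2 + x *\<^sub>B T3 + x *\<^sub>B T4 + x *\<^sub>B T5 + x *\<^sub>B T6 + e *\<^sub>B T7 + (T8 + T9)"
    by (simp only: add.assoc)
  then show ?thesis
    unfolding assms by (simp add: smulB_Pair smul_add smul_diff smul_mult)
qed

context index_seq
begin

lemma sum_sg_S: "(\<Sum>i\<in>S. smul (sg S i) (g i)) = (\<Sum>k=1..r. smul ((-1) ^ k) (- g (a k)))"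
  unfolding sum_S by (intro sum.cong refl) (simp add: sg_S)

lemma sum_xR_sg_S: "(\<Sum>i\<in>S. smul (- (xR i * sg S i)) (g i)) = (\<Sum>k=1..r. smul (xR (a k) * (-1) ^ k) (g (a k)))"
  unfolding sum_S by (intro sum.cong refl) (simp add: sg_S)

text \<open>The generator \<open>\<kappa>(e\<^bsub>S - a\<^sub>1\<^esub> \<otimes> m)\<close> in the basis: it is a basis element unless the least
  variable of \<open>m\<close> is below \<open>a\<^sub>2\<close>. In each case the summand that belongs to the other case has
  coefficient zero, so it does not matter whether its indices are those of basis elements.\<close>

lemma expand_Kos_hY:
  assumes r: "2 \<le> r" "r \<le> d - 1" and n: "2 \<le> n" and m: "m \<in> mons d (a 1) (n - 1)"
  shows "(- (c * xR (a 1) * of_bool (a 2 \<le> least m))) *\<^sub>B Y d n (r-1) (hat a 2 r {}) m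
        + (- (c * xR (a 1) * of_bool (least m < a 2)))
            *\<^sub>B (\<Sum>k=2..r. (-1) ^ k
              *\<^sub>B Y d n (r-1) (least m # hat a 2 r {k}) (mx (a k) + m - mx (least m)))
    = (0, smul (- (c * xR (a 1))) (hY d (S - {a 1}) m))"
proof (cases "least m < a 2")
  case False
  have "m \<in> mons d (a 2) (n - 1)"
    using least_mem(4)[OF m] False n mons_mono[of "a 2" "least m"] by auto
  then show ?thesis using False by (simp add: Y_remove_first[OF r] smulB_Pair)
next
  case True
  let ?l = "least m"
  have l: "dvdx ?l m" "a 1 \<le> ?l" "?l \<le> d" "m \<in> mons d ?l (n - 1)" using least_mem[OF m] n by auto
  have v: "m - mx ?l \<in> mons d ?l (n - 1 - 1)" using minus_mx_mons[OF l(4,1)] .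
  have "1 \<in> {1..r}" "1 \<le> ?l" using r l range[of 1] by auto
  moreover have "?l < a j" if "j \<in> {1..r} - {1}" for j
    using le_iff[of 2 j] that True r by fastforce
  ultimately have "hY d (S - {a 1}) (mx ?l + (m - mx ?l)) = (\<Sum>j\<in>{1..r} - {1}. smul (if 1 < j then (-1) ^ j else - ((-1) ^ j))
          (hY d (insert ?l (S - {a j, a 1})) (mx (a j) + (m - mx ?l)) :: _ \<Rightarrow>\<^sub>0 R))"
    using l by (intro hY_straighten_S)
  also have "{1..r} - {1} = {2..r}" by auto
  also have "(\<Sum>j=2..r. smul (if 1 < j then (-1) ^ j else - ((-1) ^ j))
          (hY d (insert ?l (S - {a j, a 1})) (mx (a j) + (m - mx ?l)) :: _ \<Rightarrow>\<^sub>0 R))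
     = (\<Sum>k=2..r. smul ((-1) ^ k) (hY d (insert ?l (S - {a 1, a k})) (mx (a k) + (m - mx ?l))))"
    by (intro sum.cong refl) (auto simp: insert_commute)
  finally have st: "hY d (S - {a 1}) m = (\<Sum>k=2..r. smul ((-1) ^ k) (hY d (insert ?l (S - {a 1, a k})) (mx (a k) + (m - mx ?l))) :: _ \<Rightarrow>\<^sub>0 R)"
    by (simp only: mx_add_minus[OF l(1)])
  have "(\<Sum>k=2..r. (-1) ^ k *\<^sub>B Y d n (r-1) (?l # hat a 2 r {k}) (mx (a k) + m - mx ?l))
     = (\<Sum>k=2..r. (0, smul ((-1) ^ k) (hY d (insert ?l (S - {a 1, a k})) (mx (a k) + (m - mx ?l)))))"
  proof (rule sum.cong[OF refl])
    fix k assume k: "k \<in> {2..r}"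
    have "?l < a k" "a k \<le> d" using le_iff[of 2 k] k True r range[of k] by auto
    then have "mx (a k) + (m - mx ?l) \<in> mons d ?l (n - 1)"
      using v n by (subst mx_add_mons) auto
    then show "(-1) ^ k *\<^sub>B Y d n (r-1) (?l # hat a 2 r {k}) (mx (a k) + m - mx ?l)
      = (0, smul ((-1) ^ k) (hY d (insert ?l (S - {a 1, a k})) (mx (a k) + (m - mx ?l))))"
      using Y_replace_first[OF r l(2) True k] by (simp only: mx_add_minus_other[OF l(1)] smulB_Pair)
  qed
  then show ?thesis using True by (simp add: sum_Pair_snd st smulB_Pair)
qed

end

context index_seq_gap
begin

text \<open>The generators \<open>\<eta>(e\<^bsub>S - a\<^sub>j\<^esub> \<otimes> m\<^sup>*)\<close> in the basis: those with \<open>j < least(m)\<close>, for which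
  \<open>a\<^sub>j = j + 1 \<le> least(m)\<close>, have to be straightened.\<close>

lemma expand_Kos_hX:
  assumes r: "2 \<le> r" "r \<le> d - 1" and n: "1 \<le> n" and m: "m \<in> mons d 2 n" and lm: "{2..least m} \<subseteq> S"
  shows "(\<Sum>j\<in>{1..<least m}. \<Sum>k=j+1..r. (xR (a j) * (-1) ^ (k+1) * of_bool (dvdx (a k) m))
            *\<^sub>B X d n (r-1) (hat a 1 r {k}) (mx (j+1) + m - mx (a k)))
      + (\<Sum>j=least m..r. (xR (a j) * (-1) ^ j) *\<^sub>B X d n (r-1) (hat a 1 r {j}) m)
    = (\<Sum>k=1..r. smul (xR (a k) * (-1) ^ k) (hX d (S - {a k}) m), 0)"
proof -
  have lg: "least m \<le> \<gamma>" using maximal lm by (simp add: S_def)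
  have l: "dvdx (least m) m" "2 \<le> least m" "m \<in> mons d (least m) n" using least_mem[OF m n] by auto
  have 1: "(\<Sum>k=j+1..r. (xR (a j) * (-1) ^ (k+1) * of_bool (dvdx (a k) m))
            *\<^sub>B X d n (r-1) (hat a 1 r {k}) (mx (j+1) + m - mx (a k)))
     = (smul (xR (a j) * (-1) ^ j) (hX d (S - {a j}) m), 0)" if j: "j \<in> {1..<least m}" for j
  proof -
    have j': "j + 1 \<in> {2..\<gamma>}" using j lg by auto
    have aj: "a j = j + 1" using a_initial[of j] j lg by auto
    have mj: "m \<in> mons d (j + 1) n" using l(3) mons_mono[of "j + 1" "least m"] j by auto
    have st: "hX d (S - {a j}) m = (\<Sum>k=j+1..r. smul (- ((-1) ^ j) * (-1) ^ k * of_bool (dvdx (a k) m))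
       (hX d (S - {a k}) (mx (j+1) + (m - mx (a k)))) :: _ \<Rightarrow>\<^sub>0 R)"
      using hX_straighten_initial[OF j' mj] unfolding aj by simp
    have "(\<Sum>k=j+1..r. (xR (a j) * (-1) ^ (k+1) * of_bool (dvdx (a k) m))
            *\<^sub>B X d n (r-1) (hat a 1 r {k}) (mx (j+1) + m - mx (a k)))
      = (\<Sum>k=j+1..r. (smul (xR (a j) * (-1) ^ (k+1) * of_bool (dvdx (a k) m)) (hX d (S - {a k}) (mx (j+1) + (m - mx (a k)))), 0))"
    proof (rule sum.cong[OF refl])
      fix k assume k: "k \<in> {j+1..r}"
      show "(xR (a j) * (-1) ^ (k+1) * of_bool (dvdx (a k) m)) *\<^sub>B X d n (r-1) (hat a 1 r {k}) (mx (j+1) + m - mx (a k))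
        = (smul (xR (a j) * (-1) ^ (k+1) * of_bool (dvdx (a k) m)) (hX d (S - {a k}) (mx (j+1) + (m - mx (a k)))), 0)"
      proof (cases "dvdx (a k) m")
        case True
        have "X d n (r-1) (hat a 1 r {k}) (mx (j+1) + (m - mx (a k))) = (hX d (S - {a k}) (mx (j+1) + (m - mx (a k))), 0)"
          using X_remove[OF r n j' k minus_mx_mons[OF mj True]] .
        then show ?thesis by (simp only: mx_add_minus_other[OF True] smulB_Pair)
      qed (simp add: zero_prod_def)
    qed
    also have "\<dots> = (smul (xR (a j) * (-1) ^ j) (hX d (S - {a j}) m), 0)"
    proof -
      have "(-1) ^ j * ((-1) ^ j * c) = (c :: R)" for c
        by (simp flip: mult.assoc power_mult_distrib)
      then show ?thesis
        unfolding sum_Pair_fst st smul_sum smul_mult[symmetric] by (simp add: power_add mult.assoc)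
    qed
    finally show ?thesis .
  qed
  have 2: "(xR (a j) * (-1) ^ j) *\<^sub>B X d n (r-1) (hat a 1 r {j}) m
     = (smul (xR (a j) * (-1) ^ j) (hX d (S - {a j}) m), 0)" if j: "j \<in> {least m..r}" for j
  proof -
    have "X d n (r-1) (hat a 1 r {j}) (mx (least m) + (m - mx (least m)))
        = (hX d (S - {a j}) (mx (least m) + (m - mx (least m))), 0)"
      using r n l lg j by (intro X_remove minus_mx_mons) auto
    then show ?thesis by (simp only: mx_add_minus[OF l(1)] smulB_Pair)
  qed
  have "{1..r} = {1..<least m} \<union> {least m..r}" using l lg gap_le by auto
  then have "(\<Sum>k=1..r. smul (xR (a k) * (-1) ^ k) (hX d (S - {a k}) m))
    = (\<Sum>j\<in>{1..<least m}. smul (xR (a j) * (-1) ^ j) (hX d (S - {a j}) m))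
     + (\<Sum>j=least m..r. smul (xR (a j) * (-1) ^ j) (hX d (S - {a j}) m))"
    by (simp only:) (rule sum.union_disjoint, auto)
  moreover have "(\<Sum>j\<in>{1..<least m}. \<Sum>k=j+1..r. (xR (a j) * (-1) ^ (k+1) * of_bool (dvdx (a k) m))
            *\<^sub>B X d n (r-1) (hat a 1 r {k}) (mx (j+1) + m - mx (a k)))
      = (\<Sum>j\<in>{1..<least m}. smul (xR (a j) * (-1) ^ j) (hX d (S - {a j}) m), 0)"
    unfolding sum_Pair_fst[symmetric] by (rule sum.cong[OF refl]) (rule 1)
  moreover have "(\<Sum>j=least m..r. (xR (a j) * (-1) ^ j) *\<^sub>B X d n (r-1) (hat a 1 r {j}) m)
      = (\<Sum>j=least m..r. smul (xR (a j) * (-1) ^ j) (hX d (S - {a j}) m), 0)"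
    unfolding sum_Pair_fst[symmetric] by (rule sum.cong[OF refl]) (rule 2)
  ultimately show ?thesis by (simp only: add_Pair add_0_left)
qed

lemma br_X:
  assumes r: "2 \<le> r" "r \<le> d - 1" and n: "2 \<le> n" and X: "inX d n r (hat a 1 r {}) m"
  shows "br d n r (X d n r (hat a 1 r {}) m) =
          xR 1 *\<^sub>B (\<Sum>l=2..\<gamma>. \<Sum>k=l..r. \<Sum>m2\<in>mons d l (n-1). \<Sum>m1\<in>mons d 1 (n-2).
            ((-1) ^ k *
              (of_bool (dvdx (a k) m) * tR (m1 + m2 + mx l) * Q d n (mx 1 + m1) (m - mx (a k))
               - of_bool (dvdx l m) * tR (m1 + m2 + mx (a k)) * Q d n (mx 1 + m1) (m - mx l)))
            *\<^sub>B X d n (r-1) (hat a 1 r {k}) (mx l + m2))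
        + xR 1 *\<^sub>B (\<Sum>j=\<gamma>..r. \<Sum>k=j+1..r. \<Sum>m2\<in>mons d (\<gamma>+1) (n-1). \<Sum>m1\<in>mons d 1 (n-2).
            ((-1) ^ (\<gamma>+j+k) *
              (of_bool (dvdx (a k) m) * tR (m1 + m2 + mx (a j)) * Q d n (mx 1 + m1) (m - mx (a k))
               - of_bool (dvdx (a j) m) * tR (m1 + m2 + mx (a k)) * Q d n (mx 1 + m1) (m - mx (a j))))
            *\<^sub>B X d n (r-1) (hat a 1 (\<gamma>-1) {} @ [\<gamma>+1] @ hat a \<gamma> r {j,k}) (mx (\<gamma>+1) + m2))
        + delta d n *\<^sub>B (\<Sum>j\<in>{1..<least m}. \<Sum>k=j+1..r.
            (xR (a j) * (-1) ^ (k+1) * of_bool (dvdx (a k) m))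
            *\<^sub>B X d n (r-1) (hat a 1 r {k}) (mx (j+1) + m - mx (a k)))
        + delta d n *\<^sub>B (\<Sum>j=least m..r.
            (xR (a j) * (-1) ^ j) *\<^sub>B X d n (r-1) (hat a 1 r {j}) m)
        + xR 1 *\<^sub>B (\<Sum>k=2..r. \<Sum>m1\<in>mons d (a 1) (n-1).
            ((-1) ^ k *
              (of_bool (dvdx (a k) m) * Q d n m1 (m - mx (a k))
               - of_bool (dvdx (a k) m1) * of_bool (dvdx (a 1) m)
                 * Q d n (mx (a 1) + m1 - mx (a k)) (m - mx (a 1))))
            *\<^sub>B Y d n (r-1) (hat a 1 r {k}) m1)
        + xR 1 *\<^sub>B (\<Sum>l\<in>{a 1<..<a 2}. \<Sum>k=2..r. \<Sum>m1\<in>mons d l (n-1).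
            ((-1) ^ (k+1) * of_bool (dvdx (a k) m1) * of_bool (dvdx (a 1) m)
              * Q d n (mx l + m1 - mx (a k)) (m - mx (a 1)))
            *\<^sub>B Y d n (r-1) (l # hat a 2 r {k}) m1)
        + (- xR 1) *\<^sub>B (\<Sum>m1\<in>mons d (a 2) (n-1).
            (of_bool (dvdx (a 1) m) * Q d n m1 (m - mx (a 1)))
            *\<^sub>B Y d n (r-1) (hat a 2 r {}) m1)"
    (is "_ = xR 1 *\<^sub>B ?T1 + xR 1 *\<^sub>B ?T2 + delta d n *\<^sub>B ?T3 + delta d n *\<^sub>B ?T4 + xR 1 *\<^sub>B ?T5
      + xR 1 *\<^sub>B ?T6 + (- xR 1) *\<^sub>B ?T7")
proof -
  define A where "A i u = of_bool (dvdx i m) * cPhi d n (m - mx i) u" for i u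
  define B where "B i u = of_bool (dvdx i m) * Q d n u (m - mx i)" for i u
  have n1: "1 \<le> n" "1 \<le> n - 1" using n by auto
  have rd: "r < d" "1 \<le> d" using r by auto
  have m: "m \<in> mons d 2 n" "{2..least m} \<subseteq> S"
    using X by (auto simp: inX_def set_hat S_def)
  have XS: "X d n r (hat a 1 r {}) m = (hX d S m, 0)"
    using r m S_subset card_S by (intro X_eq_hX sorted_hat) (auto simp: set_hat_S)
  define E1 where "E1 = (\<Sum>l=2..\<gamma>. \<Sum>k=l..r. \<Sum>v\<in>mons d l (n - 1).
         smul ((-1) ^ k * (A (a k) (mx l + v) - A l (mx (a k) + v))) (hX d (S - {a k}) (mx l + v)))"
  define E2 where "E2 = (\<Sum>j=\<gamma>..r. \<Sum>k=j+1..r. \<Sum>v\<in>mons d (\<gamma> + 1) (n - 1).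
         smul ((-1) ^ (\<gamma> + j + k) * (A (a k) (mx (a j) + v) - A (a j) (mx (a k) + v)))
           (hX d (insert (\<gamma> + 1) S - {a j, a k}) (mx (\<gamma> + 1) + v)))"
  define G where "G = (\<Sum>k=1..r. smul (xR (a k) * (-1) ^ k) (hX d (S - {a k}) m))"
  define F1 where "F1 = (\<Sum>k=2..r. \<Sum>v\<in>mons d (a 1) (n - 1).
         smul ((-1) ^ k * (B (a k) v - of_bool (dvdx (a k) v) * B (a 1) (mx (a 1) + v - mx (a k))))
           (hY d (S - {a k}) v))"
  define F2 where "F2 = (\<Sum>l\<in>{a 1<..<a 2}. \<Sum>k=2..r. \<Sum>v\<in>mons d l (n - 1).
         smul ((-1) ^ (k + 1) * of_bool (dvdx (a k) v) * B (a 1) (mx l + v - mx (a k)))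
           (hY d (insert l (S - {a 1, a k})) v))"
  define F3 where "F3 = (\<Sum>v\<in>mons d (a 2) (n - 1). smul (B (a 1) v) (hY d (S - {a 1}) v))"
  \<comment> \<open>so the terms of the expansion in \<open>L\<close> with a least variable below \<open>a\<^sub>1\<close> do not occur\<close>
  have "2 \<in> S" using m(2) least_mem(2)[OF m(1) n1(1)] by auto
  then have a1: "a 1 = 2" using le_iff[of 1] range[of 1] r by (force simp: S_def)
  have ex: "(\<Sum>i\<in>S. smul (- sg S i) (\<Sum>u\<in>mons d 2 n. smul (A i u) (hX d (S - {i}) u))) = E1 + E2"
    unfolding smul_uminus_sum sum_sg_S E1_def E2_def expand_hX[OF rd(1) n1(1), symmetric] by (simp add: sum_negf)
  have ey: "(\<Sum>i\<in>S. smul (- sg S i) (\<Sum>u\<in>mons d 2 (n - 1). smul (B i u) (hY d (S - {i}) u))) = F1 + F2 - F3"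
    using expand_hY[OF r(1) n1(2), of B] unfolding smul_uminus_sum sum_sg_S F1_def F2_def F3_def
    by (simp add: a1 sum_negf)
  have br: "br d n r (X d n r (hat a 1 r {}) m) = (smul (xR 1) (E1 + E2) + smul (delta d n) G, smul (xR 1) (F1 + F2 - F3))"
  proof -
    have "br d n r (hX d S m, 0) = linB (brK d n) (hX d S m)"
      using r m S_subset card_S by (intro br_hX) auto
    then show ?thesis
      unfolding XS linB_brK_hX[OF n rd(2) S_subset m(1)] A_def[symmetric] B_def[symmetric] ex ey sum_xR_sg_S G_def .
  qed
  have t1: "?T1 = (E1, 0)"
    unfolding E1_def sum_Pair_fst[symmetric]
  proof (intro sum.cong refl)
    fix l k v assume h: "l \<in> {2..\<gamma>}" "k \<in> {l..r}" "v \<in> mons d l (n - 1)"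
    show "(\<Sum>m1\<in>mons d 1 (n-2). ((-1) ^ k *
              (of_bool (dvdx (a k) m) * tR (m1 + v + mx l) * Q d n (mx 1 + m1) (m - mx (a k))
               - of_bool (dvdx l m) * tR (m1 + v + mx (a k)) * Q d n (mx 1 + m1) (m - mx l)))
            *\<^sub>B X d n (r-1) (hat a 1 r {k}) (mx l + v))
       = (smul ((-1) ^ k * (A (a k) (mx l + v) - A l (mx (a k) + v))) (hX d (S - {a k}) (mx l + v)), 0)"
      unfolding sum_smulB_left unfolding X_remove[OF r n1(1) h] smulB_Pair A_def cPhi_def
      by (intro arg_cong2[where f = Pair] arg_cong2[where f = smul] refl)
         (simp add: sum_distrib_left sum_subtractf right_diff_distrib ac_simps)
  qed
  have t2: "?T2 = (E2, 0)"
    unfolding E2_def sum_Pair_fst[symmetric]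
  proof (intro sum.cong refl)
    fix j k v assume h: "j \<in> {\<gamma>..r}" "k \<in> {j+1..r}" "v \<in> mons d (\<gamma> + 1) (n - 1)"
    have "\<gamma> \<le> j" "j < k" "k \<le> r" using h by auto
    note Xe = X_fill_gap[OF r n1(1) this h(3)]
    show "(\<Sum>m1\<in>mons d 1 (n-2). ((-1) ^ (\<gamma>+j+k) *
              (of_bool (dvdx (a k) m) * tR (m1 + v + mx (a j)) * Q d n (mx 1 + m1) (m - mx (a k))
               - of_bool (dvdx (a j) m) * tR (m1 + v + mx (a k)) * Q d n (mx 1 + m1) (m - mx (a j))))
            *\<^sub>B X d n (r-1) (hat a 1 (\<gamma>-1) {} @ [\<gamma>+1] @ hat a \<gamma> r {j,k}) (mx (\<gamma>+1) + v))
       = (smul ((-1) ^ (\<gamma> + j + k) * (A (a k) (mx (a j) + v) - A (a j) (mx (a k) + v)))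
           (hX d (insert (\<gamma> + 1) S - {a j, a k}) (mx (\<gamma> + 1) + v)), 0)"
      unfolding sum_smulB_left unfolding Xe smulB_Pair A_def cPhi_def
      by (intro arg_cong2[where f = Pair] arg_cong2[where f = smul] refl)
         (simp add: sum_distrib_left sum_subtractf right_diff_distrib ac_simps)
  qed
  have t34: "?T3 + ?T4 = (G, 0)"
    unfolding G_def by (rule expand_Kos_hX[OF r n1(1) m])
  have t5: "?T5 = (0, F1)"
    unfolding F1_def sum_Pair_snd[symmetric] B_def
    by (intro sum.cong refl) (simp add: Y_remove[OF r(2)] smulB_Pair mult.assoc)
  have t6: "?T6 = (0, F2)"
    unfolding F2_def sum_Pair_snd[symmetric] B_def
    by (intro sum.cong refl) (simp add: Y_replace_first[OF r] smulB_Pair mult.assoc)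
  have t7: "?T7 = (0, F3)"
    unfolding F3_def sum_Pair_snd[symmetric] B_def
    by (intro sum.cong refl) (simp add: Y_remove_first[OF r] smulB_Pair)
  show ?thesis
    unfolding br by (rule assemble_br_X[OF t1 t2 t34 t5 t6 t7, symmetric])
qed

lemma br_Y:
  assumes r: "2 \<le> r" "r \<le> d - 1" and n: "2 \<le> n" and Y: "inY d n r (hat a 1 r {}) m"
  shows "br d n r (Y d n r (hat a 1 r {}) m) =
          xR 1 *\<^sub>B (\<Sum>l=2..\<gamma>. \<Sum>k=l..r. \<Sum>m3\<in>mons d l (n-1).
              \<Sum>m1\<in>mons d 1 (n-2). \<Sum>m2\<in>mons d 1 (n-2).
            ((-1) ^ k * Q d n (mx 1 + m1) (mx 1 + m2) *
              (tR (mx l + m + m2) * tR (mx (a k) + m1 + m3)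
               - tR (mx (a k) + m + m2) * tR (mx l + m1 + m3)))
            *\<^sub>B X d n (r-1) (hat a 1 r {k}) (mx l + m3))
        + xR 1 *\<^sub>B (\<Sum>j=\<gamma>..r. \<Sum>k=j+1..r. \<Sum>m3\<in>mons d (\<gamma>+1) (n-1).
              \<Sum>m1\<in>mons d 1 (n-2). \<Sum>m2\<in>mons d 1 (n-2).
            ((-1) ^ (j+\<gamma>+k) * Q d n (mx 1 + m1) (mx 1 + m2) *
              (tR (mx (a j) + m + m2) * tR (mx (a k) + m1 + m3)
               - tR (mx (a k) + m + m2) * tR (mx (a j) + m1 + m3)))
            *\<^sub>B X d n (r-1) (hat a 1 (\<gamma>-1) {} @ [\<gamma>+1] @ hat a \<gamma> r {j,k}) (mx (\<gamma>+1) + m3))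
        + xR 1 *\<^sub>B (\<Sum>l\<in>{2..<a 1}. \<Sum>j=1..r. \<Sum>k=j+1..r. \<Sum>m1\<in>mons d l (n-1).
              \<Sum>m2\<in>mons d 1 (n-2).
            ((-1) ^ (k+j) *
              (of_bool (dvdx (a j) m1) * tR (mx (a k) + m + m2)
                 * Q d n (mx l + m1 - mx (a j)) (mx 1 + m2)
               - of_bool (dvdx (a k) m1) * tR (mx (a j) + m + m2)
                 * Q d n (mx l + m1 - mx (a k)) (mx 1 + m2)))
            *\<^sub>B Y d n (r-1) (l # hat a 1 r {j,k}) m1)
        + xR 1 *\<^sub>B (\<Sum>k=2..r. \<Sum>m1\<in>mons d (a 1) (n-1). \<Sum>m2\<in>mons d 1 (n-2).
            ((-1) ^ k *
              (of_bool (dvdx (a k) m1) * tR (mx (a 1) + m + m2)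
                 * Q d n (mx (a 1) + m1 - mx (a k)) (mx 1 + m2)
               - tR (mx (a k) + m + m2) * Q d n m1 (mx 1 + m2)))
            *\<^sub>B Y d n (r-1) (hat a 1 r {k}) m1)
        + xR 1 *\<^sub>B (\<Sum>l\<in>{a 1<..<a 2}. \<Sum>k=2..r. \<Sum>m1\<in>mons d l (n-1). \<Sum>m2\<in>mons d 1 (n-2).
            ((-1) ^ k * of_bool (dvdx (a k) m1) * tR (mx (a 1) + m + m2)
              * Q d n (mx l + m1 - mx (a k)) (mx 1 + m2))
            *\<^sub>B Y d n (r-1) (l # hat a 2 r {k}) m1)
        + xR 1 *\<^sub>B (\<Sum>m1\<in>mons d (a 2) (n-1). \<Sum>m2\<in>mons d 1 (n-2).
            (tR (mx (a 1) + m + m2) * Q d n m1 (mx 1 + m2))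
            *\<^sub>B Y d n (r-1) (hat a 2 r {}) m1)
        + delta d n *\<^sub>B (\<Sum>j=2..r.
            ((-1) ^ j * xR (a j)) *\<^sub>B Y d n (r-1) (hat a 1 r {j}) m)
        + (- (delta d n * xR (a 1) * of_bool (a 2 \<le> least m)))
            *\<^sub>B Y d n (r-1) (hat a 2 r {}) m
        + (- (delta d n * xR (a 1) * of_bool (least m < a 2)))
            *\<^sub>B (\<Sum>k=2..r. (-1) ^ k
              *\<^sub>B Y d n (r-1) (least m # hat a 2 r {k}) (mx (a k) + m - mx (least m)))"
    (is "_ = xR 1 *\<^sub>B ?T1 + xR 1 *\<^sub>B ?T2 + xR 1 *\<^sub>B ?T3 + xR 1 *\<^sub>B ?T4 + xR 1 *\<^sub>B ?T5
      + xR 1 *\<^sub>B ?T6 + delta d n *\<^sub>B ?T7 + ?T8 + ?T9")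
proof -
  define A where "A i u = (\<Sum>v\<in>mons d 1 (n - 2). tR (mx i + m + v) * cPhi d n (mx 1 + v) u)" for i u
  define B where "B i u = (\<Sum>v\<in>mons d 1 (n - 2). tR (mx i + m + v) * Q d n u (mx 1 + v))" for i u
  have n1: "1 \<le> n" "1 \<le> n - 1" using n by auto
  have rd: "r < d" "1 \<le> d" using r by auto
  have "hat a 1 r {} = a 1 # hat a 2 r {}"
    using r by (simp add: hat_def upt_conv_Cons numeral_2_eq_2 One_nat_def)
  then have m: "m \<in> mons d (a 1) (n - 1)" using Y by (simp add: inY_def)
  have m2: "m \<in> mons d 2 (n - 1)" using mons_mono[OF _ m, of 2] range[of 1] r by auto
  have a1: "a 1 \<in> S" "\<And>i. i \<in> S \<Longrightarrow> a 1 \<le> i" using mem_S[of 1] r le_iff[of 1] by (auto simp: S_def)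
  have YS: "Y d n r (hat a 1 r {}) m = (0, hY d S m)"
    using r m S_subset card_S a1 by (intro Y_eq_hY[where l = "a 1"] sorted_hat) (auto simp: set_hat_S)
  define E1 where "E1 = (\<Sum>l=2..\<gamma>. \<Sum>k=l..r. \<Sum>v\<in>mons d l (n - 1).
         smul ((-1) ^ k * (A l (mx (a k) + v) - A (a k) (mx l + v))) (hX d (S - {a k}) (mx l + v)))"
  define E2 where "E2 = (\<Sum>j=\<gamma>..r. \<Sum>k=j+1..r. \<Sum>v\<in>mons d (\<gamma> + 1) (n - 1).
         smul ((-1) ^ (\<gamma> + j + k) * (A (a j) (mx (a k) + v) - A (a k) (mx (a j) + v)))
           (hX d (insert (\<gamma> + 1) S - {a j, a k}) (mx (\<gamma> + 1) + v)))"
  define F0 where "F0 = (\<Sum>l\<in>{2..<a 1}. \<Sum>j=1..r. \<Sum>k=j+1..r. \<Sum>v\<in>mons d l (n - 1).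
         smul ((-1) ^ (k + j) * (of_bool (dvdx (a j) v) * B (a k) (mx l + v - mx (a j))
                                 - of_bool (dvdx (a k) v) * B (a j) (mx l + v - mx (a k))))
           (hY d (insert l (S - {a j, a k})) v))"
  define F1 where "F1 = (\<Sum>k=2..r. \<Sum>v\<in>mons d (a 1) (n - 1).
         smul ((-1) ^ k * (of_bool (dvdx (a k) v) * B (a 1) (mx (a 1) + v - mx (a k)) - B (a k) v))
           (hY d (S - {a k}) v))"
  define F2 where "F2 = (\<Sum>l\<in>{a 1<..<a 2}. \<Sum>k=2..r. \<Sum>v\<in>mons d l (n - 1).
         smul ((-1) ^ k * of_bool (dvdx (a k) v) * B (a 1) (mx l + v - mx (a k)))
           (hY d (insert l (S - {a 1, a k})) v))"
  define F3 where "F3 = (\<Sum>v\<in>mons d (a 2) (n - 1). smul (B (a 1) v) (hY d (S - {a 1}) v))"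
  define G where "G = (\<Sum>j=2..r. smul ((-1) ^ j * xR (a j)) (hY d (S - {a j}) m))"
  have ex: "(\<Sum>i\<in>S. smul (sg S i) (\<Sum>u\<in>mons d 2 n. smul (A i u) (hX d (S - {i}) u))) = E1 + E2"
    using expand_hX[OF rd(1) n1(1), of "\<lambda>i u. - A i u"] unfolding sum_sg_S E1_def E2_def
    by (simp add: sum_negf)
  have ey: "(\<Sum>i\<in>S. smul (sg S i) (\<Sum>u\<in>mons d 2 (n - 1). smul (B i u) (hY d (S - {i}) u))) = F0 + F1 + F2 + F3"
  proof -
    have "(\<Sum>i\<in>S. smul (sg S i) (\<Sum>u\<in>mons d 2 (n - 1). smul (B i u) (hY d (S - {i}) u)))
       = (\<Sum>k=1..r. smul ((-1) ^ k) (\<Sum>u\<in>mons d 2 (n - 1). smul (- B (a k) u) (hY d (S - {a k}) u)))"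
      unfolding sum_sg_S by (simp add: sum_negf)
    also have "\<dots> = F0 + F1 + F2 + F3"
      unfolding expand_hY[OF r(1) n1(2), of "\<lambda>i u. - B i u"] F0_def F1_def F2_def F3_def
      by (intro arg_cong2[where f = "(+)"] sum.cong refl arg_cong2[where f = smul])
         (simp_all add: algebra_simps power_add)
    finally show ?thesis .
  qed
  have eg: "(\<Sum>k=1..r. smul (xR (a k) * (-1) ^ k) (hY d (S - {a k}) m)) = G + smul (- xR (a 1)) (hY d (S - {a 1}) m)"
  proof -
    have "{1..r} = insert 1 {2..r}" using r by auto
    then show ?thesis by (simp add: G_def mult.commute)
  qed
  have br: "br d n r (Y d n r (hat a 1 r {}) m) = (smul (xR 1) (E1 + E2),
      smul (xR 1) (F0 + F1 + F2 + F3) + smul (delta d n) (G + smul (- xR (a 1)) (hY d (S - {a 1}) m)))"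
  proof -
    have "br d n r (0, hY d S m) = linB (brL d n) (hY d S m)"
      using r m2 S_subset card_S n by (intro br_hY) auto
    then show ?thesis
      unfolding YS linB_brL_hY[OF n rd(2) S_subset m2] A_def[symmetric] B_def[symmetric] ex ey sum_xR_sg_S eg .
  qed
  have t1: "?T1 = (E1, 0)"
    unfolding E1_def sum_Pair_fst[symmetric]
  proof (intro sum.cong refl)
    fix l k v assume h: "l \<in> {2..\<gamma>}" "k \<in> {l..r}" "v \<in> mons d l (n - 1)"
    show "(\<Sum>m1\<in>mons d 1 (n-2). \<Sum>m2\<in>mons d 1 (n-2).
            ((-1) ^ k * Q d n (mx 1 + m1) (mx 1 + m2) *
              (tR (mx l + m + m2) * tR (mx (a k) + m1 + v)
               - tR (mx (a k) + m + m2) * tR (mx l + m1 + v)))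
            *\<^sub>B X d n (r-1) (hat a 1 r {k}) (mx l + v))
       = (smul ((-1) ^ k * (A l (mx (a k) + v) - A (a k) (mx l + v))) (hX d (S - {a k}) (mx l + v)), 0)"
      unfolding sum_smulB_left unfolding X_remove[OF r n1(1) h] smulB_Pair A_def cPhi_combine
      by (intro arg_cong2[where f = Pair] arg_cong2[where f = smul] refl)
         (simp add: sum_distrib_left sum_subtractf right_diff_distrib ac_simps)
  qed
  have t2: "?T2 = (E2, 0)"
    unfolding E2_def sum_Pair_fst[symmetric]
  proof (intro sum.cong refl)
    fix j k v assume h: "j \<in> {\<gamma>..r}" "k \<in> {j+1..r}" "v \<in> mons d (\<gamma> + 1) (n - 1)"
    have "\<gamma> \<le> j" "j < k" "k \<le> r" using h by auto
    note Xe = X_fill_gap[OF r n1(1) this h(3)]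
    show "(\<Sum>m1\<in>mons d 1 (n-2). \<Sum>m2\<in>mons d 1 (n-2).
            ((-1) ^ (j+\<gamma>+k) * Q d n (mx 1 + m1) (mx 1 + m2) *
              (tR (mx (a j) + m + m2) * tR (mx (a k) + m1 + v)
               - tR (mx (a k) + m + m2) * tR (mx (a j) + m1 + v)))
            *\<^sub>B X d n (r-1) (hat a 1 (\<gamma>-1) {} @ [\<gamma>+1] @ hat a \<gamma> r {j,k}) (mx (\<gamma>+1) + v))
       = (smul ((-1) ^ (\<gamma> + j + k) * (A (a j) (mx (a k) + v) - A (a k) (mx (a j) + v)))
           (hX d (insert (\<gamma> + 1) S - {a j, a k}) (mx (\<gamma> + 1) + v)), 0)"
      unfolding sum_smulB_left unfolding Xe smulB_Pair A_def cPhi_combine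
      by (intro arg_cong2[where f = Pair] arg_cong2[where f = smul] refl)
         (simp add: sum_distrib_left sum_subtractf right_diff_distrib ac_simps)
  qed
  have t3: "?T3 = (0, F0)"
    unfolding F0_def sum_Pair_snd[symmetric]
  proof (intro sum.cong refl)
    fix l j k v assume h: "l \<in> {2..<a 1}" "j \<in> {1..r}" "k \<in> {j+1..r}" "v \<in> mons d l (n - 1)"
    have "Y d n (r-1) (l # hat a 1 r {j,k}) v = (0, hY d (insert l (S - {a j, a k})) v)"
      using h by (intro Y_prepend[OF r]) auto
    note Ye = this
    show "(\<Sum>m2\<in>mons d 1 (n-2).
            ((-1) ^ (k+j) *
              (of_bool (dvdx (a j) v) * tR (mx (a k) + m + m2)
                 * Q d n (mx l + v - mx (a j)) (mx 1 + m2)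
               - of_bool (dvdx (a k) v) * tR (mx (a j) + m + m2)
                 * Q d n (mx l + v - mx (a k)) (mx 1 + m2)))
            *\<^sub>B Y d n (r-1) (l # hat a 1 r {j,k}) v)
      = (0, smul ((-1) ^ (k + j) * (of_bool (dvdx (a j) v) * B (a k) (mx l + v - mx (a j))
                                 - of_bool (dvdx (a k) v) * B (a j) (mx l + v - mx (a k))))
           (hY d (insert l (S - {a j, a k})) v))"
      unfolding sum_smulB_left unfolding Ye smulB_Pair B_def
      by (simp only: sum_distrib_left sum_subtractf right_diff_distrib mult.assoc)
  qed
  have t4: "?T4 = (0, F1)"
    unfolding F1_def sum_Pair_snd[symmetric]
  proof (intro sum.cong refl)
    fix k v assume h: "k \<in> {2..r}" "v \<in> mons d (a 1) (n - 1)"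
    show "(\<Sum>m2\<in>mons d 1 (n-2).
            ((-1) ^ k *
              (of_bool (dvdx (a k) v) * tR (mx (a 1) + m + m2)
                 * Q d n (mx (a 1) + v - mx (a k)) (mx 1 + m2)
               - tR (mx (a k) + m + m2) * Q d n v (mx 1 + m2)))
            *\<^sub>B Y d n (r-1) (hat a 1 r {k}) v)
      = (0, smul ((-1) ^ k * (of_bool (dvdx (a k) v) * B (a 1) (mx (a 1) + v - mx (a k)) - B (a k) v))
           (hY d (S - {a k}) v))"
      unfolding sum_smulB_left unfolding Y_remove[OF r(2) h] smulB_Pair B_def
      by (simp only: sum_distrib_left sum_subtractf right_diff_distrib mult.assoc)
  qed
  have t5: "?T5 = (0, F2)"
    unfolding F2_def sum_Pair_snd[symmetric]
  proof (intro sum.cong refl)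
    fix l k v assume h: "l \<in> {a 1<..<a 2}" "k \<in> {2..r}" "v \<in> mons d l (n - 1)"
    have "Y d n (r-1) (l # hat a 2 r {k}) v = (0, hY d (insert l (S - {a 1, a k})) v)"
      using h by (intro Y_replace_first[OF r]) auto
    note Ye = this
    show "(\<Sum>m2\<in>mons d 1 (n-2).
            ((-1) ^ k * of_bool (dvdx (a k) v) * tR (mx (a 1) + m + m2)
              * Q d n (mx l + v - mx (a k)) (mx 1 + m2))
            *\<^sub>B Y d n (r-1) (l # hat a 2 r {k}) v)
      = (0, smul ((-1) ^ k * of_bool (dvdx (a k) v) * B (a 1) (mx l + v - mx (a k)))
           (hY d (insert l (S - {a 1, a k})) v))"
      unfolding sum_smulB_left unfolding Ye smulB_Pair B_def
      by (simp only: sum_distrib_left mult.assoc)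
  qed
  have t6: "?T6 = (0, F3)"
    unfolding F3_def sum_Pair_snd[symmetric]
    by (intro sum.cong refl) (simp add: Y_remove_first[OF r] smulB_Pair sum_Pair_snd sum_smul_left B_def)
  have t7: "?T7 = (0, G)"
    unfolding G_def sum_Pair_snd[symmetric]
    by (intro sum.cong refl) (simp add: Y_remove[OF r(2) _ m] smulB_Pair)
  have t89: "?T8 + ?T9 = (0, smul (- (delta d n * xR (a 1))) (hY d (S - {a 1}) m))"
    by (rule expand_Kos_hY[OF r n m])
  show ?thesis
    unfolding br by (rule assemble_br_Y[OF t1 t2 t3 t4 t5 t6 t7 t89, symmetric])
qed

end

theorem theorem8p6:
  fixes d n :: nat
  assumes "d \<ge> 3" and "n \<ge> 2"
  shows
    \<comment> \<open>(a)(i)\<close>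
    "(\<forall>a m. inX d n 1 [a] m \<longrightarrow>
        b1 d n (X d n 1 [a] m)
          = xR 1 * (\<Sum>m1\<in>mons d 1 (n-1). monR m1 * Q d n m1 (m - mx a))) \<and>
    \<comment> \<open>(a)(ii)\<close>
     (\<forall>a m. inY d n 1 [a] m \<longrightarrow>
        b1 d n (Y d n 1 [a] m)
          = delta d n * xR a * monR m
            - xR 1 * (\<Sum>m1\<in>mons d 1 (n-2). \<Sum>m2\<in>mons d 1 (n-1).
                monR m2 * Q d n m2 (mx 1 + m1) * tR (mx a + m1 + m))) \<and>
    \<comment> \<open>(b)(i)\<close>
     (\<forall>r a m \<gamma>. 2 \<le> r \<and> r \<le> d - 1 \<and> inX d n r (hat a 1 r {}) m \<and>
        {2..\<gamma>} \<subseteq> a ` {1..r} \<and> (\<forall>g. {2..g} \<subseteq> a ` {1..r} \<longrightarrow> g \<le> \<gamma>) \<longrightarrow>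
        br d n r (X d n r (hat a 1 r {}) m) =
          xR 1 *\<^sub>B (\<Sum>l=2..\<gamma>. \<Sum>k=l..r. \<Sum>m2\<in>mons d l (n-1). \<Sum>m1\<in>mons d 1 (n-2).
            ((-1) ^ k *
              (of_bool (dvdx (a k) m) * tR (m1 + m2 + mx l) * Q d n (mx 1 + m1) (m - mx (a k))
               - of_bool (dvdx l m) * tR (m1 + m2 + mx (a k)) * Q d n (mx 1 + m1) (m - mx l)))
            *\<^sub>B X d n (r-1) (hat a 1 r {k}) (mx l + m2))
        + xR 1 *\<^sub>B (\<Sum>j=\<gamma>..r. \<Sum>k=j+1..r. \<Sum>m2\<in>mons d (\<gamma>+1) (n-1). \<Sum>m1\<in>mons d 1 (n-2).
            ((-1) ^ (\<gamma>+j+k) *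
              (of_bool (dvdx (a k) m) * tR (m1 + m2 + mx (a j)) * Q d n (mx 1 + m1) (m - mx (a k))
               - of_bool (dvdx (a j) m) * tR (m1 + m2 + mx (a k)) * Q d n (mx 1 + m1) (m - mx (a j))))
            *\<^sub>B X d n (r-1) (hat a 1 (\<gamma>-1) {} @ [\<gamma>+1] @ hat a \<gamma> r {j,k}) (mx (\<gamma>+1) + m2))
        + delta d n *\<^sub>B (\<Sum>j\<in>{1..<least m}. \<Sum>k=j+1..r.
            (xR (a j) * (-1) ^ (k+1) * of_bool (dvdx (a k) m))
            *\<^sub>B X d n (r-1) (hat a 1 r {k}) (mx (j+1) + m - mx (a k)))
        + delta d n *\<^sub>B (\<Sum>j=least m..r.
            (xR (a j) * (-1) ^ j) *\<^sub>B X d n (r-1) (hat a 1 r {j}) m)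
        + xR 1 *\<^sub>B (\<Sum>k=2..r. \<Sum>m1\<in>mons d (a 1) (n-1).
            ((-1) ^ k *
              (of_bool (dvdx (a k) m) * Q d n m1 (m - mx (a k))
               - of_bool (dvdx (a k) m1) * of_bool (dvdx (a 1) m)
                 * Q d n (mx (a 1) + m1 - mx (a k)) (m - mx (a 1))))
            *\<^sub>B Y d n (r-1) (hat a 1 r {k}) m1)
        + xR 1 *\<^sub>B (\<Sum>l\<in>{a 1<..<a 2}. \<Sum>k=2..r. \<Sum>m1\<in>mons d l (n-1).
            ((-1) ^ (k+1) * of_bool (dvdx (a k) m1) * of_bool (dvdx (a 1) m)
              * Q d n (mx l + m1 - mx (a k)) (m - mx (a 1)))
            *\<^sub>B Y d n (r-1) (l # hat a 2 r {k}) m1)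
        + (- xR 1) *\<^sub>B (\<Sum>m1\<in>mons d (a 2) (n-1).
            (of_bool (dvdx (a 1) m) * Q d n m1 (m - mx (a 1)))
            *\<^sub>B Y d n (r-1) (hat a 2 r {}) m1)) \<and>
    \<comment> \<open>(b)(ii)\<close>
     (\<forall>r a m \<gamma>. 2 \<le> r \<and> r \<le> d - 1 \<and> inY d n r (hat a 1 r {}) m \<and>
        {2..\<gamma>} \<subseteq> a ` {1..r} \<and> (\<forall>g. {2..g} \<subseteq> a ` {1..r} \<longrightarrow> g \<le> \<gamma>) \<longrightarrow>
        br d n r (Y d n r (hat a 1 r {}) m) =
          xR 1 *\<^sub>B (\<Sum>l=2..\<gamma>. \<Sum>k=l..r. \<Sum>m3\<in>mons d l (n-1).
              \<Sum>m1\<in>mons d 1 (n-2). \<Sum>m2\<in>mons d 1 (n-2).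
            ((-1) ^ k * Q d n (mx 1 + m1) (mx 1 + m2) *
              (tR (mx l + m + m2) * tR (mx (a k) + m1 + m3)
               - tR (mx (a k) + m + m2) * tR (mx l + m1 + m3)))
            *\<^sub>B X d n (r-1) (hat a 1 r {k}) (mx l + m3))
        + xR 1 *\<^sub>B (\<Sum>j=\<gamma>..r. \<Sum>k=j+1..r. \<Sum>m3\<in>mons d (\<gamma>+1) (n-1).
              \<Sum>m1\<in>mons d 1 (n-2). \<Sum>m2\<in>mons d 1 (n-2).
            ((-1) ^ (j+\<gamma>+k) * Q d n (mx 1 + m1) (mx 1 + m2) *
              (tR (mx (a j) + m + m2) * tR (mx (a k) + m1 + m3)
               - tR (mx (a k) + m + m2) * tR (mx (a j) + m1 + m3)))
            *\<^sub>B X d n (r-1) (hat a 1 (\<gamma>-1) {} @ [\<gamma>+1] @ hat a \<gamma> r {j,k}) (mx (\<gamma>+1) + m3))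
        + xR 1 *\<^sub>B (\<Sum>l\<in>{2..<a 1}. \<Sum>j=1..r. \<Sum>k=j+1..r. \<Sum>m1\<in>mons d l (n-1).
              \<Sum>m2\<in>mons d 1 (n-2).
            ((-1) ^ (k+j) *
              (of_bool (dvdx (a j) m1) * tR (mx (a k) + m + m2)
                 * Q d n (mx l + m1 - mx (a j)) (mx 1 + m2)
               - of_bool (dvdx (a k) m1) * tR (mx (a j) + m + m2)
                 * Q d n (mx l + m1 - mx (a k)) (mx 1 + m2)))
            *\<^sub>B Y d n (r-1) (l # hat a 1 r {j,k}) m1)
        + xR 1 *\<^sub>B (\<Sum>k=2..r. \<Sum>m1\<in>mons d (a 1) (n-1). \<Sum>m2\<in>mons d 1 (n-2).
            ((-1) ^ k *
              (of_bool (dvdx (a k) m1) * tR (mx (a 1) + m + m2)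
                 * Q d n (mx (a 1) + m1 - mx (a k)) (mx 1 + m2)
               - tR (mx (a k) + m + m2) * Q d n m1 (mx 1 + m2)))
            *\<^sub>B Y d n (r-1) (hat a 1 r {k}) m1)
        + xR 1 *\<^sub>B (\<Sum>l\<in>{a 1<..<a 2}. \<Sum>k=2..r. \<Sum>m1\<in>mons d l (n-1). \<Sum>m2\<in>mons d 1 (n-2).
            ((-1) ^ k * of_bool (dvdx (a k) m1) * tR (mx (a 1) + m + m2)
              * Q d n (mx l + m1 - mx (a k)) (mx 1 + m2))
            *\<^sub>B Y d n (r-1) (l # hat a 2 r {k}) m1)
        + xR 1 *\<^sub>B (\<Sum>m1\<in>mons d (a 2) (n-1). \<Sum>m2\<in>mons d 1 (n-2).
            (tR (mx (a 1) + m + m2) * Q d n m1 (mx 1 + m2))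
            *\<^sub>B Y d n (r-1) (hat a 2 r {}) m1)
        + delta d n *\<^sub>B (\<Sum>j=2..r.
            ((-1) ^ j * xR (a j)) *\<^sub>B Y d n (r-1) (hat a 1 r {j}) m)
        + (- (delta d n * xR (a 1) * of_bool (a 2 \<le> least m)))
            *\<^sub>B Y d n (r-1) (hat a 2 r {}) m
        + (- (delta d n * xR (a 1) * of_bool (least m < a 2)))
            *\<^sub>B (\<Sum>k=2..r. (-1) ^ k
              *\<^sub>B Y d n (r-1) (least m # hat a 2 r {k}) (mx (a k) + m - mx (least m)))) \<and>
    \<comment> \<open>(c)\<close>
     bd d n (Xtop d) =
        (\<Sum>m\<in>mons d 2 n.
          (delta d n * monR m
            - (\<Sum>m1\<in>mons d 1 (n-2). \<Sum>m2\<in>mons d 1 (n-1).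
                xR 1 * monR m2 * Q d n m2 (mx 1 + m1) * tR (m1 + m)))
          *\<^sub>B X d n (d-1) [2..<Suc d] m)
      - (\<Sum>m\<in>mons d 2 (n-1). \<Sum>m1\<in>mons d 1 (n-1).
          (xR 1 * monR m1 * Q d n m1 m) *\<^sub>B Y d n (d-1) [2..<Suc d] m)"
proof (intro conjI allI impI, goal_cases)
  case (1 a m)
  then show ?case using assms by (intro b1_X) auto
next
  case (2 a m)
  then show ?case using assms by (intro b1_Y) auto
next
  case (3 r a m \<gamma>)
  then interpret index_seq a r d by (intro index_seqI) (auto simp: inX_def)
  interpret index_seq_gap a r d \<gamma> by unfold_locales (use 3 in auto)
  show ?case using 3 assms by (intro br_X) auto
next
  case (4 r a m \<gamma>)
  then interpret index_seq a r d by (intro index_seqI) (auto simp: inY_def)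
  interpret index_seq_gap a r d \<gamma> by unfold_locales (use 4 in auto)
  show ?case using 4 assms by (intro br_Y) auto
next
  case 5
  show ?case by (rule bd_Xtop[OF assms])
qed

end
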